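(* Let $D$ be an oriented prime knot diagram, endowed with the checkerboard coloring of its complementary regions in which the unbounded region is shaded. Let $b$ be the number of shaded regions and let $m$ be the number of all complementary regions. Order the regions as $R_1,\dots,R_m$ so that $R_1,\dots,R_b$ are exactly the shaded regions, and let $M_D$ be the Dehn coloring matrix of $D$ with respect to this ordering, so that its $j$-th column corresponds to $R_j$. Let $G$ be the $b\times b$ Goeritz matrix of $D$, with rows and columns indexed by $R_1,\dots,R_b$ in the same order. (1) For each $j\in\{1,\dots,b\}$, consider the rows of $M_D$ whose $j$-th entry is nonzero. One can multiply each of these rows by $+1$ or $-1$ so that the sum of the resulting rows is a row vector $v_j\in\mathbb{Z}^m$ whose entries in positions $b+1,\dots,m$ are all zero. Moreover, such a choice of signs is unique up to simultaneously changing all the signs; in particular $v_j$ is unique up to sign. (2) Let $v_1,\dots,v_b$ be row vectors obtained as in (1), and fix any one of them, say $v_{j_0}$. Then one can multiply each of the other row vectors $v_j$ ($j\neq j_0$) by $+1$ or $-1$ so that the $b\times m$ matrix with the resulting vectors as its rows, in order, has $G$ or $-G$ as the submatrix formed by its first $b$ columns, its remaining columns being zero.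
   Context: A checkerboard coloring of a knot diagram shades some of its complementary regions so that, of any two regions adjacent along an arc of the diagram, exactly one is shaded. The coloring used here is always the one in which the unbounded region is shaded. A knot diagram $D$ is called prime if any simple closed curve transversely intersecting the diagram in exactly two points bounds a disk which intersects the diagram in a single unknotted arc. (The diagram is regarded on the sphere $S^2$, so either of the two disks bounded by the curve is allowed; a single unknotted arc means an embedded arc containing no crossing of $D$.) Goeritz index: each crossing of $D$ is assigned $+1$ or $-1$ depending on the position of the shaded regions around it. The index is $+1$ if rotating the over-strand counterclockwise about the crossing until it coincides with the under-strand sweeps over the shaded corners at the crossing, and $-1$ if this rotation sweeps over the unshaded corners. Goeritz matrix: let the shaded regions be $B_1,\dots,B_b$. For $j\neq k$, let $c_{jk}$ be the sum of the Goeritz indices of the crossings at which $B_j$ and $B_k$ meet (the sum is $0$ if there are none). The Goeritz matrix is the $b\times b$ integer matrix $G=(g_{jk})$ with $g_{jk}=c_{jk}$ for $j\neq k$ and $g_{jj}=-\sum_{\ell\neq j}c_{j\ell}$. (No row or column is deleted.) Dehn coloring matrix: let $R_1,\dots,R_m$ be the complementary regions of $D$, with variables $Z_1,\dots,Z_m$. Each crossing gives an equation $Z_i+Z_j-Z_k-Z_l=0$, where $R_i,R_j,R_k,R_l$ are the regions at the four corners of the crossing in cyclic order. Here $R_i$ and $R_j$ are the two regions lying ahead of the under-strand when one travels along the oriented over-strand (they are separated from each other by the over-strand), and $R_k$ and $R_l$ are the two regions on the other side of the under-strand, so that $R_i$ is opposite to $R_k$ and $R_j$ is opposite to $R_l$.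 If the same region occupies more than one corner, its coefficients are added. The Dehn coloring matrix $M_D$ is the coefficient matrix of this system: its rows correspond to the crossings of $D$ and its columns to the regions $R_1,\dots,R_m$. *)

theory Defs
  imports "HOL-Analysis.Analysis"
begin

(* Twice the signed area of the triangle 0, w, z: it is positive iff z is reached from w by a
   counterclockwise rotation through an angle strictly between 0 and pi, and zero iff w and z
   are linearly dependent over the reals. *)
definition cross :: "complex \<Rightarrow> complex \<Rightarrow> real" where
  "cross w z = Im (cnj w * z)"

abbreviation tangent :: "(real \<Rightarrow> complex) \<Rightarrow> real \<Rightarrow> complex" where
  "tangent \<gamma> t \<equiv> vector_derivative \<gamma> (at t)"

(* An oriented knot diagram in the plane is a regular closed curve gamma, given as a 1-periodic
   C1 immersion of the real line, whose only self-intersections are finitely many transverse double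
   points, together with the over/under information.  A crossing is encoded as the pair (s, t) in
   [0,1) x [0,1) of its two parameters, the first one belonging to the over-strand and the second
   one to the under-strand; X is the set of crossings.  The diagram without crossings (X = {}) is
   included. *)
definition knot_diagram :: "(real \<Rightarrow> complex) \<Rightarrow> (real \<times> real) set \<Rightarrow> bool" where
  "knot_diagram \<gamma> X \<longleftrightarrow>
     (\<forall>t. \<gamma> (t + 1) = \<gamma> t) \<and>
     \<gamma> C1_differentiable_on UNIV \<and>
     (\<forall>t. tangent \<gamma> t \<noteq> 0) \<and>
     finite X \<and> X \<subseteq> {0..<1} \<times> {0..<1} \<and>
     (\<forall>s\<in>{0..<1}. \<forall>t\<in>{0..<1}. (s, t) \<in> X \<or> (t, s) \<in> X \<longleftrightarrow> s \<noteq> t \<and> \<gamma> s = \<gamma> t) \<and>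
     (\<forall>s t. (s, t) \<in> X \<longrightarrow> (t, s) \<notin> X) \<and>
     (\<forall>r\<in>{0..<1}. \<forall>s\<in>{0..<1}. \<forall>t\<in>{0..<1}. \<gamma> r = \<gamma> s \<and> \<gamma> s = \<gamma> t \<longrightarrow> r = s \<or> s = t \<or> r = t) \<and>
     (\<forall>(s, t)\<in>X. cross (tangent \<gamma> s) (tangent \<gamma> t) \<noteq> 0)"

definition crossing_points :: "(real \<Rightarrow> complex) \<Rightarrow> (real \<times> real) set \<Rightarrow> complex set" where
  "crossing_points \<gamma> X = (\<lambda>(s, t). \<gamma> s) ` X"

definition regions :: "(real \<Rightarrow> complex) \<Rightarrow> complex set set" where
  "regions \<gamma> = components (- range \<gamma>)"

(* Q contains a short open segment that starts at p and points in direction w. *)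
definition lies_towards :: "complex set \<Rightarrow> complex \<Rightarrow> complex \<Rightarrow> bool" where
  "lies_towards Q p w \<longleftrightarrow> (\<forall>\<^sub>F \<epsilon> in at_right 0. p + complex_of_real \<epsilon> * w \<in> Q)"

(* P and Q lie on the left and on the right side, respectively, of an arc of the diagram. *)
definition adjacent_along_arc ::
    "(real \<Rightarrow> complex) \<Rightarrow> (real \<times> real) set \<Rightarrow> complex set \<Rightarrow> complex set \<Rightarrow> bool" where
  "adjacent_along_arc \<gamma> X P Q \<longleftrightarrow>
     (\<exists>t. \<gamma> t \<notin> crossing_points \<gamma> X \<and>
          lies_towards P (\<gamma> t) (\<i> * tangent \<gamma> t) \<and>
          lies_towards Q (\<gamma> t) (- (\<i> * tangent \<gamma> t)))"

(* S is the set of shaded regions. *)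
definition checkerboard ::
    "(real \<Rightarrow> complex) \<Rightarrow> (real \<times> real) set \<Rightarrow> complex set set \<Rightarrow> bool" where
  "checkerboard \<gamma> X S \<longleftrightarrow>
     S \<subseteq> regions \<gamma> \<and>
     (\<forall>P\<in>regions \<gamma>. \<forall>Q\<in>regions \<gamma>. adjacent_along_arc \<gamma> X P Q \<longrightarrow> (P \<in> S \<longleftrightarrow> Q \<notin> S)) \<and>
     (\<forall>Q\<in>regions \<gamma>. \<not> bounded Q \<longrightarrow> Q \<in> S)"

(* c is a simple closed curve which meets the diagram in exactly two points, none of them a
   crossing, and is transverse to it there.  The base point of c is chosen off the diagram, which
   is no restriction and ensures that both intersections occur at interior parameters. *)
definition transverse_in_two_points ::
    "(real \<Rightarrow> complex) \<Rightarrow> (real \<times> real) set \<Rightarrow> (real \<Rightarrow> complex) \<Rightarrow> bool" where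
  "transverse_in_two_points \<gamma> X c \<longleftrightarrow>
     simple_path c \<and> pathfinish c = pathstart c \<and> pathstart c \<notin> range \<gamma> \<and>
     card (path_image c \<inter> range \<gamma>) = 2 \<and>
     path_image c \<inter> crossing_points \<gamma> X = {} \<and>
     (\<forall>s\<in>{0<..<1}. \<forall>t. c s = \<gamma> t \<longrightarrow>
        (\<exists>w. (c has_vector_derivative w) (at s) \<and> cross w (tangent \<gamma> t) \<noteq> 0))"

(* On the sphere, the two disks bounded by c are the closures of the inside and of the outside
   of c (the latter with the point at infinity added, which is not on the diagram). *)
definition prime_diagram :: "(real \<Rightarrow> complex) \<Rightarrow> (real \<times> real) set \<Rightarrow> bool" where
  "prime_diagram \<gamma> X \<longleftrightarrow>
     (\<forall>c. transverse_in_two_points \<gamma> X c \<longrightarrow>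
        (\<exists>K\<in>{inside (path_image c), outside (path_image c)}.
           (\<exists>g. arc g \<and> path_image g = closure K \<inter> range \<gamma>) \<and>
           closure K \<inter> crossing_points \<gamma> X = {}))"

(* With o and u the tangent vectors of the over- and the under-strand, the four corners of a
   crossing are the open sectors containing o + u, o - u, - o - u, - o + u (in cyclic order). *)
definition at_corner ::
    "(real \<Rightarrow> complex) \<Rightarrow> real \<times> real \<Rightarrow> real \<Rightarrow> real \<Rightarrow> complex set \<Rightarrow> bool" where
  "at_corner \<gamma> x a b Q \<longleftrightarrow>
     lies_towards Q (\<gamma> (fst x)) (of_real a * tangent \<gamma> (fst x) + of_real b * tangent \<gamma> (snd x))"

definition meets_crossing :: "(real \<Rightarrow> complex) \<Rightarrow> real \<times> real \<Rightarrow> complex set \<Rightarrow> bool" where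
  "meets_crossing \<gamma> x Q \<longleftrightarrow> (\<exists>a\<in>{1, -1}. \<exists>b\<in>{1, -1}. at_corner \<gamma> x a b Q)"

(* If u is counterclockwise from o, then rotating the over-strand counterclockwise onto the
   under-strand sweeps over the corners of o + u and - o - u; otherwise it is the vector - u that
   is counterclockwise from o, and the corners of o - u and - o + u are swept over. *)
definition goeritz_index ::
    "(real \<Rightarrow> complex) \<Rightarrow> complex set set \<Rightarrow> real \<times> real \<Rightarrow> int" where
  "goeritz_index \<gamma> S x =
     (let b = (if cross (tangent \<gamma> (fst x)) (tangent \<gamma> (snd x)) > 0 then 1 else -1)
      in if (\<exists>Q\<in>S. at_corner \<gamma> x 1 b Q) \<and> (\<exists>Q\<in>S. at_corner \<gamma> x (-1) (-b) Q) then 1 else -1)"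

(* In the following, R enumerates the regions, starting from the index 1. *)

definition goeritz_sum ::
    "(real \<Rightarrow> complex) \<Rightarrow> (real \<times> real) set \<Rightarrow> complex set set \<Rightarrow> (nat \<Rightarrow> complex set) \<Rightarrow> nat \<Rightarrow> nat \<Rightarrow> int"
  where
  "goeritz_sum \<gamma> X S R j k =
     (\<Sum>x\<in>{x \<in> X. meets_crossing \<gamma> x (R j) \<and> meets_crossing \<gamma> x (R k)}. goeritz_index \<gamma> S x)"

definition goeritz_matrix ::
    "(real \<Rightarrow> complex) \<Rightarrow> (real \<times> real) set \<Rightarrow> complex set set \<Rightarrow> (nat \<Rightarrow> complex set) \<Rightarrow> nat \<Rightarrow>
     nat \<Rightarrow> nat \<Rightarrow> int" where
  "goeritz_matrix \<gamma> X S R b j k =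
     (if j \<noteq> k then goeritz_sum \<gamma> X S R j k
      else - (\<Sum>l\<in>{1..b} - {j}. goeritz_sum \<gamma> X S R j l))"

(* The rows are indexed by the crossings, the columns by the indices of the regions. *)
definition dehn_matrix ::
    "(real \<Rightarrow> complex) \<Rightarrow> (nat \<Rightarrow> complex set) \<Rightarrow> real \<times> real \<Rightarrow> nat \<Rightarrow> int" where
  "dehn_matrix \<gamma> R x j =
     of_bool (at_corner \<gamma> x 1 1 (R j)) + of_bool (at_corner \<gamma> x 1 (-1) (R j))
     - of_bool (at_corner \<gamma> x (-1) (-1) (R j)) - of_bool (at_corner \<gamma> x (-1) 1 (R j))"

definition nonzero_rows ::
    "(real \<Rightarrow> complex) \<Rightarrow> (real \<times> real) set \<Rightarrow> (nat \<Rightarrow> complex set) \<Rightarrow> nat \<Rightarrow> (real \<times> real) set" where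
  "nonzero_rows \<gamma> X R j = {x \<in> X. dehn_matrix \<gamma> R x j \<noteq> 0}"

definition signed_row_sum ::
    "(real \<Rightarrow> complex) \<Rightarrow> (real \<times> real) set \<Rightarrow> (nat \<Rightarrow> complex set) \<Rightarrow> nat \<Rightarrow> (real \<times> real \<Rightarrow> int) \<Rightarrow>
     nat \<Rightarrow> int" where
  "signed_row_sum \<gamma> X R j \<sigma> k = (\<Sum>x\<in>nonzero_rows \<gamma> X R j. \<sigma> x * dehn_matrix \<gamma> R x k)"

definition admissible_signs ::
    "(real \<Rightarrow> complex) \<Rightarrow> (real \<times> real) set \<Rightarrow> (nat \<Rightarrow> complex set) \<Rightarrow> nat \<Rightarrow> nat \<Rightarrow> nat \<Rightarrow>
     (real \<times> real \<Rightarrow> int) \<Rightarrow> bool" where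
  "admissible_signs \<gamma> X R b m j \<sigma> \<longleftrightarrow>
     (\<forall>x\<in>nonzero_rows \<gamma> X R j. \<sigma> x \<in> {1, -1}) \<and>
     (\<forall>k\<in>{b+1..m}. signed_row_sum \<gamma> X R j \<sigma> k = 0)"

end

theory Submission
  imports Defs
begin

text \<open>
  Write \<open>g x\<close> for the Goeritz index of a crossing and \<open>M x Q\<close> for the entry of the Dehn matrix in the
  row of \<open>x\<close> and the column of the region \<open>Q\<close>. For a shaded region \<open>P\<close> the signs \<open>g x * M x P\<close> are
  admissible, and they give minus the row of the Goeritz matrix at \<open>P\<close>: at a crossing the two shaded
  corners have opposite coefficients.

  For an unshaded region \<open>U\<close> the product \<open>g x * M x P * M x U\<close> is a sum over those of the four half
  edges at \<open>x\<close> that separate \<open>P\<close> from \<open>U\<close>: such a half edge contributes \<open>+1\<close> if it is outgoing with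
  \<open>P\<close> on its left or incoming with \<open>P\<close> on its right, and \<open>-1\<close> otherwise. If two arcs separate \<open>P\<close> from \<open>U\<close>, a
  simple closed curve running through \<open>P\<close> and \<open>U\<close> meets the diagram only on these two arcs, and
  primeness forces both of them to lie on the same edge. Hence only the two ends of a single edge contribute,
  and they cancel.

  For the uniqueness, two admissible choices of signs have the same product at both ends of every edge of \<open>P\<close>.
  As the diagram is connected, so is the frontier of \<open>P\<close>, and therefore this product is constant.
\<close>

section \<open>Local structure of the diagram\<close>

text \<open>The curve is only C1, so the local facts about regions rest on strict differentiability:
  it keeps short straight pushes in transversal directions off the curve. Parameters run over the
  whole real line, so that an arc between two crossings is always an interval, wherever the base
  point of the knot lies.

  A single common edge is decisive for uniqueness. Unless that edge is a loop at one crossing, the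
  column of \<open>U\<close> has nonzero entries in exactly two of the rows with a nonzero entry at
  \<open>P\<close>, those of the ends of the edge. A vanishing signed sum therefore ties the two
  signs together by a factor that depends on the matrix alone. The factor is the same for both
  choices of signs and drops out of their product, which is why the product, and not each choice, is
  followed along the frontier.

  For the diagonal of the Goeritz matrix, the same opposite signs make the coefficients of all
  shaded regions in a row add up to zero.\<close>

lemma cross_add_right: "cross w (x + y) = cross w x + cross w y"
  by (simp add: cross_def algebra_simps)
lemma cross_add_left: "cross (x + y) w = cross x w + cross y w"
  by (simp add: cross_def algebra_simps)
lemma cross_diff_right: "cross w (x - y) = cross w x - cross w y"
  by (simp add: cross_def algebra_simps)
lemma cross_minus_right: "cross w (- y) = - cross w y"
  by (simp add: cross_def)
lemma cross_scale_right: "cross w (of_real r * y) = r * cross w y"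
  by (simp add: cross_def algebra_simps)
lemma cross_scale_left: "cross (of_real r * y) w = r * cross y w"
  by (simp add: cross_def algebra_simps)
lemma cross_skew: "cross w z = - cross z w"
  by (simp add: cross_def algebra_simps)
lemma cross_self [simp]: "cross w w = 0"
  by (simp add: cross_def algebra_simps)
lemma cross_zero [simp]: "cross w 0 = 0"
  by (simp add: cross_def)
lemma cross_rotate: "cross w (\<i> * w) = (norm w)\<^sup>2"
  by (simp add: cross_def cmod_def power2_eq_square)
lemma abs_cross_le: "\<bar>cross w z\<bar> \<le> norm w * norm z"
  using abs_Im_le_cmod[of "cnj w * z"] by (simp add: cross_def norm_mult)
lemma continuous_cross: "continuous_on A (\<lambda>z. cross w z)"
  unfolding cross_def by (intro continuous_intros)

lemmas cross_linear = cross_add_right cross_add_left cross_diff_right cross_minus_right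
  cross_scale_right cross_scale_left

lemma lies_towards_unique:
  assumes "lies_towards P p w" "lies_towards Q p w" "P \<in> regions \<gamma>" "Q \<in> regions \<gamma>"
  shows "P = Q"
proof -
  have "\<forall>\<^sub>F \<epsilon> in at_right 0. p + complex_of_real \<epsilon> * w \<in> P \<inter> Q"
    using assms(1,2) unfolding lies_towards_def by eventually_elim auto
  then obtain \<epsilon> where "p + complex_of_real \<epsilon> * w \<in> P \<inter> Q"
    using eventually_happens[of _ "at_right (0::real)"] by (auto simp: trivial_limit_at_right_real)
  then show ?thesis
    using assms(3,4) components_nonoverlap[of P _ Q] unfolding regions_def by blast
qed

lemma lies_towardsI:
  assumes "\<delta> > 0" "\<And>\<eta>. 0 < \<eta> \<Longrightarrow> \<eta> < \<delta> \<Longrightarrow> p + complex_of_real \<eta> * w \<in> Q"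
  shows "lies_towards Q p w"
  unfolding lies_towards_def eventually_at_right_field using assms by (metis add.commute)

lemma lies_towardsE:
  assumes "lies_towards Q p w"
  obtains \<delta> where "\<delta> > 0" "\<And>\<eta>. 0 < \<eta> \<Longrightarrow> \<eta> < \<delta> \<Longrightarrow> p + complex_of_real \<eta> * w \<in> Q"
  using assms unfolding lies_towards_def eventually_at_right_field by auto

lemma connected_subset_region:
  assumes "connected A" "A \<noteq> {}" "A \<inter> range \<gamma> = {}"
  obtains Q where "Q \<in> regions \<gamma>" "A \<subseteq> Q"
  using exists_component_superset[of A "- range \<gamma>"] assms unfolding regions_def by blast

section \<open>The curve, its parameters and its double points\<close>

locale diagram =
  fixes \<gamma> :: "real \<Rightarrow> complex" and X :: "(real \<times> real) set"
  assumes diagram: "knot_diagram \<gamma> X"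
begin

abbreviation "d t \<equiv> tangent \<gamma> t"

text \<open>All parameters of crossings on the real line, not only those in \<open>{0..<1}\<close>;
  the set is invariant under integer translation.\<close>

definition "C = {t. \<gamma> t \<in> crossing_points \<gamma> X}"

text \<open>Forgets which strand is on top, so that a local argument at a crossing is made once and
  applied to either strand.\<close>

definition "paired c c' \<longleftrightarrow> (c, c') \<in> X \<or> (c', c) \<in> X"

lemma per1: "\<gamma> (t + 1) = \<gamma> t"
  using diagram by (simp add: knot_diagram_def)

lemma per_nat: "\<gamma> (t + real n) = \<gamma> t"
proof (induction n)
  case (Suc n)
  then show ?case using per1[of "t + real n"] by (simp add: algebra_simps)
qed simp

lemma per: "\<gamma> (t + of_int n) = \<gamma> t"
proof (cases n rule: int_cases2)
  case (nonneg k)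
  then show ?thesis using per_nat by simp
next
  case (nonpos k)
  then show ?thesis using per_nat[of "t - real k" k] by simp
qed

lemma per_frac: "\<gamma> (frac t) = \<gamma> t"
  using per[of t "- floor t"] by (simp add: frac_def)

lemma has_tangent: "(\<gamma> has_vector_derivative d t) (at t)"
  and continuous_tangent: "continuous_on UNIV (\<lambda>t. d t)"
proof -
  obtain D where D: "\<And>x. (\<gamma> has_vector_derivative D x) (at x)" "continuous_on UNIV D"
    using diagram unfolding knot_diagram_def C1_differentiable_on_def by auto
  have "d = D" using vector_derivative_at[OF D(1)] by auto
  then show "(\<gamma> has_vector_derivative d t) (at t)" "continuous_on UNIV (\<lambda>t. d t)" using D
    by auto
qed

lemma continuous_curve: "continuous_on A \<gamma>"
  by (rule continuous_at_imp_continuous_on) (use has_vector_derivative_continuous[OF has_tangent] in blast)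

lemma tangent_nonzero: "d t \<noteq> 0"
  using diagram by (simp add: knot_diagram_def)

lemma tangent_per: "d (t + of_int n) = d t"
proof -
  have "((\<lambda>x. \<gamma> (x - of_int n)) has_vector_derivative d t) (at (t + of_int n))"
  proof -
    have "((\<lambda>x. x - of_int n) has_vector_derivative 1) (at (t + of_int n))"
      by (auto intro!: derivative_eq_intros simp flip: has_real_derivative_iff_has_vector_derivative)
    then show ?thesis
      using vector_diff_chain_at[of "\<lambda>x. x - of_int n" 1 "t + of_int n" \<gamma> "d t"] has_tangent[of t]
      by (simp add: o_def)
  qed
  moreover have "(\<lambda>x. \<gamma> (x - of_int n)) = \<gamma>"
    using per[of _ "-n"] by auto
  ultimately show ?thesis by (simp add: vector_derivative_at)
qed

lemma tangent_frac: "d (frac t) = d t"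
  using tangent_per[of t "- floor t"] by (simp add: frac_def)

lemma finite_X: "finite X" and X_unit: "x \<in> X \<Longrightarrow> fst x \<in> {0..<1} \<and> snd x \<in> {0..<1}"
  using diagram by (auto simp: knot_diagram_def)

lemma X_transverse: "x \<in> X \<Longrightarrow> cross (d (fst x)) (d (snd x)) \<noteq> 0"
  using diagram by (auto simp: knot_diagram_def)

lemma paired_sym: "paired c c' \<longleftrightarrow> paired c' c"
  by (auto simp: paired_def)

lemma paired_unit: "paired c c' \<Longrightarrow> c \<in> {0..<1} \<and> c' \<in> {0..<1}"
  using X_unit by (auto simp: paired_def)

lemma paired_iff:
  assumes "c \<in> {0..<1}" "c' \<in> {0..<1}"
  shows "paired c c' \<longleftrightarrow> c \<noteq> c' \<and> \<gamma> c = \<gamma> c'"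
proof -
  have "\<forall>s\<in>{0..<1}. \<forall>t\<in>{0..<1}. (s, t) \<in> X \<or> (t, s) \<in> X \<longleftrightarrow> s \<noteq> t \<and> \<gamma> s = \<gamma> t"
    using diagram unfolding knot_diagram_def by argo
  then show ?thesis using assms unfolding paired_def by blast
qed

lemma paired_transverse: "paired c c' \<Longrightarrow> cross (d c) (d c') \<noteq> 0"
  unfolding paired_def using X_transverse cross_skew[of "d c" "d c'"] by fastforce

text \<open>Another parameter in \<open>{0..<1}\<close> over the double point would make it a triple
  point, which a diagram excludes.\<close>

lemma paired_frac:
  assumes "paired c c'" "\<gamma> t = \<gamma> c"
  shows "frac t = c \<or> frac t = c'"
proof -
  have r: "frac t \<in> {0..<1}" by (simp add: frac_lt_1)
  have "\<gamma> c = \<gamma> c'" "c \<noteq> c'" using paired_iff paired_unit assms(1) by blast+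
  moreover have U: "\<forall>r\<in>{0..<1}. \<forall>s\<in>{0..<1}. \<forall>t\<in>{0..<1}. \<gamma> r = \<gamma> s \<and> \<gamma> s = \<gamma> t \<longrightarrow> r = s \<or> s = t \<or> r = t"
    using diagram unfolding knot_diagram_def by argo
  ultimately show ?thesis
    using r paired_unit[OF assms(1)] per_frac[of t] assms(2) U[rule_format, of c c' "frac t"] by auto
qed

lemma C_iff_paired: "t \<in> C \<longleftrightarrow> (\<exists>c'. paired (frac t) c')"
proof
  assume "t \<in> C"
  then obtain x where x: "x \<in> X" "\<gamma> t = \<gamma> (fst x)"
    unfolding C_def crossing_points_def by auto
  then have "paired (fst x) (snd x)" by (simp add: paired_def)
  then show "\<exists>c'. paired (frac t) c'" using paired_frac x(2) paired_sym by metis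
next
  assume "\<exists>c'. paired (frac t) c'"
  then obtain c' where c: "paired (frac t) c'" ..
  then have "\<gamma> c' = \<gamma> (frac t)" using paired_iff paired_unit by metis
  then show "t \<in> C" using c per_frac[of t]
    unfolding C_def crossing_points_def paired_def by force
qed

lemma C_per: "t + of_int n \<in> C \<longleftrightarrow> t \<in> C"
  by (simp add: C_def per)

lemma inj_off_C:
  assumes "t \<notin> C" "\<gamma> s = \<gamma> t"
  shows "frac s = frac t"
proof (rule ccontr)
  assume "frac s \<noteq> frac t"
  then have "paired (frac t) (frac s)"
    using assms(2) by (subst paired_iff) (auto simp: per_frac frac_lt_1)
  then show False using assms(1) C_iff_paired by blast
qed

lemma frac_eqE:
  assumes "frac s = frac t"
  obtains n :: int where "s = t + of_int n"
  using assms unfolding frac_def by (metis add_diff_eq diff_add_eq eq_diff_eq of_int_diff)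

lemma range_curve: "range \<gamma> = \<gamma> ` {0..1}"
proof -
  have "\<gamma> t \<in> \<gamma> ` {0..1}" for t
    using per_frac[of t] by (metis atLeastAtMost_iff frac_ge_0 frac_lt_1 image_eqI less_imp_le)
  then show ?thesis by auto
qed

lemma compact_range: "compact (range \<gamma>)"
  unfolding range_curve by (intro compact_continuous_image continuous_curve) simp

lemma connected_range: "connected (range \<gamma>)"
  by (intro connected_continuous_image continuous_curve) simp

lemma open_region: "Q \<in> regions \<gamma> \<Longrightarrow> open Q"
  unfolding regions_def using open_components compact_imp_closed[OF compact_range] by blast

lemma region_disjoint: "Q \<in> regions \<gamma> \<Longrightarrow> Q \<inter> range \<gamma> = {}"
  unfolding regions_def using in_components_subset by blast

lemma connected_region: "Q \<in> regions \<gamma> \<Longrightarrow> connected Q"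
  unfolding regions_def using in_components_connected by blast

lemma region_eq: "P \<in> regions \<gamma> \<Longrightarrow> Q \<in> regions \<gamma> \<Longrightarrow> z \<in> P \<Longrightarrow> z \<in> Q \<Longrightarrow> P = Q"
  unfolding regions_def using components_nonoverlap[of P _ Q] by blast

text \<open>The mean value inequality for the curve minus its linear part at \<open>t0\<close>,
  whose derivative is small near \<open>t0\<close> by continuity of the tangent. Uniformity in both
  \<open>s\<close> and \<open>t\<close> makes the estimate apply to every chord of a short strand,
  not only to chords from \<open>t0\<close>.\<close>

lemma strict_differentiability:
  assumes "\<kappa> > 0"
  obtains \<delta> where "\<delta> > 0"
    "\<And>s t. \<bar>s - t0\<bar> < \<delta> \<Longrightarrow> \<bar>t - t0\<bar> < \<delta> \<Longrightarrow>
      norm (\<gamma> t - \<gamma> s - of_real (t - s) * d t0) \<le> \<kappa> * \<bar>t - s\<bar>"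
proof -
  have "isCont d t0" using continuous_tangent by (simp add: continuous_on_eq_continuous_at)
  then obtain \<delta> where \<delta>: "\<delta> > 0" "\<And>s. \<bar>s - t0\<bar> < \<delta> \<Longrightarrow> norm (d s - d t0) < \<kappa>"
    using assms unfolding continuous_at_eps_delta dist_norm real_norm_def by blast
  have "norm (\<gamma> t - \<gamma> s - of_real (t - s) * d t0) \<le> \<kappa> * \<bar>t - s\<bar>"
    if st: "\<bar>s - t0\<bar> < \<delta>" "\<bar>t - t0\<bar> < \<delta>" for s t
  proof -
    let ?f = "\<lambda>u. \<gamma> u - u *\<^sub>R d t0"
    have "norm (?f t - ?f s) \<le> \<kappa> * norm (t - s)"
    proof (rule differentiable_bound)
      show "convex (ball t0 \<delta>)" by simp
      fix u assume u: "u \<in> ball t0 \<delta>"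
      have "(?f has_vector_derivative (d u - d t0)) (at u)"
        by (rule has_vector_derivative_diff[OF has_tangent])
           (auto intro!: derivative_eq_intros simp: has_vector_derivative_def)
      then show "(?f has_derivative (\<lambda>h. h *\<^sub>R (d u - d t0))) (at u within ball t0 \<delta>)"
        unfolding has_vector_derivative_def using has_derivative_at_withinI by blast
      show "onorm (\<lambda>h. h *\<^sub>R (d u - d t0)) \<le> \<kappa>"
      proof (rule onorm_bound)
        show "\<kappa> \<ge> 0" using assms by simp
        fix h :: real
        have "norm (d u - d t0) \<le> \<kappa>"
          using \<delta>(2)[of u] u by (auto simp: dist_real_def abs_minus_commute)
        then show "norm (h *\<^sub>R (d u - d t0)) \<le> \<kappa> * norm h"
          by (simp add: mult.commute[of _ "\<bar>h\<bar>"] mult_left_mono)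
      qed
    qed (use st in \<open>auto simp: dist_real_def abs_minus_commute\<close>)
    then show ?thesis by (simp add: scaleR_conv_of_real algebra_simps)
  qed
  then show thesis using that \<delta>(1) by blast
qed

text \<open>Outside the \<open>\<delta>\<close>-balls around the preimages of \<open>p\<close>, what
  remains of a period is compact and the curve stays at a positive distance from \<open>p\<close>.
  This turns closeness in the plane into closeness of parameters.\<close>

lemma near_preimage:
  assumes "\<delta> > 0"
  obtains r where "r > 0" "\<And>t. norm (\<gamma> t - p) < r \<Longrightarrow> \<exists>t'. \<gamma> t' = p \<and> \<bar>t - t'\<bar> < \<delta>"
proof -
  let ?K = "{0..1} - (\<Union>t'\<in>\<gamma> -` {p}. ball t' \<delta>)"
  have K: "compact ?K" by (rule compact_diff) auto
  obtain r where r: "r > 0" "\<And>t. t \<in> ?K \<Longrightarrow> r \<le> norm (\<gamma> t - p)"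
  proof (cases "?K = {}")
    case True
    show thesis by (rule that[of 1]) (simp, unfold True, simp)
  next
    case False
    have "continuous_on ?K (\<lambda>t. norm (\<gamma> t - p))"
      by (intro continuous_intros continuous_curve)
    from continuous_attains_inf[OF K False this]
    obtain u where u: "u \<in> ?K" "\<And>t. t \<in> ?K \<Longrightarrow> norm (\<gamma> u - p) \<le> norm (\<gamma> t - p)"
      unfolding Ball_def by metis
    have "u \<in> ball u \<delta>" using assms by simp
    then have "\<gamma> u \<noteq> p" using u(1) by blast
    then show thesis using that[of "norm (\<gamma> u - p)"] u(2) by simp
  qed
  have "\<exists>t'. \<gamma> t' = p \<and> \<bar>t - t'\<bar> < \<delta>" if "norm (\<gamma> t - p) < r" for t
  proof -
    have "frac t \<notin> ?K" using r(2)[of "frac t"] that by (auto simp: per_frac)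
    moreover have "frac t \<in> {0..1}" by (simp add: frac_lt_1 less_imp_le)
    ultimately obtain t' where "\<gamma> t' = p" "\<bar>t' - frac t\<bar> < \<delta>"
      by (auto simp: dist_real_def)
    then show ?thesis using per[of t' "floor t"]
      by (intro exI[of _ "t' + of_int (floor t)"]) (auto simp: frac_def)
  qed
  then show thesis using that r(1) by blast
qed

text \<open>A chord of a short strand is nearly parallel to \<open>d t0\<close>, while the vectors
  of the compact set \<open>W\<close> make an angle with it that is bounded away from zero. So a
  push of a point of the strand along \<open>W\<close> cannot end on the same strand.\<close>

lemma avoid_strand:
  assumes W: "compact W" "\<And>w. w \<in> W \<Longrightarrow> cross (d t0) w \<noteq> 0"
  obtains \<delta> where "\<delta> > 0"
    "\<And>s t \<eta> w. \<lbrakk>\<bar>s - t0\<bar> < \<delta>; \<bar>t - t0\<bar> < \<delta>; \<eta> > 0; w \<in> W\<rbrakk> \<Longrightarrow> \<gamma> s + of_real \<eta> * w \<noteq> \<gamma> t"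
proof -
  obtain \<mu> where \<mu>: "\<mu> > 0" "\<And>w. w \<in> W \<Longrightarrow> \<mu> \<le> \<bar>cross (d t0) w\<bar>"
  proof (cases "W = {}")
    case True
    then show thesis using that[of 1] by auto
  next
    case False
    have "continuous_on W (\<lambda>w. \<bar>cross (d t0) w\<bar>)"
      by (intro continuous_intros continuous_cross)
    then obtain u where "u \<in> W" "\<And>w. w \<in> W \<Longrightarrow> \<bar>cross (d t0) u\<bar> \<le> \<bar>cross (d t0) w\<bar>"
      using continuous_attains_inf[OF W(1) False] by blast
    then show thesis using that[of "\<bar>cross (d t0) u\<bar>"] W(2) by auto
  qed
  obtain B where B: "B > 0" "\<And>w. w \<in> W \<Longrightarrow> norm w \<le> B"
    using compact_imp_bounded[OF W(1)] unfolding bounded_pos by blast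
  define D where "D = norm (d t0)"
  have D: "D > 0" using tangent_nonzero by (simp add: D_def)
  \<comment> \<open>The bound \<open>D/2\<close> forces \<open>D * |t - s|\<close> to be at most
    \<open>2 * \<eta> * B\<close>; the bound \<open>\<mu> / (4*B)\<close> then leaves the chord a
    normal part of at most half the required \<open>\<eta> * \<mu>\<close>.\<close>
  define \<kappa> where "\<kappa> = min (D/2) (\<mu> / (4*B))"
  have \<kappa>: "\<kappa> > 0" "\<kappa> \<le> D/2" "\<kappa> * (4*B) \<le> \<mu>"
    using D \<mu> B by (auto simp: \<kappa>_def min_def field_simps)
  obtain \<delta> where \<delta>: "\<delta> > 0"
    "\<And>s t. \<bar>s - t0\<bar> < \<delta> \<Longrightarrow> \<bar>t - t0\<bar> < \<delta> \<Longrightarrow>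
      norm (\<gamma> t - \<gamma> s - of_real (t - s) * d t0) \<le> \<kappa> * \<bar>t - s\<bar>"
    using strict_differentiability[OF \<kappa>(1)] by blast
  have "\<gamma> s + of_real \<eta> * w \<noteq> \<gamma> t"
    if *: "\<bar>s - t0\<bar> < \<delta>" "\<bar>t - t0\<bar> < \<delta>" "\<eta> > 0" "w \<in> W" for s t \<eta> w
  proof
    assume "\<gamma> s + of_real \<eta> * w = \<gamma> t"
    define e where "e = \<gamma> t - \<gamma> s - of_real (t - s) * d t0"
    have e: "norm e \<le> \<kappa> * \<bar>t - s\<bar>" using \<delta>(2) * by (simp add: e_def)
    have eq: "of_real \<eta> * w = of_real (t - s) * d t0 + e"
      using \<open>\<gamma> s + _ = _\<close> by (simp add: e_def algebra_simps)
    have "\<eta> * cross (d t0) w = cross (d t0) e"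
      using arg_cong[OF eq, of "cross (d t0)"] by (simp only: cross_linear) simp
    then have "\<eta> * \<bar>cross (d t0) w\<bar> = \<bar>cross (d t0) e\<bar>" using *(3)
      by (metis abs_mult abs_of_pos)
    also have "\<dots> \<le> D * (\<kappa> * \<bar>t - s\<bar>)"
      using abs_cross_le[of "d t0" e] e D by (smt (verit) D_def mult_left_mono)
    finally have 1: "\<eta> * \<mu> \<le> D * (\<kappa> * \<bar>t - s\<bar>)"
      using \<mu>(2)[OF *(4)] *(3) by (smt (verit) mult_left_mono)
    have "\<bar>t - s\<bar> * D = norm (of_real (t - s) * d t0)"
      by (simp add: norm_mult D_def flip: of_real_diff)
    also have "\<dots> = norm (of_real \<eta> * w - e)" using eq by simp
    also have "\<dots> \<le> \<eta> * norm w + norm e"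
      using norm_triangle_ineq4[of "of_real \<eta> * w" e] *(3) by (simp add: norm_mult)
    also have "\<dots> \<le> \<eta> * B + \<kappa> * \<bar>t - s\<bar>" using B(2)[OF *(4)] *(3) e
      by (smt (verit) mult_left_mono)
    also have "\<dots> \<le> \<eta> * B + D/2 * \<bar>t - s\<bar>" using \<kappa>(2)
      by (smt (verit) mult_right_mono)
    finally have 2: "D * \<bar>t - s\<bar> \<le> 2 * (\<eta> * B)" by (simp add: algebra_simps)
    have "\<eta> * \<mu> \<le> \<kappa> * (2 * (\<eta> * B))" using 1 2 \<kappa>(1)
      by (smt (verit) mult.left_commute mult_left_mono)
    also have "\<dots> = (\<kappa> * (4*B)) * \<eta> / 2" by simp
    also have "\<dots> \<le> \<mu> * \<eta> / 2" using mult_right_mono[OF \<kappa>(3), of \<eta>] *(3)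
      by linarith
    finally show False using *(3) \<mu>(1) by (simp add: algebra_simps)
  qed
  then show thesis using that \<delta>(1) by blast
qed

lemma connected_thick_arc:
  assumes "convex I" "convex W"
  shows "connected ((\<lambda>(s, \<eta>, w). \<gamma> s + complex_of_real \<eta> * w) ` (I \<times> {0<..<\<delta>} \<times> W))"
proof (rule connected_continuous_image)
  show "connected (I \<times> {0<..<\<delta>} \<times> W)"
    using assms by (intro convex_connected convex_Times) auto
  show "continuous_on (I \<times> {0<..<\<delta>} \<times> W) (\<lambda>(s, \<eta>, w). \<gamma> s + complex_of_real \<eta> * w)"
    unfolding case_prod_unfold
    by (intro continuous_intros continuous_on_compose2[OF continuous_curve[of UNIV]]) auto
qed

text \<open>Off \<open>C\<close> all preimages of \<open>\<gamma> t0\<close> are integer translates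
  of \<open>t0\<close>, so up to a period only the strand at \<open>t0\<close> itself comes near
  this point, and \<open>avoid_strand\<close> keeps the pushed points off it. They form a connected
  set and hence lie in one region.\<close>

lemma one_sided_neighbourhood:
  assumes "t0 \<notin> C" "compact W" "convex W" "W \<noteq> {}" "\<And>w. w \<in> W \<Longrightarrow> cross (d t0) w \<noteq> 0"
  obtains Q \<delta> where "Q \<in> regions \<gamma>" "\<delta> > 0"
    "\<And>s \<eta> w. \<lbrakk>\<bar>s - t0\<bar> < \<delta>; 0 < \<eta>; \<eta> < \<delta>; w \<in> W\<rbrakk> \<Longrightarrow> \<gamma> s + of_real \<eta> * w \<in> Q"
proof -
  obtain \<delta>1 where \<delta>1: "\<delta>1 > 0"
    "\<And>s t \<eta> w. \<lbrakk>\<bar>s - t0\<bar> < \<delta>1; \<bar>t - t0\<bar> < \<delta>1; \<eta> > 0; w \<in> W\<rbrakk> \<Longrightarrow> \<gamma> s + of_real \<eta> * w \<noteq> \<gamma> t"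
    using avoid_strand[OF assms(2,5)] by blast
  obtain r where r: "r > 0" "\<And>t. norm (\<gamma> t - \<gamma> t0) < r \<Longrightarrow> \<exists>t'. \<gamma> t' = \<gamma> t0 \<and> \<bar>t - t'\<bar> < \<delta>1"
    using near_preimage[OF \<delta>1(1)] by blast
  obtain B where B: "B > 0" "\<And>w. w \<in> W \<Longrightarrow> norm w \<le> B"
    using compact_imp_bounded[OF assms(2)] unfolding bounded_pos by blast
  have "isCont \<gamma> t0" using continuous_curve[of UNIV]
    by (simp add: continuous_on_eq_continuous_at)
  then obtain \<delta>2 where \<delta>2: "\<delta>2 > 0" "\<And>s. \<bar>s - t0\<bar> < \<delta>2 \<Longrightarrow> norm (\<gamma> s - \<gamma> t0) < r/2"
    using r(1) unfolding continuous_at_eps_delta dist_norm real_norm_def by (metis half_gt_zero)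
  \<comment> \<open>The move along the curve and the push contribute at most \<open>r/2\<close>
    each, so a point of the diagram hit by the push is within \<open>r\<close> of
    \<open>\<gamma> t0\<close>.\<close>
  define \<delta> where "\<delta> = min (min \<delta>1 \<delta>2) (r / (2*B))"
  have \<delta>: "\<delta> > 0" "\<delta> \<le> \<delta>1" "\<delta> \<le> \<delta>2" "\<delta> \<le> r / (2*B)"
    using \<delta>1(1) \<delta>2(1) r(1) B(1) by (auto simp: \<delta>_def)
  then have \<delta>B: "\<delta> * B \<le> r/2" using B(1) by (simp add: field_simps)
  have avoid: "\<gamma> s + of_real \<eta> * w \<notin> range \<gamma>"
    if *: "\<bar>s - t0\<bar> < \<delta>" "0 < \<eta>" "\<eta> < \<delta>" "w \<in> W" for s \<eta> w
  proof
    assume "\<gamma> s + of_real \<eta> * w \<in> range \<gamma>"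
    then obtain t where t: "\<gamma> s + of_real \<eta> * w = \<gamma> t" by auto
    have "\<eta> * norm w \<le> \<delta> * B" using * B by (intro mult_mono) auto
    then have "norm (of_real \<eta> * w) \<le> r/2" using * \<delta>B by (simp add: norm_mult)
    then have "norm (\<gamma> t - \<gamma> t0) < r"
      using \<delta>2(2)[of s] * \<delta>(3) norm_triangle_ineq[of "\<gamma> s - \<gamma> t0" "of_real \<eta> * w"] t
      by (smt (verit) add_diff_eq diff_add_eq field_sum_of_halves)
    then obtain t' where t': "\<gamma> t' = \<gamma> t0" "\<bar>t - t'\<bar> < \<delta>1" using r(2)
      by blast
    obtain n :: int where n: "t' = t0 + of_int n"
      using inj_off_C[OF assms(1) t'(1)] frac_eqE by blast
    have "\<gamma> (t - of_int n) = \<gamma> t" using per[of t "-n"] by simp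
    moreover have "\<bar>t - of_int n - t0\<bar> < \<delta>1" using t'(2) n by (simp add: algebra_simps)
    ultimately show False using \<delta>1(2)[of s "t - of_int n" \<eta> w] * \<delta>(2) t by auto
  qed
  let ?A = "(\<lambda>(s, \<eta>, w). \<gamma> s + complex_of_real \<eta> * w) ` (ball t0 \<delta> \<times> {0<..<\<delta>} \<times> W)"
  have "?A \<noteq> {}" using \<delta>(1) assms(4) by auto
  moreover have "?A \<inter> range \<gamma> = {}"
  proof -
    have "\<gamma> s + of_real \<eta> * w \<notin> range \<gamma>" if "s \<in> ball t0 \<delta>" "\<eta> \<in> {0<..<\<delta>}" "w \<in> W" for s \<eta> w
      using avoid that by (simp add: dist_real_def abs_minus_commute)
    then show ?thesis by fast
  qed
  ultimately obtain Q where Q: "Q \<in> regions \<gamma>" "?A \<subseteq> Q"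
    using connected_subset_region connected_thick_arc[OF convex_ball assms(3)] by metis
  show thesis
  proof (rule that[OF Q(1) \<delta>(1)])
    fix s \<eta> w assume "\<bar>s - t0\<bar> < \<delta>" "0 < \<eta>" "\<eta> < \<delta>" "w \<in> W"
    then have "\<gamma> s + of_real \<eta> * w \<in> ?A"
      by (intro image_eqI[of _ _ "(s, \<eta>, w)"]) (auto simp: dist_real_def abs_minus_commute)
    then show "\<gamma> s + of_real \<eta> * w \<in> Q" using Q(2) by blast
  qed
qed

text \<open>For \<open>\<theta> = 1\<close> the region on the left of the oriented curve, for
  \<open>\<theta> = -1\<close> the one on the right. Its existence is shown for parameters off
  \<open>C\<close>; at a crossing the normal may point along the other strand.\<close>

definition "side \<theta> t = (THE Q. Q \<in> regions \<gamma> \<and> lies_towards Q (\<gamma> t) (of_real \<theta> * (\<i> * d t)))"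

lemma side_eqI:
  assumes "Q \<in> regions \<gamma>" "lies_towards Q (\<gamma> t) (of_real \<theta> * (\<i> * d t))"
  shows "side \<theta> t = Q"
  unfolding side_def using assms lies_towards_unique by (intro the_equality) blast+

lemma side_per: "side \<theta> (t + of_int n) = side \<theta> t"
  by (simp add: side_def per tangent_per)

lemma finite_C: "finite (C \<inter> {a..b})"
proof (rule finite_subset)
  show "C \<inter> {a..b} \<subseteq> (\<lambda>(c, n). c + of_int n) ` ((fst ` X \<union> snd ` X) \<times> {\<lfloor>a\<rfloor>..\<lfloor>b\<rfloor>})"
  proof
    fix t assume t: "t \<in> C \<inter> {a..b}"
    then obtain c' where "paired (frac t) c'" using C_iff_paired by blast
    then have "frac t \<in> fst ` X \<union> snd ` X" by (force simp: paired_def)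
    moreover have "\<lfloor>t\<rfloor> \<in> {\<lfloor>a\<rfloor>..\<lfloor>b\<rfloor>}" using t
      by (auto intro: floor_mono)
    moreover have "t = frac t + of_int \<lfloor>t\<rfloor>" by (simp add: frac_def)
    ultimately show "t \<in> (\<lambda>(c, n). c + of_int n) ` ((fst ` X \<union> snd ` X) \<times> {\<lfloor>a\<rfloor>..\<lfloor>b\<rfloor>})"
      by (intro image_eqI[of _ _ "(frac t, \<lfloor>t\<rfloor>)"]) auto
  qed
qed (simp add: finite_X)

lemma C_isolated:
  obtains \<delta> where "\<delta> > 0" "\<And>s. s \<noteq> t0 \<Longrightarrow> \<bar>s - t0\<bar> < \<delta> \<Longrightarrow> s \<notin> C"
proof -
  obtain e where e: "e > 0" "\<forall>x\<in>C \<inter> {t0 - 1..t0 + 1}. x \<noteq> t0 \<longrightarrow> e \<le> dist t0 x"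
    using finite_set_avoid[OF finite_C, of "t0 - 1" "t0 + 1" t0] by blast
  have "s \<notin> C" if "s \<noteq> t0" "\<bar>s - t0\<bar> < min e 1" for s
  proof
    assume "s \<in> C"
    then have "s \<in> C \<inter> {t0 - 1..t0 + 1}" using that(2) by auto
    then show False using e(2) that by (force simp: dist_real_def)
  qed
  then show thesis using that[of "min e 1"] e(1) by simp
qed

lemma isCont_curve: "isCont \<gamma> t" and isCont_tangent: "isCont d t"
  using continuous_curve[of UNIV] continuous_tangent by (auto simp: continuous_on_eq_continuous_at)

text \<open>A whole disk of directions around the normal at \<open>t0\<close> is used, because it
  also contains the normals at nearby parameters. Its radius \<open>D/2\<close> keeps it
  transversal: \<open>cross (d t0)\<close> has absolute value \<open>D^2\<close> at the centre and
  changes by at most half of that.\<close>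

lemma side_nearby:
  assumes "t0 \<notin> C" "\<theta> \<in> {1, -1}"
  obtains Q \<delta> where "Q \<in> regions \<gamma>" "\<delta> > 0"
    "\<And>s. \<bar>s - t0\<bar> < \<delta> \<Longrightarrow> lies_towards Q (\<gamma> s) (of_real \<theta> * (\<i> * d s))"
proof -
  define D where "D = norm (d t0)"
  have D: "D > 0" using tangent_nonzero by (simp add: D_def)
  define w0 where "w0 = of_real \<theta> * (\<i> * d t0)"
  have "cross (d t0) w \<noteq> 0" if "w \<in> cball w0 (D/2)" for w
  proof -
    have "\<bar>cross (d t0) (w - w0)\<bar> \<le> D * norm (w - w0)" using abs_cross_le
      by (simp add: D_def)
    also have "\<dots> \<le> D * (D/2)" using that D
      by (intro mult_left_mono) (auto simp: dist_norm norm_minus_commute)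
    finally have 1: "\<bar>cross (d t0) (w - w0)\<bar> \<le> D\<^sup>2 / 2"
      by (simp add: power2_eq_square)
    have "\<bar>cross (d t0) w0\<bar> = D\<^sup>2"
      using assms(2) unfolding w0_def cross_scale_right cross_rotate by (auto simp: D_def)
    moreover have "cross (d t0) w = cross (d t0) w0 + cross (d t0) (w - w0)"
      unfolding cross_diff_right by simp
    moreover have "D\<^sup>2 > 0" using D by simp
    ultimately show ?thesis using 1 by linarith
  qed
  moreover have "cball w0 (D/2) \<noteq> {}" using D by simp
  ultimately obtain Q \<delta>1 where Q: "Q \<in> regions \<gamma>" "\<delta>1 > 0"
    "\<And>s \<eta> w. \<lbrakk>\<bar>s - t0\<bar> < \<delta>1; 0 < \<eta>; \<eta> < \<delta>1; w \<in> cball w0 (D/2)\<rbrakk> \<Longrightarrow> \<gamma> s + of_real \<eta> * w \<in> Q"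
    using one_sided_neighbourhood[OF assms(1) compact_cball convex_cball] by blast
  obtain \<delta>2 where \<delta>2: "\<delta>2 > 0" "\<And>s. \<bar>s - t0\<bar> < \<delta>2 \<Longrightarrow> norm (d s - d t0) < D/2"
    using isCont_tangent[of t0] D unfolding continuous_at_eps_delta dist_norm real_norm_def
    by (metis half_gt_zero)
  show thesis
  proof (rule that[OF Q(1)])
    show "min \<delta>1 \<delta>2 > 0" using Q(2) \<delta>2(1) by simp
    fix s assume s: "\<bar>s - t0\<bar> < min \<delta>1 \<delta>2"
    have "of_real \<theta> * (\<i> * d s) - w0 = of_real \<theta> * (\<i> * (d s - d t0))"
      by (simp add: w0_def algebra_simps)
    then have "norm (of_real \<theta> * (\<i> * d s) - w0) = norm (d s - d t0)"
      using assms(2) by (auto simp: norm_mult)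
    then have "of_real \<theta> * (\<i> * d s) \<in> cball w0 (D/2)"
      using \<delta>2(2)[of s] s by (simp add: dist_norm norm_minus_commute)
    then show "lies_towards Q (\<gamma> s) (of_real \<theta> * (\<i> * d s))"
      using Q(2,3) s by (intro lies_towardsI[of \<delta>1]) auto
  qed
qed

lemma side_locally_constant:
  assumes "t0 \<notin> C" "\<theta> \<in> {1, -1}"
  obtains \<delta> where "\<delta> > 0" "\<And>s. \<bar>s - t0\<bar> < \<delta> \<Longrightarrow> side \<theta> s = side \<theta> t0"
proof -
  obtain Q \<delta> where Q: "Q \<in> regions \<gamma>" "\<delta> > 0"
    "\<And>s. \<bar>s - t0\<bar> < \<delta> \<Longrightarrow> lies_towards Q (\<gamma> s) (of_real \<theta> * (\<i> * d s))"
    using side_nearby[OF assms] by blast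
  have "side \<theta> s = Q" if "\<bar>s - t0\<bar> < \<delta>" for s using side_eqI Q that by blast
  then show thesis using that[of \<delta>] Q(2) by auto
qed

lemma
  assumes "t \<notin> C" "\<theta> \<in> {1, -1}"
  shows side_region: "side \<theta> t \<in> regions \<gamma>"
    and lies_towards_side: "lies_towards (side \<theta> t) (\<gamma> t) (of_real \<theta> * (\<i> * d t))"
proof -
  obtain Q \<delta> where "Q \<in> regions \<gamma>" "\<delta> > 0"
    "\<And>s. \<bar>s - t\<bar> < \<delta> \<Longrightarrow> lies_towards Q (\<gamma> s) (of_real \<theta> * (\<i> * d s))"
    using side_nearby[OF assms] by blast
  then have "Q \<in> regions \<gamma>" "lies_towards Q (\<gamma> t) (of_real \<theta> * (\<i> * d t))"
    by auto
  then show "side \<theta> t \<in> regions \<gamma>" "lies_towards (side \<theta> t) (\<gamma> t) (of_real \<theta> * (\<i> * d t))"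
    using side_eqI by metis+
qed

lemma side_constant:
  assumes "{\<alpha><..<\<beta>} \<inter> C = {}" "s \<in> {\<alpha><..<\<beta>}" "t \<in> {\<alpha><..<\<beta>}" "\<theta> \<in> {1, -1}"
  shows "side \<theta> s = side \<theta> t"
proof (rule connected_equivalence_relation[of "{\<alpha><..<\<beta>}" s t "\<lambda>s t. side \<theta> s = side \<theta> t"])
  fix a assume a: "a \<in> {\<alpha><..<\<beta>}"
  then obtain \<delta> where \<delta>: "\<delta> > 0" "\<And>s. \<bar>s - a\<bar> < \<delta> \<Longrightarrow> side \<theta> s = side \<theta> a"
    using side_locally_constant[of a \<theta>] assms by blast
  show "\<exists>T. openin (top_of_set {\<alpha><..<\<beta>}) T \<and> a \<in> T \<and> (\<forall>x\<in>T. side \<theta> a = side \<theta> x)"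
  proof (intro exI conjI ballI)
    show "openin (top_of_set {\<alpha><..<\<beta>}) ({\<alpha><..<\<beta>} \<inter> ball a \<delta>)"
      by (simp add: openin_open_Int)
    show "a \<in> {\<alpha><..<\<beta>} \<inter> ball a \<delta>" using a \<delta>(1) by simp
    fix x assume "x \<in> {\<alpha><..<\<beta>} \<inter> ball a \<delta>"
    then have "\<bar>x - a\<bar> < \<delta>" by (simp add: dist_real_def abs_minus_commute)
    then show "side \<theta> a = side \<theta> x" using \<delta>(2) by metis
  qed
qed (use assms in auto)

text \<open>The segment from the normal to \<open>w\<close> consists of directions on the same side
  of the tangent, so \<open>one_sided_neighbourhood\<close> assigns one region to all of
  them.\<close>

lemma lies_towards_side_direction:
  assumes "t \<notin> C" "\<theta> \<in> {1, -1}" "\<theta> * cross (d t) w > 0"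
  shows "lies_towards (side \<theta> t) (\<gamma> t) w"
proof -
  let ?w = "of_real \<theta> * (\<i> * d t)"
  have 1: "\<theta> * cross (d t) ?w > 0"
    using assms(2) tangent_nonzero[of t] unfolding cross_scale_right cross_rotate by auto
  have "cross (d t) v \<noteq> 0" if v: "v \<in> closed_segment ?w w" for v
  proof -
    obtain u where "0 \<le> u" "u \<le> 1" "v = (1 - u) *\<^sub>R ?w + u *\<^sub>R w"
      using v by (auto simp: in_segment)
    then have u: "0 \<le> u" "u \<le> 1" "v = of_real (1 - u) * ?w + of_real u * w"
      unfolding scaleR_conv_of_real by auto
    have "\<theta> * cross (d t) v = (1 - u) * (\<theta> * cross (d t) ?w) + u * (\<theta> * cross (d t) w)"
      unfolding u(3) cross_add_right cross_scale_right by (simp add: algebra_simps)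
    moreover have "\<dots> > 0"
    proof (cases "u = 0")
      case False
      then have "u * (\<theta> * cross (d t) w) > 0" using u assms(3) by simp
      moreover have "(1 - u) * (\<theta> * cross (d t) ?w) \<ge> 0" using u 1 by simp
      ultimately show ?thesis by linarith
    qed (use 1 in auto)
    ultimately show ?thesis by auto
  qed
  moreover have "closed_segment ?w w \<noteq> {}" by auto
  ultimately obtain Q \<delta> where Q: "Q \<in> regions \<gamma>" "\<delta> > 0"
    "\<And>s \<eta> v. \<lbrakk>\<bar>s - t\<bar> < \<delta>; 0 < \<eta>; \<eta> < \<delta>; v \<in> closed_segment ?w w\<rbrakk> \<Longrightarrow> \<gamma> s + of_real \<eta> * v \<in> Q"
    using one_sided_neighbourhood[OF assms(1) compact_segment convex_closed_segment] by metis
  have "lies_towards Q (\<gamma> t) v" if "v \<in> {?w, w}" for v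
    using that Q(2) Q(3)[of t _ v] by (intro lies_towardsI[of \<delta>]) auto
  then show ?thesis using side_eqI[OF Q(1)] by auto
qed

text \<open>A point \<open>z\<close> of \<open>Q\<close> close to \<open>\<gamma> t0\<close> equals
  \<open>\<gamma> s + of_real \<eta> * (\<i> * d t0)\<close> for some \<open>s\<close> near
  \<open>t0\<close>: the intermediate value theorem finds \<open>s\<close> such that
  \<open>\<gamma> s - z\<close> has no tangential part. The sign of \<open>\<eta>\<close> then tells
  on which side \<open>z\<close> lies.\<close>

lemma frontier_side:
  assumes "t0 \<notin> C" "Q \<in> regions \<gamma>" "\<gamma> t0 \<in> frontier Q"
  shows "Q = side 1 t0 \<or> Q = side (-1) t0"
proof -
  define D where "D = norm (d t0)"
  have D: "D > 0" using tangent_nonzero by (simp add: D_def)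
  have *: "\<exists>\<delta>>0. \<forall>s \<eta>. \<bar>s - t0\<bar> < \<delta> \<longrightarrow> 0 < \<eta> \<longrightarrow> \<eta> < \<delta> \<longrightarrow>
      \<gamma> s + of_real \<eta> * (of_real \<theta> * (\<i> * d t0)) \<in> side \<theta> t0" if \<theta>: "\<theta> \<in> {1, -1}" for \<theta>
  proof -
    let ?w = "of_real \<theta> * (\<i> * d t0)"
    have "cross (d t0) w \<noteq> 0" if "w \<in> {?w}" for w
      using that \<theta> tangent_nonzero[of t0]
        by (auto simp: cross_scale_right cross_minus_right cross_rotate)
    then obtain P \<delta> where P: "P \<in> regions \<gamma>" "\<delta> > 0"
      "\<And>s \<eta> w. \<lbrakk>\<bar>s - t0\<bar> < \<delta>; 0 < \<eta>; \<eta> < \<delta>; w \<in> {?w}\<rbrakk> \<Longrightarrow> \<gamma> s + of_real \<eta> * w \<in> P"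
      using one_sided_neighbourhood[OF assms(1), of "{?w}"]
        by (metis compact_insert compact_empty convex_singleton insert_not_empty)
    then have "side \<theta> t0 = P" by (intro side_eqI lies_towardsI[of \<delta>]) auto
    then show ?thesis using P by blast
  qed
  obtain \<delta>1 where \<delta>1: "\<delta>1 > 0" "\<And>s \<eta>. \<bar>s - t0\<bar> < \<delta>1 \<Longrightarrow> 0 < \<eta> \<Longrightarrow> \<eta> < \<delta>1 \<Longrightarrow> \<gamma> s + of_real \<eta> * (\<i> * d t0) \<in> side 1 t0"
    using *[of 1] by auto
  obtain \<delta>2 where \<delta>2: "\<delta>2 > 0" "\<And>s \<eta>. \<bar>s - t0\<bar> < \<delta>2 \<Longrightarrow> 0 < \<eta> \<Longrightarrow> \<eta> < \<delta>2 \<Longrightarrow> \<gamma> s - of_real \<eta> * (\<i> * d t0) \<in> side (-1) t0"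
    using *[of "-1"] by auto
  obtain \<delta>3 where \<delta>3: "\<delta>3 > 0" "\<And>s. \<bar>s - t0\<bar> < \<delta>3 \<Longrightarrow> norm (\<gamma> s - \<gamma> t0) < D * min \<delta>1 \<delta>2 / 2"
    using isCont_curve[of t0] D \<delta>1 \<delta>2
      unfolding continuous_at_eps_delta dist_norm real_norm_def
    by (metis half_gt_zero min_less_iff_conj mult_pos_pos)
  obtain \<delta>4 where \<delta>4: "\<delta>4 > 0"
    "\<And>s t. \<bar>s - t0\<bar> < \<delta>4 \<Longrightarrow> \<bar>t - t0\<bar> < \<delta>4 \<Longrightarrow>
      norm (\<gamma> t - \<gamma> s - of_real (t - s) * d t0) \<le> D/2 * \<bar>t - s\<bar>"
    using strict_differentiability[of "D/2"] D by (metis half_gt_zero)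
  define a where "a = min (min \<delta>1 \<delta>2) (min \<delta>3 \<delta>4) / 2"
  have a: "a > 0" "a < \<delta>1" "a < \<delta>2" "a < \<delta>3" "a < \<delta>4"
    using \<delta>1(1) \<delta>2(1) \<delta>3(1) \<delta>4(1) by (auto simp: a_def)
  let ?in = "\<lambda>z. Re (cnj (d t0) * z)"
  have in_le: "\<bar>?in z\<bar> \<le> D * norm z" for z
    using abs_Re_le_cmod[of "cnj (d t0) * z"] by (simp add: norm_mult D_def)
  have "Re (cnj (d t0) * d t0) = D\<^sup>2" by (simp add: D_def cmod_def power2_eq_square)
  then have in_d: "?in (of_real r * d t0 + e) = r * D\<^sup>2 + ?in e" for r e
    by (simp add: algebra_simps)
  \<comment> \<open>Since the linearization errs by at most \<open>D/2 * a\<close>, the bound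
    \<open>D * a / 4\<close> gives the tangential parts at \<open>t0 - a\<close> and
    \<open>t0 + a\<close> opposite weak signs. The second bound, together with
    \<open>\<delta>3\<close>, keeps the absolute value of \<open>\<eta>\<close> below
    \<open>\<delta>1\<close> and \<open>\<delta>2\<close>.\<close>
  define e where "e = min (D * a / 4) (D * min \<delta>1 \<delta>2 / 2)"
  have e: "e > 0" "e \<le> D * a / 4" "e \<le> D * min \<delta>1 \<delta>2 / 2"
    using D a \<delta>1 \<delta>2 by (auto simp: e_def)
  have "\<gamma> t0 \<in> closure Q" using assms(3) by (simp add: frontier_def)
  then obtain z where z: "z \<in> Q" "norm (z - \<gamma> t0) < e"
    using e(1) unfolding closure_approachable dist_norm by blast
  have le: "D/2 * a + e \<le> D * a" using e(2) mult_pos_pos[OF D a(1)] by linarith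
  have lo: "?in (\<gamma> (t0 - a) - z) \<le> 0"
  proof -
    define r where "r = \<gamma> (t0 - a) - \<gamma> t0 - of_real (- a) * d t0"
    have "norm r \<le> D/2 * a" using \<delta>4(2)[of t0 "t0 - a"] a \<delta>4(1) by (simp add: r_def)
    then have "\<bar>?in (r - (z - \<gamma> t0))\<bar> \<le> D * (D/2*a + e)"
      using in_le[of "r - (z - \<gamma> t0)"] norm_triangle_ineq4[of r "z - \<gamma> t0"] z(2) D
      by (smt (verit) mult_left_mono)
    also have "\<dots> \<le> D * (D * a)" using le D by (intro mult_left_mono) auto
    finally have b: "?in (r - (z - \<gamma> t0)) \<le> a * D\<^sup>2"
      by (simp add: power2_eq_square algebra_simps)
    have "\<gamma> (t0 - a) - z = of_real (- a) * d t0 + (r - (z - \<gamma> t0))" by (simp add: r_def)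
    then have "?in (\<gamma> (t0 - a) - z) = - a * D\<^sup>2 + ?in (r - (z - \<gamma> t0))" using in_d
      by metis
    then show ?thesis using b by linarith
  qed
  have hi: "0 \<le> ?in (\<gamma> (t0 + a) - z)"
  proof -
    define r where "r = \<gamma> (t0 + a) - \<gamma> t0 - of_real a * d t0"
    have "norm r \<le> D/2 * a" using \<delta>4(2)[of t0 "t0 + a"] a \<delta>4(1) by (simp add: r_def)
    then have "\<bar>?in (r - (z - \<gamma> t0))\<bar> \<le> D * (D/2*a + e)"
      using in_le[of "r - (z - \<gamma> t0)"] norm_triangle_ineq4[of r "z - \<gamma> t0"] z(2) D
      by (smt (verit) mult_left_mono)
    also have "\<dots> \<le> D * (D * a)" using le D by (intro mult_left_mono) auto
    finally have b: "- ?in (r - (z - \<gamma> t0)) \<le> a * D\<^sup>2"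
      by (simp add: power2_eq_square algebra_simps)
    have "\<gamma> (t0 + a) - z = of_real a * d t0 + (r - (z - \<gamma> t0))" by (simp add: r_def)
    then have "?in (\<gamma> (t0 + a) - z) = a * D\<^sup>2 + ?in (r - (z - \<gamma> t0))" using in_d
      by metis
    then show ?thesis using b by linarith
  qed
  have "continuous_on {t0 - a..t0 + a} (\<lambda>s. ?in (\<gamma> s - z))"
    by (intro continuous_intros continuous_curve)
  then obtain s where s: "t0 - a \<le> s" "s \<le> t0 + a" "?in (\<gamma> s - z) = 0"
    using IVT'[of "\<lambda>s. ?in (\<gamma> s - z)" "t0 - a" 0 "t0 + a"] lo hi a(1) by auto
  define \<eta> where "\<eta> = Im (cnj (d t0) * (z - \<gamma> s)) / D\<^sup>2"
  have "cnj (d t0) * (z - \<gamma> s) = \<i> * of_real (Im (cnj (d t0) * (z - \<gamma> s)))"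
    using s(3) by (simp add: complex_eq_iff algebra_simps)
  moreover have "d t0 * cnj (d t0) = of_real (D\<^sup>2)"
    by (simp add: D_def complex_norm_square[symmetric])
  ultimately have "of_real (D\<^sup>2) * (z - \<gamma> s) = d t0 * (\<i> * of_real (Im (cnj (d t0) * (z - \<gamma> s))))"
    by (metis mult.assoc)
  then have z_eq: "z = \<gamma> s + of_real \<eta> * (\<i> * d t0)"
    using D by (simp add: \<eta>_def field_simps)
  have "\<bar>\<eta>\<bar> * D = norm (z - \<gamma> s)" using z_eq by (simp add: norm_mult D_def)
  also have "\<dots> \<le> norm (z - \<gamma> t0) + norm (\<gamma> s - \<gamma> t0)"
    using norm_triangle_ineq4[of "z - \<gamma> t0" "\<gamma> s - \<gamma> t0"] by simp
  also have "\<dots> < D * min \<delta>1 \<delta>2" using z(2) e(3) \<delta>3(2)[of s] s a by linarith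
  finally have \<eta>: "\<bar>\<eta>\<bar> < min \<delta>1 \<delta>2" using D
    by (simp add: mult.commute)
  have sd: "\<bar>s - t0\<bar> < \<delta>1" "\<bar>s - t0\<bar> < \<delta>2" using s a by linarith+
  consider "\<eta> = 0" | "\<eta> > 0" | "\<eta> < 0" by linarith
  then show ?thesis
  proof cases
    case 1
    then show ?thesis using z_eq z(1) region_disjoint[OF assms(2)] by auto
  next
    case 2
    then have "z \<in> side 1 t0" using \<delta>1(2)[OF sd(1), of \<eta>] \<eta> z_eq by simp
    then show ?thesis using region_eq[OF assms(2) side_region[OF assms(1)] z(1)] by auto
  next
    case 3
    then have "z \<in> side (-1) t0" using \<delta>2(2)[OF sd(2), of "-\<eta>"] \<eta> z_eq by simp
    then show ?thesis using region_eq[OF assms(2) side_region[OF assms(1)] z(1)] by auto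
  qed
qed

text \<open>The push contains \<open>d c\<close> with the same sign \<open>h\<close> as the half
  strand, so that transversally to \<open>d c'\<close> the displacements by \<open>r\<close> and by
  \<open>\<eta>\<close> add up instead of cancelling. The strand through \<open>c'\<close> leaves
  its tangent only by a small multiple of \<open>r + \<eta>\<close> and cannot reach that far; the
  strand through \<open>c\<close> is excluded by \<open>avoid_strand\<close>.\<close>

lemma avoid_crossing:
  assumes "paired c c'" "h \<in> {1, -1}" "k \<in> {1, -1}"
  obtains \<delta> where "\<delta> > 0"
    "\<And>r \<eta>. \<lbrakk>0 \<le> r; r < \<delta>; 0 < \<eta>; \<eta> < \<delta>\<rbrakk> \<Longrightarrow>
      \<gamma> (c + h * r) + of_real \<eta> * (of_real h * d c + of_real k * d c') \<notin> range \<gamma>"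
proof -
  define w where "w = of_real h * d c + of_real k * d c'"
  define ch where "ch = \<bar>cross (d c') (d c)\<bar>"
  have ch: "ch > 0" using paired_transverse assms(1) paired_sym by (auto simp: ch_def)
  have wc: "cross (d c) w \<noteq> 0"
    using paired_transverse[OF assms(1)] assms(2,3) by (auto simp: w_def cross_linear)
  define D D' where "D = norm (d c)" and "D' = norm (d c')"
  have D: "D > 0" "D' > 0" using tangent_nonzero by (auto simp: D_def D'_def)
  define M where "M = 2 * (2 * D + norm w) / D'"
  have M: "M \<ge> 0" using D by (simp add: M_def)
  \<comment> \<open>The bounds \<open>D\<close> and \<open>D'/2\<close> ensure that a parameter
    \<open>u\<close> hit on the other strand is within \<open>M * (r + \<eta>)\<close> of
    \<open>c'\<close>. By the third bound the two errors, measured by \<open>cross (d c')\<close>,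
    together reach at most half of \<open>(r + \<eta>) * ch\<close>.\<close>
  define \<kappa> where "\<kappa> = min (min D (D'/2)) (ch / (2 * D' * (1 + M)))"
  have \<kappa>: "\<kappa> > 0" "\<kappa> \<le> D" "\<kappa> \<le> D'/2" "\<kappa> \<le> ch / (2 * D' * (1 + M))"
  proof -
    show "\<kappa> > 0" using D ch M by (simp add: \<kappa>_def)
  qed (unfold \<kappa>_def, linarith+)
  then have \<kappa>': "\<kappa> * (2 * D' * (1 + M)) \<le> ch" using D M
    by (simp add: pos_le_divide_eq)
  obtain \<delta>1 where \<delta>1: "\<delta>1 > 0"
    "\<And>s t \<eta> v. \<lbrakk>\<bar>s - c\<bar> < \<delta>1; \<bar>t - c\<bar> < \<delta>1; \<eta> > 0; v \<in> {w}\<rbrakk> \<Longrightarrow> \<gamma> s + of_real \<eta> * v \<noteq> \<gamma> t"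
    using avoid_strand[of "{w}" c] wc by auto
  obtain \<delta>2 where \<delta>2: "\<delta>2 > 0"
    "\<And>s t. \<bar>s - c\<bar> < \<delta>2 \<Longrightarrow> \<bar>t - c\<bar> < \<delta>2 \<Longrightarrow> norm (\<gamma> t - \<gamma> s - of_real (t - s) * d c) \<le> \<kappa> * \<bar>t - s\<bar>"
    using strict_differentiability[OF \<kappa>(1)] by blast
  obtain \<delta>3 where \<delta>3: "\<delta>3 > 0"
    "\<And>s t. \<bar>s - c'\<bar> < \<delta>3 \<Longrightarrow> \<bar>t - c'\<bar> < \<delta>3 \<Longrightarrow> norm (\<gamma> t - \<gamma> s - of_real (t - s) * d c') \<le> \<kappa> * \<bar>t - s\<bar>"
    using strict_differentiability[OF \<kappa>(1)] by blast
  have "min \<delta>1 \<delta>3 > 0" using \<delta>1(1) \<delta>3(1) by simp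
  then obtain r0 where r0: "r0 > 0" "\<And>t. norm (\<gamma> t - \<gamma> c) < r0 \<Longrightarrow> \<exists>t'. \<gamma> t' = \<gamma> c \<and> \<bar>t - t'\<bar> < min \<delta>1 \<delta>3"
    using near_preimage by metis
  obtain \<delta>4 where \<delta>4: "\<delta>4 > 0" "\<And>s. \<bar>s - c\<bar> < \<delta>4 \<Longrightarrow> norm (\<gamma> s - \<gamma> c) < r0/2"
    using isCont_curve[of c] r0(1) unfolding continuous_at_eps_delta dist_norm real_norm_def
    by (metis half_gt_zero)
  define \<delta> where "\<delta> = min (min \<delta>1 \<delta>2) (min \<delta>4 (r0 / (2 * (norm w + 1))))"
  have nw: "norm w + 1 > 0" using norm_ge_zero[of w] by linarith
  have \<delta>: "\<delta> > 0" "\<delta> \<le> \<delta>1" "\<delta> \<le> \<delta>2" "\<delta> \<le> \<delta>4" "\<delta> \<le> r0 / (2 * (norm w + 1))"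
    using \<delta>1(1) \<delta>2(1) \<delta>4(1) r0(1) nw by (auto simp: \<delta>_def)
  have \<delta>w: "\<delta> * (norm w + 1) \<le> r0/2" using \<delta>(5) nw by (simp add: field_simps)
  have cc: "\<gamma> c' = \<gamma> c" using assms(1) paired_iff paired_unit by metis
  have "\<gamma> (c + h * r) + of_real \<eta> * w \<notin> range \<gamma>"
    if *: "0 \<le> r" "r < \<delta>" "0 < \<eta>" "\<eta> < \<delta>" for r \<eta>
  proof
    assume "\<gamma> (c + h * r) + of_real \<eta> * w \<in> range \<gamma>"
    then obtain t where t: "\<gamma> (c + h * r) + of_real \<eta> * w = \<gamma> t" by auto
    have hr: "\<bar>h * r\<bar> = r" using assms(2) *(1) by auto
    have "\<eta> * norm w \<le> \<delta> * (norm w + 1)" using * by (intro mult_mono) auto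
    then have "norm (of_real \<eta> * w) \<le> r0/2" using * \<delta>w by (simp add: norm_mult)
    moreover have "norm (\<gamma> (c + h * r) - \<gamma> c) < r0/2"
      using \<delta>4(2)[of "c + h * r"] hr * \<delta>(4) by simp
    ultimately have "norm (\<gamma> t - \<gamma> c) < r0"
      using norm_triangle_ineq[of "\<gamma> (c + h * r) - \<gamma> c" "of_real \<eta> * w"]
        unfolding t[symmetric]
      by (simp add: algebra_simps)
    then obtain t' where t': "\<gamma> t' = \<gamma> c" "\<bar>t - t'\<bar> < min \<delta>1 \<delta>3"
      using r0(2) by blast
    define u where "u = t - of_int \<lfloor>t'\<rfloor>"
    have u: "\<gamma> u = \<gamma> t" "\<bar>u - frac t'\<bar> < min \<delta>1 \<delta>3"
      using per[of t "- \<lfloor>t'\<rfloor>"] t'(2) by (auto simp: u_def frac_def)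
    consider "frac t' = c" | "frac t' = c'" using paired_frac[OF assms(1) t'(1)] by blast
    then show False
    proof cases
      case 1
      then show False using \<delta>1(2)[of "c + h * r" u \<eta> w] hr * \<delta>(2) u t by auto
    next
      case 2
      define e where "e = \<gamma> (c + h * r) - \<gamma> c - of_real (h * r) * d c"
      define e' where "e' = \<gamma> u - \<gamma> c' - of_real (u - c') * d c'"
      have e: "norm e \<le> \<kappa> * r"
        using \<delta>2(2)[of c "c + h * r"] hr * \<delta>(3) \<delta>2(1) by (simp add: e_def)
      have e': "norm e' \<le> \<kappa> * \<bar>u - c'\<bar>"
        using \<delta>3(2)[of c' u] u(2) 2 \<delta>3(1) by (simp add: e'_def)
      have eq: "of_real (h * r) * d c + e + of_real \<eta> * w = of_real (u - c') * d c' + e'"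
        using t u(1) cc by (simp add: e_def e'_def)
      have "of_real (u - c') * d c' = (of_real (h * r) * d c + e + of_real \<eta> * w) - e'"
        unfolding eq by simp
      moreover have "norm (of_real (u - c') * d c') = \<bar>u - c'\<bar> * D'"
        unfolding norm_mult norm_of_real D'_def ..
      ultimately have "\<bar>u - c'\<bar> * D' = norm ((of_real (h * r) * d c + e + of_real \<eta> * w) - e')"
        by metis
      moreover have "norm (of_real (h * r) * d c) = r * D" unfolding norm_mult norm_of_real hr D_def ..
      moreover have "norm (of_real \<eta> * w) = \<eta> * norm w" using *(3) by (simp add: norm_mult)
      ultimately have "\<bar>u - c'\<bar> * D' \<le> r * D + norm e + \<eta> * norm w + norm e'"
        using norm_triangle_ineq4[of "of_real (h * r) * d c + e + of_real \<eta> * w" e']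
          norm_triangle_ineq[of "of_real (h * r) * d c + e" "of_real \<eta> * w"]
          norm_triangle_ineq[of "of_real (h * r) * d c" e] by linarith
      also have "\<dots> \<le> r * D + D * r + \<eta> * norm w + D'/2 * \<bar>u - c'\<bar>"
        using e e' mult_right_mono[OF \<kappa>(2) *(1)] mult_right_mono[OF \<kappa>(3), of "\<bar>u - c'\<bar>"]
          by linarith
      finally have "\<bar>u - c'\<bar> * D' \<le> 2 * (2 * D * r + norm w * \<eta>)"
        by (simp add: algebra_simps)
      also have "\<dots> \<le> 2 * (2 * D + norm w) * (r + \<eta>)"
        using D *(1,3) by (simp add: algebra_simps)
      also have "\<dots> = M * (r + \<eta>) * D'" using D by (simp add: M_def)
      finally have ub: "\<bar>u - c'\<bar> \<le> M * (r + \<eta>)" using D by simp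
      have "cross (d c') (of_real (h * r) * d c + e + of_real \<eta> * w) = (r + \<eta>) * h * cross (d c') (d c) + cross (d c') e"
        unfolding w_def
          by (simp only: cross_add_right cross_scale_right cross_self) (simp add: algebra_simps)
      moreover have "cross (d c') (of_real (u - c') * d c' + e') = cross (d c') e'"
        by (simp add: cross_add_right cross_scale_right del: of_real_diff)
      ultimately have "(r + \<eta>) * h * cross (d c') (d c) = cross (d c') e' - cross (d c') e"
        using eq by simp
      moreover have "\<bar>(r + \<eta>) * h * cross (d c') (d c)\<bar> = (r + \<eta>) * ch"
        using assms(2) *(1,3) by (auto simp: abs_mult ch_def)
      ultimately have "(r + \<eta>) * ch \<le> D' * norm e' + D' * norm e"
        using abs_cross_le[of "d c'" e'] abs_cross_le[of "d c'" e] unfolding D'_def by linarith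
      also have "\<dots> \<le> D' * (\<kappa> * (M * (r + \<eta>))) + D' * (\<kappa> * (r + \<eta>))"
      proof (intro add_mono mult_left_mono)
        show "norm e' \<le> \<kappa> * (M * (r + \<eta>))"
          using e' mult_left_mono[OF ub, of \<kappa>] \<kappa>(1) by linarith
        show "norm e \<le> \<kappa> * (r + \<eta>)"
          using e mult_left_mono[of r "r + \<eta>" \<kappa>] \<kappa>(1) *(3) by linarith
      qed (use D in auto)
      also have "\<dots> = (\<kappa> * (2 * D' * (1 + M))) * (r + \<eta>) / 2"
        by (simp add: algebra_simps)
      also have "\<dots> \<le> ch * (r + \<eta>) / 2"
        using mult_right_mono[OF \<kappa>', of "r + \<eta>"] *(1,3) by linarith
      finally have "(r + \<eta>) * ch \<le> 0" by (simp add: algebra_simps)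
      then show False using ch *(1,3) by (smt (verit) mult_pos_pos)
    qed
  qed
  then show thesis using that[OF \<delta>(1)] unfolding w_def by blast
qed

text \<open>The pushed half strand is connected; its part at \<open>r = 0\<close> shows the corner
  of the crossing and its parts at \<open>r > 0\<close> show a side of the nearby arc, so the two
  regions agree. Which side it is depends on the sign of the push normal to \<open>d c\<close>, that
  is, of \<open>k * cross (d c) (d c')\<close>.\<close>

lemma corner_nearby:
  assumes "paired c c'" "h \<in> {1, -1}" "k \<in> {1, -1}"
  obtains Q \<delta> where "Q \<in> regions \<gamma>" "\<delta> > 0"
    "lies_towards Q (\<gamma> c) (of_real h * d c + of_real k * d c')"
    "\<And>r. 0 < r \<Longrightarrow> r < \<delta> \<Longrightarrow> c + h * r \<notin> C \<and> side (k * sgn (cross (d c) (d c'))) (c + h * r) = Q"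
proof -
  define w where "w = of_real h * d c + of_real k * d c'"
  define \<theta> where "\<theta> = k * sgn (cross (d c) (d c'))"
  have \<theta>: "\<theta> \<in> {1, -1}" using assms(3) paired_transverse[OF assms(1)]
    by (auto simp: \<theta>_def sgn_if)
  obtain \<delta>1 where \<delta>1: "\<delta>1 > 0"
    "\<And>r \<eta>. \<lbrakk>0 \<le> r; r < \<delta>1; 0 < \<eta>; \<eta> < \<delta>1\<rbrakk> \<Longrightarrow> \<gamma> (c + h * r) + of_real \<eta> * w \<notin> range \<gamma>"
    using avoid_crossing[OF assms] unfolding w_def by blast
  define I where "I = (\<lambda>r. c + h * r) ` {0..<\<delta>1}"
  have "convex I" using convex_affinity[of "{0..<\<delta>1}" c h] by (simp add: I_def)
  let ?A = "(\<lambda>(s, \<eta>, w). \<gamma> s + complex_of_real \<eta> * w) ` (I \<times> {0<..<\<delta>1} \<times> {w})"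
  have mem: "\<gamma> (c + h * r) + of_real \<eta> * w \<in> ?A" if "0 \<le> r" "r < \<delta>1" "0 < \<eta>" "\<eta> < \<delta>1" for r \<eta>
    using that by (intro image_eqI[of _ _ "(c + h * r, \<eta>, w)"]) (auto simp: I_def)
  have "?A \<noteq> {}" using mem[of 0 "\<delta>1/2"] \<delta>1(1) by auto
  moreover have "?A \<inter> range \<gamma> = {}" using \<delta>1(2) unfolding I_def by fastforce
  moreover have "connected ?A" by (rule connected_thick_arc) (use \<open>convex I\<close> in auto)
  ultimately obtain Q where Q: "Q \<in> regions \<gamma>" "?A \<subseteq> Q"
    using connected_subset_region by metis
  have tow: "lies_towards Q (\<gamma> (c + h * r)) w" if "0 \<le> r" "r < \<delta>1" for r
    using mem that Q(2) by (intro lies_towardsI[OF \<delta>1(1)]) blast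
  obtain \<delta>2 where \<delta>2: "\<delta>2 > 0" "\<And>s. s \<noteq> c \<Longrightarrow> \<bar>s - c\<bar> < \<delta>2 \<Longrightarrow> s \<notin> C"
    using C_isolated by blast
  have pos: "\<theta> * cross (d c) w > 0"
    using assms(3) paired_transverse[OF assms(1)]
    unfolding w_def \<theta>_def cross_add_right cross_scale_right by (auto simp: sgn_if)
  define f where "f s = \<theta> * cross (d s) w" for s
  have "isCont f c"
    unfolding f_def cross_def by (intro continuous_intros isCont_Im isCont_cnj isCont_tangent)
  moreover have "f c > 0" using pos by (simp add: f_def)
  ultimately obtain \<delta>3 where \<delta>3': "\<delta>3 > 0" "\<And>s. \<bar>s - c\<bar> < \<delta>3 \<Longrightarrow> \<bar>f s - f c\<bar> < f c"
    unfolding continuous_at_eps_delta dist_real_def by blast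
  have \<delta>3: "\<theta> * cross (d s) w > 0" if "\<bar>s - c\<bar> < \<delta>3" for s
    using \<delta>3'(2)[OF that] by (simp add: f_def abs_if split: if_splits)
  show thesis
  proof (rule that[OF Q(1)])
    show "min \<delta>1 (min \<delta>2 \<delta>3) > 0" using \<delta>1(1) \<delta>2(1) \<delta>3'(1)
      by simp
    show "lies_towards Q (\<gamma> c) (of_real h * d c + of_real k * d c')"
      using tow[of 0] \<delta>1(1) by (simp add: w_def)
    fix r assume r: "0 < r" "r < min \<delta>1 (min \<delta>2 \<delta>3)"
    have hr: "\<bar>h * r\<bar> = r" "h * r \<noteq> 0" using assms(2) r by auto
    then have nC: "c + h * r \<notin> C" using \<delta>2(2)[of "c + h * r"] r by auto
    have "lies_towards (side \<theta> (c + h * r)) (\<gamma> (c + h * r)) w"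
      using lies_towards_side_direction[OF nC \<theta>] \<delta>3 hr r by auto
    then have "side \<theta> (c + h * r) = Q"
      using lies_towards_unique tow[of r] r Q(1) side_region[OF nC \<theta>] by auto
    then show "c + h * r \<notin> C \<and> side (k * sgn (cross (d c) (d c'))) (c + h * r) = Q"
      using nC by (simp add: \<theta>_def)
  qed
qed

end

section \<open>Transverse curves and primeness\<close>

text \<open>An arc in \<open>P\<close> from \<open>p1\<close> to \<open>p2\<close> is cut at its
  last parameter in \<open>T1\<close> and then at the first later parameter in
  \<open>T2\<close>.\<close>

lemma arc_between_closed_sets:
  fixes P :: "complex set"
  assumes "open P" "connected P" "closed T1" "closed T2" "T1 \<inter> T2 = {}"
    and "p1 \<in> P \<inter> T1" "p2 \<in> P \<inter> T2"
  obtains g where "arc g" "path_image g \<subseteq> P"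
    "path_image g \<inter> T1 = {pathstart g}" "path_image g \<inter> T2 = {pathfinish g}"
proof -
  have "path_connected P" using assms(1,2) connected_open_path_connected by blast
  moreover have "p1 \<noteq> p2" using assms by auto
  ultimately obtain g where g: "arc g" "path_image g \<subseteq> P" "pathstart g = p1" "pathfinish g = p2"
    using assms(6,7) unfolding path_connected_arcwise by auto
  have cont: "continuous_on {0..1} g" using g(1) unfolding arc_def path_def by blast
  let ?A = "{0..1} \<inter> g -` T1"
  have "closed ?A" by (rule continuous_closed_preimage[OF cont]) (use assms in auto)
  then have "compact ?A" by (simp add: compact_eq_bounded_closed bounded_Int)
  moreover have "0 \<in> ?A" using g(3) assms(6) by (simp add: pathstart_def)
  ultimately obtain u1 where u1: "u1 \<in> ?A" "\<And>u. u \<in> ?A \<Longrightarrow> u \<le> u1"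
    using compact_attains_sup[of ?A] by blast
  let ?B = "{u1..1} \<inter> g -` T2"
  have "closed ?B"
    by (rule continuous_closed_preimage[OF continuous_on_subset[OF cont]]) (use assms u1 in auto)
  then have "compact ?B" by (simp add: compact_eq_bounded_closed bounded_Int)
  moreover have "1 \<in> ?B" using g(4) assms(7) u1 by (simp add: pathfinish_def)
  ultimately obtain u2 where u2: "u2 \<in> ?B" "\<And>u. u \<in> ?B \<Longrightarrow> u2 \<le> u"
    using compact_attains_inf[of ?B] by blast
  have "u1 \<noteq> u2" using u1(1) u2(1) assms(5) by auto
  then have u: "0 \<le> u1" "u1 < u2" "u2 \<le> 1" using u1(1) u2(1) by auto
  let ?g = "subpath u1 u2 g"
  have im: "path_image ?g = g ` {u1..u2}" using u by (simp add: path_image_subpath)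
  show thesis
  proof (rule that)
    show "arc ?g" using arc_subpath_arc[OF g(1)] u by auto
    show "path_image ?g \<subseteq> P" using g(2) u unfolding im by (auto simp: path_image_def)
    have "v = u1" if "v \<in> {u1..u2}" "g v \<in> T1" for v using u1(2)[of v] that u by auto
    moreover have "u1 \<in> {u1..u2}" "g u1 \<in> T1" using u u1(1) by auto
    ultimately show "path_image ?g \<inter> T1 = {pathstart ?g}" unfolding im pathstart_subpath by blast
    have "v = u2" if "v \<in> {u1..u2}" "g v \<in> T2" for v using u2(2)[of v] that u by auto
    moreover have "u2 \<in> {u1..u2}" "g u2 \<in> T2" using u u2(1) by auto
    ultimately show "path_image ?g \<inter> T2 = {pathfinish ?g}" unfolding im pathfinish_subpath
      by blast
  qed
qed

text \<open>Serves the straight pieces of a loop that is a nested join of four paths, each of them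
  traversed at fourfold speed.\<close>

lemma linepath_vector_derivative:
  fixes p q :: complex
  assumes "a < s" "s < b" "\<And>s. a < s \<Longrightarrow> s < b \<Longrightarrow> c s = linepath p q (4 * s - k)"
  shows "(c has_vector_derivative 4 * (q - p)) (at s)"
proof (rule has_vector_derivative_transform_within_open[of "\<lambda>s. linepath p q (4 * s - k)" _ _ "{a<..<b}"])
  show "((\<lambda>s. linepath p q (4 * s - k)) has_vector_derivative 4 * (q - p)) (at s)"
    unfolding linepath_def scaleR_conv_of_real has_vector_derivative_def
    by (auto intro!: derivative_eq_intros simp: scaleR_conv_of_real algebra_simps)
qed (use assms in auto)

lemma mem_segment_through:
  fixes z w :: complex
  assumes "e > 0" "f > 0"
  shows "z \<in> closed_segment (z - of_real e * w) (z + of_real f * w)"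
proof -
  define u where "u = e / (e + f)"
  have "0 \<le> u" "u \<le> 1" "u * f - (1 - u) * e = 0" using assms
    by (simp_all add: u_def field_simps)
  moreover have "(1 - u) *\<^sub>R (z - of_real e * w) + u *\<^sub>R (z + of_real f * w)
      = z + of_real (u * f - (1 - u) * e) * w"
    by (simp add: scaleR_conv_of_real algebra_simps)
  ultimately show ?thesis unfolding in_segment by (intro exI[of _ u]) simp
qed

context diagram begin

text \<open>The normal is oriented from \<open>U\<close> to \<open>P\<close>, so that the
  construction of a loop through both regions need not know which of them is on the left.\<close>

lemma transversal_segment:
  assumes "t \<notin> C" "side 1 t \<noteq> side (-1) t" "{side 1 t, side (-1) t} = {P, U}"
  obtains w \<delta> where "\<delta> > 0" "cross w (d t) \<noteq> 0" "w \<noteq> 0"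
    "\<And>\<eta>. 0 < \<eta> \<Longrightarrow> \<eta> < \<delta> \<Longrightarrow> \<gamma> t + of_real \<eta> * w \<in> P"
    "\<And>\<eta>. 0 < \<eta> \<Longrightarrow> \<eta> < \<delta> \<Longrightarrow> \<gamma> t - of_real \<eta> * w \<in> U"
proof -
  have "side 1 t = P \<and> side (-1) t = U \<or> side (-1) t = P \<and> side 1 t = U"
    using assms(3) by (auto simp: doubleton_eq_iff)
  then have "\<exists>\<theta>\<in>{1, -1}. side \<theta> t = P \<and> side (-\<theta>) t = U" by auto
  then obtain \<theta> where \<theta>: "\<theta> \<in> {1, -1}" "side \<theta> t = P" "side (-\<theta>) t = U"
    by blast
  define w where "w = of_real \<theta> * (\<i> * d t)"
  have "lies_towards P (\<gamma> t) w"
    using lies_towards_side[OF assms(1) \<theta>(1)] \<theta>(2) by (simp add: w_def)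
  then obtain \<delta>1 where \<delta>1: "\<delta>1 > 0" "\<And>\<eta>. 0 < \<eta> \<Longrightarrow> \<eta> < \<delta>1 \<Longrightarrow> \<gamma> t + of_real \<eta> * w \<in> P"
    using lies_towardsE by blast
  have "lies_towards U (\<gamma> t) (-w)"
    using lies_towards_side[OF assms(1), of "-\<theta>"] \<theta> by (auto simp: w_def)
  then obtain \<delta>2 where \<delta>2: "\<delta>2 > 0" "\<And>\<eta>. 0 < \<eta> \<Longrightarrow> \<eta> < \<delta>2 \<Longrightarrow> \<gamma> t + of_real \<eta> * (-w) \<in> U"
    using lies_towardsE by blast
  have 1: "cross (d t) w \<noteq> 0"
    using \<theta>(1) tangent_nonzero[of t] unfolding w_def cross_scale_right cross_rotate by auto
  show thesis
  proof (rule that)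
    show "min \<delta>1 \<delta>2 > 0" using \<delta>1 \<delta>2 by simp
    show "cross w (d t) \<noteq> 0" using 1 cross_skew[of w "d t"] by simp
    show "w \<noteq> 0" using 1 by auto
    show "\<gamma> t + of_real \<eta> * w \<in> P" if "0 < \<eta>" "\<eta> < min \<delta>1 \<delta>2" for \<eta>
      using \<delta>1(2) that by simp
    show "\<gamma> t - of_real \<eta> * w \<in> U" if "0 < \<eta>" "\<eta> < min \<delta>1 \<delta>2" for \<eta>
      using \<delta>2(2)[of \<eta>] that by simp
  qed
qed

lemma crossing_points_range: "crossing_points \<gamma> X \<subseteq> range \<gamma>"
  by (auto simp: crossing_points_def)

text \<open>Two short straight segments across the arcs are linked by an arc inside \<open>P\<close>
  and an arc inside \<open>U\<close>. Straightness gives the derivative needed for transversality,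
  and linking arcs that meet the segments only at their ends make the loop simple.\<close>

lemma transverse_curve:
  assumes t: "t1 \<notin> C" "t2 \<notin> C" "\<gamma> t1 \<noteq> \<gamma> t2"
    and PU: "P \<in> regions \<gamma>" "U \<in> regions \<gamma>" "P \<noteq> U"
    and s1: "{side 1 t1, side (-1) t1} = {P, U}"
    and s2: "{side 1 t2, side (-1) t2} = {P, U}"
  obtains c where "transverse_in_two_points \<gamma> X c" "path_image c \<inter> range \<gamma> = {\<gamma> t1, \<gamma> t2}"
proof -
  have disj: "P \<inter> U = {}" using PU region_eq by blast
  have offP: "P \<inter> range \<gamma> = {}" and offU: "U \<inter> range \<gamma> = {}"
    using PU region_disjoint by auto
  obtain w1 \<delta>1 where w1: "\<delta>1 > 0" "cross w1 (d t1) \<noteq> 0" "w1 \<noteq> 0"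
    "\<And>\<eta>. 0 < \<eta> \<Longrightarrow> \<eta> < \<delta>1 \<Longrightarrow> \<gamma> t1 + of_real \<eta> * w1 \<in> P"
    "\<And>\<eta>. 0 < \<eta> \<Longrightarrow> \<eta> < \<delta>1 \<Longrightarrow> \<gamma> t1 - of_real \<eta> * w1 \<in> U"
    using transversal_segment[OF t(1) _ s1] PU(3) s1 by (metis doubleton_eq_iff)
  obtain w2 \<delta>2 where w2: "\<delta>2 > 0" "cross w2 (d t2) \<noteq> 0" "w2 \<noteq> 0"
    "\<And>\<eta>. 0 < \<eta> \<Longrightarrow> \<eta> < \<delta>2 \<Longrightarrow> \<gamma> t2 + of_real \<eta> * w2 \<in> P"
    "\<And>\<eta>. 0 < \<eta> \<Longrightarrow> \<eta> < \<delta>2 \<Longrightarrow> \<gamma> t2 - of_real \<eta> * w2 \<in> U"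
    using transversal_segment[OF t(2) _ s2] PU(3) s2 by (metis doubleton_eq_iff)
  define N where "N = norm w1 + norm w2"
  have N: "N > 0" using w1(3) by (simp add: N_def add_pos_nonneg)
  have D: "norm (\<gamma> t1 - \<gamma> t2) > 0" using t(3) by simp
  \<comment> \<open>The bound by \<open>norm (\<gamma> t1 - \<gamma> t2) / N\<close> keeps the two
    segments disjoint.\<close>
  define \<eta> where "\<eta> = min (min \<delta>1 \<delta>2) (norm (\<gamma> t1 - \<gamma> t2) / N) / 2"
  have "0 < 2 * \<eta>" "2 * \<eta> \<le> \<delta>1" "2 * \<eta> \<le> \<delta>2" "2 * \<eta> \<le> norm (\<gamma> t1 - \<gamma> t2) / N"
    using w1(1) w2(1) divide_pos_pos[OF D N] by (simp_all add: \<eta>_def)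
  then have \<eta>: "0 < \<eta>" "\<eta> < \<delta>1" "\<eta> < \<delta>2" "\<eta> < norm (\<gamma> t1 - \<gamma> t2) / N"
    by linarith+
  then have \<eta>N: "\<eta> * N < norm (\<gamma> t1 - \<gamma> t2)" using N
    by (simp add: pos_less_divide_eq)
  define T1 where "T1 = (\<lambda>e. \<gamma> t1 + of_real e * w1) ` {-\<eta>..\<eta>}"
  define T2 where "T2 = (\<lambda>e. \<gamma> t2 + of_real e * w2) ` {-\<eta>..\<eta>}"
  have clT: "closed T1" "closed T2" unfolding T1_def T2_def
    by (intro compact_imp_closed compact_continuous_image continuous_intros; simp)+
  have T12: "T1 \<inter> T2 = {}"
  proof (rule ccontr)
    assume "T1 \<inter> T2 \<noteq> {}"
    then obtain e f where ef: "\<bar>e\<bar> \<le> \<eta>" "\<bar>f\<bar> \<le> \<eta>" "\<gamma> t1 + of_real e * w1 = \<gamma> t2 + of_real f * w2"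
      unfolding T1_def T2_def by (auto simp: abs_le_iff) (metis abs_le_iff minus_le_iff)
    then have "norm (\<gamma> t1 - \<gamma> t2) = norm (of_real f * w2 - of_real e * w1)"
      by (metis add_diff_cancel_left add_diff_eq diff_add_cancel diff_add_eq)
    also have "\<dots> \<le> \<bar>f\<bar> * norm w2 + \<bar>e\<bar> * norm w1"
      using norm_triangle_ineq4[of "of_real f * w2" "of_real e * w1"] by (simp add: norm_mult)
    also have "\<dots> \<le> \<eta> * norm w2 + \<eta> * norm w1" using ef
      by (intro add_mono mult_right_mono) auto
    finally show False using \<eta>N by (simp add: N_def algebra_simps)
  qed
  have T1_cases: "(e > 0 \<longrightarrow> \<gamma> t1 + of_real e * w1 \<in> P) \<and> (e < 0 \<longrightarrow> \<gamma> t1 + of_real e * w1 \<in> U)"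
    if "e \<in> {-\<eta>..\<eta>}" for e
    using w1(4)[of e] w1(5)[of "-e"] that \<eta> by auto
  have T2_cases: "(e > 0 \<longrightarrow> \<gamma> t2 + of_real e * w2 \<in> P) \<and> (e < 0 \<longrightarrow> \<gamma> t2 + of_real e * w2 \<in> U)"
    if "e \<in> {-\<eta>..\<eta>}" for e
    using w2(4)[of e] w2(5)[of "-e"] that \<eta> by auto
  have T1_range: "T1 \<inter> range \<gamma> = {\<gamma> t1}"
  proof -
    have "e = 0" if "e \<in> {-\<eta>..\<eta>}" "\<gamma> t1 + of_real e * w1 \<in> range \<gamma>" for e
      using T1_cases[OF that(1)] offP offU that(2) by (metis disjoint_iff linorder_neqE_linordered_idom)
    moreover have "\<gamma> t1 \<in> T1" using \<eta>(1) unfolding T1_def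
      by (intro image_eqI[of _ _ 0]) auto
    ultimately show ?thesis unfolding T1_def by fastforce
  qed
  have T2_range: "T2 \<inter> range \<gamma> = {\<gamma> t2}"
  proof -
    have "e = 0" if "e \<in> {-\<eta>..\<eta>}" "\<gamma> t2 + of_real e * w2 \<in> range \<gamma>" for e
      using T2_cases[OF that(1)] offP offU that(2) by (metis disjoint_iff linorder_neqE_linordered_idom)
    moreover have "\<gamma> t2 \<in> T2" using \<eta>(1) unfolding T2_def
      by (intro image_eqI[of _ _ 0]) auto
    ultimately show ?thesis unfolding T2_def by fastforce
  qed
  have "\<gamma> t1 + of_real \<eta> * w1 \<in> P \<inter> T1" "\<gamma> t2 + of_real \<eta> * w2 \<in> P \<inter> T2"
    using T1_cases[of \<eta>] T2_cases[of \<eta>] \<eta>(1) by (auto simp: T1_def T2_def)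
  then obtain gP where gP: "arc gP" "path_image gP \<subseteq> P"
    "path_image gP \<inter> T1 = {pathstart gP}" "path_image gP \<inter> T2 = {pathfinish gP}"
    using arc_between_closed_sets[OF open_region[OF PU(1)] connected_region[OF PU(1)] clT T12] by metis
  have "\<gamma> t1 + of_real (-\<eta>) * w1 \<in> U \<inter> T1" "\<gamma> t2 + of_real (-\<eta>) * w2 \<in> U \<inter> T2"
  proof -
    have m: "-\<eta> \<in> {-\<eta>..\<eta>}" "-\<eta> < 0" using \<eta>(1) by auto
    show "\<gamma> t1 + of_real (-\<eta>) * w1 \<in> U \<inter> T1" "\<gamma> t2 + of_real (-\<eta>) * w2 \<in> U \<inter> T2"
      using T1_cases[OF m(1)] T2_cases[OF m(1)] m unfolding T1_def T2_def by blast+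
  qed
  then obtain gU where gU: "arc gU" "path_image gU \<subseteq> U"
    "path_image gU \<inter> T1 = {pathstart gU}" "path_image gU \<inter> T2 = {pathfinish gU}"
    using arc_between_closed_sets[OF open_region[OF PU(2)] connected_region[OF PU(2)] clT T12] by metis
  define p1 p2 q1 q2 where "p1 = pathstart gP" and "p2 = pathfinish gP"
    and "q1 = pathstart gU" and "q2 = pathfinish gU"
  have pq: "p1 \<in> P \<inter> T1" "p2 \<in> P \<inter> T2" "q1 \<in> U \<inter> T1" "q2 \<in> U \<inter> T2"
    using gP gU by (auto simp: p1_def p2_def q1_def q2_def)
  \<comment> \<open>On each segment the two linking arcs end on opposite halves, so the piece
    between these ends passes through the point of the diagram.\<close>
  have pos1: "\<exists>e. 0 < e \<and> e \<le> \<eta> \<and> p = \<gamma> t1 + of_real e * w1" if "p \<in> P \<inter> T1" for p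
  proof -
    obtain e where e: "e \<in> {-\<eta>..\<eta>}" "p = \<gamma> t1 + of_real e * w1"
      using \<open>p \<in> P \<inter> T1\<close> unfolding T1_def by blast
    have "e > 0" using T1_cases[OF e(1)] e(2) that disj offP
      by (metis Int_iff add.right_neutral disjoint_iff linorder_neqE_linordered_idom mult_zero_left of_real_0 rangeI)
    then show ?thesis using e by auto
  qed
  have pos2: "\<exists>e. 0 < e \<and> e \<le> \<eta> \<and> p = \<gamma> t2 + of_real e * w2" if "p \<in> P \<inter> T2" for p
  proof -
    obtain e where e: "e \<in> {-\<eta>..\<eta>}" "p = \<gamma> t2 + of_real e * w2"
      using \<open>p \<in> P \<inter> T2\<close> unfolding T2_def by blast
    have "e > 0" using T2_cases[OF e(1)] e(2) that disj offP
      by (metis Int_iff add.right_neutral disjoint_iff linorder_neqE_linordered_idom mult_zero_left of_real_0 rangeI)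
    then show ?thesis using e by auto
  qed
  have neg1: "\<exists>e. 0 < e \<and> e \<le> \<eta> \<and> p = \<gamma> t1 - of_real e * w1" if "p \<in> U \<inter> T1" for p
  proof -
    obtain e where e: "e \<in> {-\<eta>..\<eta>}" "p = \<gamma> t1 + of_real e * w1"
      using \<open>p \<in> U \<inter> T1\<close> unfolding T1_def by blast
    have "e < 0" using T1_cases[OF e(1)] e(2) that disj offU
      by (metis Int_iff add.right_neutral disjoint_iff linorder_neqE_linordered_idom mult_zero_left of_real_0 rangeI)
    then show ?thesis using e by (intro exI[of _ "-e"]) auto
  qed
  have neg2: "\<exists>e. 0 < e \<and> e \<le> \<eta> \<and> p = \<gamma> t2 - of_real e * w2" if "p \<in> U \<inter> T2" for p
  proof -
    obtain e where e: "e \<in> {-\<eta>..\<eta>}" "p = \<gamma> t2 + of_real e * w2"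
      using \<open>p \<in> U \<inter> T2\<close> unfolding T2_def by blast
    have "e < 0" using T2_cases[OF e(1)] e(2) that disj offU
      by (metis Int_iff add.right_neutral disjoint_iff linorder_neqE_linordered_idom mult_zero_left of_real_0 rangeI)
    then show ?thesis using e by (intro exI[of _ "-e"]) auto
  qed
  obtain e1 where e1: "0 < e1" "e1 \<le> \<eta>" "p1 = \<gamma> t1 + of_real e1 * w1" using pos1 pq
    by blast
  obtain e2 where e2: "0 < e2" "e2 \<le> \<eta>" "p2 = \<gamma> t2 + of_real e2 * w2" using pos2 pq
    by blast
  obtain f1 where f1: "0 < f1" "f1 \<le> \<eta>" "q1 = \<gamma> t1 - of_real f1 * w1" using neg1 pq
    by blast
  obtain f2 where f2: "0 < f2" "f2 \<le> \<eta>" "q2 = \<gamma> t2 - of_real f2 * w2" using neg2 pq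
    by blast
  have convT: "convex T1" "convex T2"
    using convex_translation[OF convex_linear_image[of "\<lambda>e. complex_of_real e * w1" "{-\<eta>..\<eta>}"], of "\<gamma> t1"]
      convex_translation[OF convex_linear_image[of "\<lambda>e. complex_of_real e * w2" "{-\<eta>..\<eta>}"], of "\<gamma> t2"]
    by (auto simp: T1_def T2_def image_image linear_iff algebra_simps scaleR_conv_of_real)
  define l1 l2 where "l1 = linepath q1 p1" and "l2 = linepath p2 q2"
  have l_sub: "path_image l1 \<subseteq> T1" "path_image l2 \<subseteq> T2"
    using pq convT by (auto simp: l1_def l2_def closed_segment_subset)
  have "q1 \<noteq> p1" "p2 \<noteq> q2" using pq disj by auto
  then have l_arc: "arc l1" "arc l2" by (auto simp: l1_def l2_def)
  have seg1: "\<gamma> t1 \<in> path_image l1"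
    using mem_segment_through[of f1 e1 "\<gamma> t1" w1] e1 f1 by (simp add: l1_def)
  have seg2: "\<gamma> t2 \<in> path_image l2"
    using mem_segment_through[of f2 e2 "\<gamma> t2" w2] e2 f2
      by (simp add: l2_def closed_segment_commute)
  define g1 g2 where "g1 = l1 +++ gP" and "g2 = l2 +++ reversepath gU"
  define c where "c = g1 +++ g2"
  have ends: "pathstart l1 = q1" "pathfinish l1 = p1" "pathstart l2 = p2" "pathfinish l2 = q2"
    "pathstart gP = p1" "pathfinish gP = p2" "pathstart gU = q1" "pathfinish gU = q2"
    by (auto simp: l1_def l2_def p1_def p2_def q1_def q2_def)
  have im1: "path_image g1 = path_image l1 \<union> path_image gP"
    and im2: "path_image g2 = path_image l2 \<union> path_image gU"
    unfolding g1_def g2_def by (simp_all add: path_image_join ends)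
  have arcs: "arc g1" "arc g2"
  proof -
    have "path_image l1 \<inter> path_image gP \<subseteq> {p1}" using l_sub(1) gP(3) ends(5) by blast
    then show "arc g1" unfolding g1_def using l_arc(1) gP(1) ends by (intro arc_join) auto
    have "path_image l2 \<inter> path_image gU \<subseteq> {q2}" using l_sub(2) gU(4) ends(8) by blast
    then show "arc g2" unfolding g2_def using l_arc(2) gU(1) ends
      by (intro arc_join) (auto simp: arc_reversepath)
  qed
  have "path_image l1 \<inter> path_image l2 = {}" using l_sub T12 by blast
  moreover have "path_image l1 \<inter> path_image gU \<subseteq> {q1}" using l_sub(1) gU(3) ends(7)
    by blast
  moreover have "path_image gP \<inter> path_image l2 \<subseteq> {p2}" using l_sub(2) gP(4) ends(6)
    by blast
  moreover have "path_image gP \<inter> path_image gU = {}" using gP(2) gU(2) disj by blast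
  ultimately have "path_image g1 \<inter> path_image g2 \<subseteq> {q1, p2}" unfolding im1 im2 by blast
  moreover have ends': "pathstart g1 = q1" "pathfinish g1 = p2" "pathstart g2 = p2" "pathfinish g2 = q1"
    by (auto simp: g1_def g2_def ends)
  ultimately have simp_c: "simple_path c"
    unfolding c_def using arcs by (intro simple_path_join_loop) auto
  have im: "path_image c = path_image l1 \<union> path_image gP \<union> path_image l2 \<union> path_image gU"
    unfolding c_def by (auto simp: path_image_join ends' im1 im2)
  have l1_range: "t = \<gamma> t1" if "t \<in> path_image l1" "t \<in> range \<gamma>" for t
    using that T1_range l_sub by blast
  have l2_range: "t = \<gamma> t2" if "t \<in> path_image l2" "t \<in> range \<gamma>" for t
    using that T2_range l_sub by blast
  have c_range: "path_image c \<inter> range \<gamma> = {\<gamma> t1, \<gamma> t2}"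
  proof -
    have "path_image l1 \<inter> range \<gamma> = {\<gamma> t1}" "path_image l2 \<inter> range \<gamma> = {\<gamma> t2}"
      using l1_range l2_range seg1 seg2 by blast+
    moreover have "path_image gP \<inter> range \<gamma> = {}" "path_image gU \<inter> range \<gamma> = {}"
      using gP(2) gU(2) offP offU by blast+
    ultimately show ?thesis unfolding im Int_Un_distrib2 by (simp add: insert_commute)
  qed
  \<comment> \<open>The nested join traverses each of its four pieces in a quarter of the unit
    interval.\<close>
  have c1: "c s = linepath q1 p1 (4 * s - 0)" if "s \<le> 1/4" for s
    using that by (simp add: c_def g1_def l1_def joinpaths_def)
  have c2: "c s = gP (4 * s - 1)" if "1/4 < s" "s \<le> 1/2" for s
    using that by (simp add: c_def g1_def joinpaths_def)
  have c3: "c s = linepath p2 q2 (4 * s - 2)" if "1/2 < s" "s \<le> 3/4" for s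
    using that by (simp add: c_def g2_def l2_def joinpaths_def algebra_simps)
  have c4: "c s = reversepath gU (4 * s - 3)" if "3/4 < s" for s
    using that by (simp add: c_def g2_def joinpaths_def algebra_simps)
  \<comment> \<open>Where two pieces are joined the loop need not be differentiable, but these
    points lie in \<open>P\<close> or \<open>U\<close> and thus off the diagram.\<close>
  have trans: "\<exists>w. (c has_vector_derivative w) (at s) \<and> cross w (d t) \<noteq> 0"
    if s: "s \<in> {0<..<1}" and st: "c s = \<gamma> t" for s t
  proof -
    have tr: "c s \<in> range \<gamma>" using st by simp
    consider "s < 1/4" | "s = 1/4" | "1/4 < s" "s \<le> 1/2" | "1/2 < s" "s < 3/4" | "s = 3/4" | "3/4 < s"
      by linarith
    then show ?thesis
    proof cases
      case 1
      have "(c has_vector_derivative 4 * (p1 - q1)) (at s)"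
        by (rule linepath_vector_derivative[of 0 s "1/4" c q1 p1 0]) (use 1 s c1 in auto)
      moreover have "p1 - q1 = of_real (e1 + f1) * w1" using e1 f1 by (simp add: algebra_simps)
      then have k: "4 * (p1 - q1) = of_real (4 * (e1 + f1)) * w1" by simp
      moreover have "c s \<in> path_image l1"
        using 1 s c1 by (auto simp: l1_def path_image_def)
      then have "\<gamma> t = \<gamma> t1" using l1_range tr st by auto
      then have "d t = d t1" using inj_off_C[OF t(1)] tangent_frac by metis
      moreover have "cross (of_real (4 * (e1 + f1)) * w1) (d t1) \<noteq> 0"
        unfolding cross_scale_left using w1(2) e1(1) f1(1) by simp
      ultimately show ?thesis unfolding k by metis
    next
      case 2
      have "c s = p1" unfolding 2 using c1[of "1/4"] by (simp add: linepath_def)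
      then show ?thesis using pq(1) offP tr by auto
    next
      case 3
      then have "c s \<in> path_image gP" using c2 by (auto simp: path_image_def)
      then show ?thesis using gP(2) offP tr by auto
    next
      case 4
      have "(c has_vector_derivative 4 * (q2 - p2)) (at s)"
        by (rule linepath_vector_derivative[of "1/2" s "3/4" c p2 q2 2]) (use 4 s c3 in auto)
      moreover have "q2 - p2 = of_real (- (e2 + f2)) * w2" using e2 f2 by (simp add: algebra_simps)
      then have k: "4 * (q2 - p2) = of_real (- 4 * (e2 + f2)) * w2" by simp
      moreover have "c s \<in> path_image l2"
        using 4 s c3 by (auto simp: l2_def path_image_def)
      then have "\<gamma> t = \<gamma> t2" using l2_range tr st by auto
      then have "d t = d t2" using inj_off_C[OF t(2)] tangent_frac by metis
      moreover have "cross (of_real (- 4 * (e2 + f2)) * w2) (d t2) \<noteq> 0"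
        unfolding cross_scale_left using w2(2) e2(1) f2(1) by simp
      ultimately show ?thesis unfolding k by metis
    next
      case 5
      have "c s = q2" unfolding 5 using c3[of "3/4"] by (simp add: linepath_def)
      then show ?thesis using pq(4) offU tr by auto
    next
      case 6
      then have "c s \<in> path_image (reversepath gU)" using c4 s by (auto simp: path_image_def)
      then show ?thesis using gU(2) offU tr by auto
    qed
  qed
  have "transverse_in_two_points \<gamma> X c"
    unfolding transverse_in_two_points_def
  proof (intro conjI ballI allI impI)
    show "simple_path c" by fact
    show "pathfinish c = pathstart c" by (simp add: c_def ends')
    show "pathstart c \<notin> range \<gamma>" using pq(3) offU by (auto simp: c_def ends')
    show "card (path_image c \<inter> range \<gamma>) = 2" using c_range t(3) by simp
    have "path_image c \<inter> crossing_points \<gamma> X \<subseteq> {\<gamma> t1, \<gamma> t2}"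
      unfolding c_range[symmetric] using crossing_points_range by (rule Int_mono[OF order_refl])
    then show "path_image c \<inter> crossing_points \<gamma> X = {}"
      using t(1,2) unfolding C_def by auto
  qed (use trans in auto)
  then show thesis using that c_range by blast
qed

text \<open>The two points cut the knot into two open arcs that avoid the loop, so each of them lies
  in the open disk \<open>K\<close> given by primeness or misses it. If both missed it, the closed
  disk would meet the diagram in at most two points, too few for an arc; and the part of the diagram
  in \<open>K\<close> has no crossing.\<close>

lemma edge_on_one_side:
  assumes "prime_diagram \<gamma> X"
    and t: "t1 \<notin> C" "t2 \<notin> C" "t1 < t2" "t2 < t1 + 1"
    and PU: "P \<in> regions \<gamma>" "U \<in> regions \<gamma>" "P \<noteq> U"
    and s1: "{side 1 t1, side (-1) t1} = {P, U}"
    and s2: "{side 1 t2, side (-1) t2} = {P, U}"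
  shows "{t1..t2} \<inter> C = {} \<or> {t2..t1 + 1} \<inter> C = {}"
proof -
  have ne: "\<gamma> t1 \<noteq> \<gamma> t2"
  proof
    assume "\<gamma> t1 = \<gamma> t2"
    then have "frac t1 = frac t2" using inj_off_C t by blast
    then obtain n :: int where "t1 = t2 + of_int n" by (rule frac_eqE)
    then have "-1 < real_of_int n" "real_of_int n < 0" using t by auto
    then have "-1 < n" "n < 0" by linarith+
    then show False by linarith
  qed
  obtain c where c: "transverse_in_two_points \<gamma> X c" "path_image c \<inter> range \<gamma> = {\<gamma> t1, \<gamma> t2}"
    using transverse_curve[OF t(1,2) ne PU s1 s2] by blast
  obtain K where K1: "K \<in> {inside (path_image c), outside (path_image c)}"
    "\<exists>g. arc g \<and> path_image g = closure K \<inter> range \<gamma>" "closure K \<inter> crossing_points \<gamma> X = {}"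
    using assms(1)[unfolded prime_diagram_def, rule_format, OF c(1)] by metis
  then obtain g where K: "K \<in> {inside (path_image c), outside (path_image c)}"
    "arc g" "path_image g = closure K \<inter> range \<gamma>" "closure K \<inter> crossing_points \<gamma> X = {}"
      by metis
  have J: "simple_path c" "pathfinish c = pathstart c"
    using c(1) by (auto simp: transverse_in_two_points_def)
  note JJ = Jordan_inside_outside[OF J]
  have K_cl: "closure K \<subseteq> K \<union> path_image c"
    using K(1) JJ frontier_def[of K] interior_open[of K] by auto
  have off: "\<gamma> t \<notin> path_image c" if "t1 < t" "t < t1 + 1" "t \<noteq> t2" for t
  proof
    assume "\<gamma> t \<in> path_image c"
    then have "\<gamma> t = \<gamma> t1 \<or> \<gamma> t = \<gamma> t2" using c(2) by auto
    then have "frac t = frac t1 \<or> frac t = frac t2" using inj_off_C t by blast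
    then obtain n :: int where "t = t1 + of_int n \<or> t = t2 + of_int n" by (metis frac_eqE)
    moreover have "real_of_int n \<noteq> 0" using that calculation by auto
    then have "n \<ge> 1 \<or> n \<le> -1" by linarith
    then have "real_of_int n \<ge> 1 \<or> real_of_int n \<le> -1" by linarith
    ultimately show False using that t by linarith
  qed
  have dich: "\<gamma> ` I \<subseteq> K \<or> \<gamma> ` I \<inter> K = {}" if "I \<subseteq> {t1<..<t1+1} - {t2}" "connected I" for I
  proof -
    have con: "connected (\<gamma> ` I)"
      by (rule connected_continuous_image[OF continuous_curve that(2)])
    have "\<gamma> t \<notin> path_image c" if "t \<in> I" for t
    proof -
      have "t \<in> {t1<..<t1+1} - {t2}" using that \<open>I \<subseteq> _\<close> by blast
      then show ?thesis using off by simp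
    qed
    then have sub: "\<gamma> ` I \<subseteq> inside (path_image c) \<union> outside (path_image c)"
      by auto
    have "inside (path_image c) \<inter> \<gamma> ` I = {} \<or> outside (path_image c) \<inter> \<gamma> ` I = {}"
      using connectedD[OF con, of "inside (path_image c)" "outside (path_image c)"] sub JJ by simp
    then show ?thesis using K(1) sub by blast
  qed
  have shift: "\<exists>s. t1 \<le> s \<and> s < t1 + 1 \<and> \<gamma> s = \<gamma> t" for t
  proof (intro exI conjI)
    show "t1 \<le> t1 + frac (t - t1)" "t1 + frac (t - t1) < t1 + 1" by (auto simp: frac_lt_1)
    show "\<gamma> (t1 + frac (t - t1)) = \<gamma> t" using per[of t "- \<lfloor>t - t1\<rfloor>"]
      by (simp add: frac_def)
  qed
  have "\<gamma> ` {t1<..<t2} \<subseteq> K \<or> \<gamma> ` {t2<..<t1+1} \<subseteq> K"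
  proof (rule ccontr)
    assume n: "\<not> ?thesis"
    have no: "\<gamma> ` {t1<..<t2} \<inter> K = {}" "\<gamma> ` {t2<..<t1+1} \<inter> K = {}"
    proof -
      have "{t1<..<t2} \<subseteq> {t1<..<t1+1} - {t2}" "{t2<..<t1+1} \<subseteq> {t1<..<t1+1} - {t2}"
        using t by auto
      then show "\<gamma> ` {t1<..<t2} \<inter> K = {}" "\<gamma> ` {t2<..<t1+1} \<inter> K = {}"
        using dich[OF _ connected_Ioo] n by blast+
    qed
    have noK: "\<gamma> s \<notin> K" if "s \<in> {t1..<t1+1}" for s
    proof (cases "s = t1 \<or> s = t2")
      case True
      then have "\<gamma> s \<in> path_image c" using c(2) by auto
      then show ?thesis using K(1) JJ by blast
    next
      case False
      then have "s \<in> {t1<..<t2} \<or> s \<in> {t2<..<t1+1}" using that by auto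
      then show ?thesis using no by blast
    qed
    have "path_image g \<subseteq> {\<gamma> t1, \<gamma> t2}"
    proof
      fix z assume z: "z \<in> path_image g"
      then obtain t where "z = \<gamma> t" using K(3) by auto
      then have "z \<notin> K" using noK shift[of t] by (metis atLeastLessThan_iff)
      then show "z \<in> {\<gamma> t1, \<gamma> t2}" using z K(3) K_cl c(2) by blast
    qed
    then have "finite (g ` {0..1})" by (simp add: path_image_def finite_subset)
    then have "finite {0..1::real}" using K(2) finite_imageD unfolding arc_def by blast
    then show False using infinite_Icc[of "0::real" 1] by simp
  qed
  moreover have noC: "I \<inter> C = {}" if "\<gamma> ` I \<subseteq> K" for I
    using that K(4) closure_subset[of K] unfolding C_def by blast
  have "t1 + 1 \<notin> C" using C_per[of t1 1] t by simp
  have "{t1..t2} \<inter> C \<subseteq> {t1<..<t2} \<inter> C" "{t2..t1+1} \<inter> C \<subseteq> {t2<..<t1+1} \<inter> C"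
    using t \<open>t1 + 1 \<notin> C\<close> by (auto simp: less_le)
  then show ?thesis using noC calculation by blast
qed

end

context diagram begin

section \<open>Corners, half edges and edges\<close>

lemma paired_X: "x \<in> X \<Longrightarrow> paired (fst x) (snd x)"
  by (simp add: paired_def)

lemma X_point: "x \<in> X \<Longrightarrow> \<gamma> (snd x) = \<gamma> (fst x)" and X_distinct: "x \<in> X \<Longrightarrow> fst x \<noteq> snd x"
  using paired_X paired_iff paired_unit by metis+

definition "time x over = (if over then fst x else snd x)"

text \<open>The usual sign of a crossing: 1 for a right-handed and -1 for a left-handed one.\<close>

definition "orientation x = sgn (cross (d (fst x)) (d (snd x)))"

definition "corner x a b = (THE Q. Q \<in> regions \<gamma> \<and> at_corner \<gamma> x a b Q)"

(* The region to the left (\<theta> = 1) or right (\<theta> = -1), with respect to the orientation of the knot,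
   of the outgoing (h = 1) or incoming (h = -1) end of the over- or under-strand at x. *)
definition "half_edge_side \<theta> x over h =
  (if over then corner x h (\<theta> * orientation x) else corner x (- \<theta> * orientation x) h)"

lemma orientation_cases: "x \<in> X \<Longrightarrow> orientation x \<in> {1, -1}"
  using X_transverse by (auto simp: orientation_def sgn_if)

lemma time_unit: "x \<in> X \<Longrightarrow> time x ov \<in> {0..<1}"
  using X_unit by (simp add: time_def)

lemma time_frac: "x \<in> X \<Longrightarrow> frac (time x ov) = time x ov"
  using time_unit[of x ov] by (simp add: frac_eq)

lemma time_in_C: "x \<in> X \<Longrightarrow> time x ov \<in> C"
  using X_point by (force simp: C_def crossing_points_def time_def case_prod_unfold)

lemma C_time:
  assumes "c \<in> C"
  obtains x ov where "x \<in> X" "time x ov = frac c"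
proof -
  obtain c' where "paired (frac c) c'" using assms C_iff_paired by blast
  then consider "(frac c, c') \<in> X" | "(c', frac c) \<in> X" unfolding paired_def by blast
  then show thesis
    by cases (use that[of "(frac c, c')" True] that[of "(c', frac c)" False] in \<open>auto simp: time_def\<close>)
qed

lemma crossing_eq:
  assumes "x \<in> X" "y \<in> X" "\<gamma> (fst x) = \<gamma> (fst y)"
  shows "x = y"
proof -
  have "fst y = fst x \<or> fst y = snd x" "snd y = fst x \<or> snd y = snd x"
    using paired_frac[OF paired_X[OF assms(1)], of "fst y"] paired_frac[OF paired_X[OF assms(1)], of "snd y"]
      time_frac[OF assms(2), of True] time_frac[OF assms(2), of False] X_point[OF assms(2)] assms(3)
    by (auto simp: time_def)
  moreover have "\<forall>s t. (s, t) \<in> X \<longrightarrow> (t, s) \<notin> X" using diagram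
    unfolding knot_diagram_def by argo
  ultimately show ?thesis using X_distinct[OF assms(2)] assms(1,2) by (metis prod.collapse)
qed

lemma time_inj:
  assumes "x \<in> X" "y \<in> X" "time x ov = time y ov'"
  shows "x = y \<and> ov = ov'"
proof -
  have "\<gamma> (fst z) = \<gamma> (time z o')" if "z \<in> X" for z o' using X_point[OF that]
    by (simp add: time_def)
  then have "x = y" using crossing_eq[OF assms(1,2)] assms by metis
  then show ?thesis using assms X_distinct[OF assms(1)] by (auto simp: time_def split: if_splits)
qed

lemma corner_eqI: "Q \<in> regions \<gamma> \<Longrightarrow> at_corner \<gamma> x a b Q \<Longrightarrow> corner x a b = Q"
  unfolding corner_def at_corner_def using lies_towards_unique by (intro the_equality) blast+

lemma
  assumes "x \<in> X" "a \<in> {1, -1}" "b \<in> {1, -1}"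
  shows corner_region: "corner x a b \<in> regions \<gamma>" and at_corner_corner: "at_corner \<gamma> x a b (corner x a b)"
proof -
  obtain Q \<delta> where "Q \<in> regions \<gamma>" "lies_towards Q (\<gamma> (fst x)) (of_real a * d (fst x) + of_real b * d (snd x))"
    using corner_nearby[OF paired_X[OF assms(1)] assms(2,3)] by metis
  then have "Q \<in> regions \<gamma>" "at_corner \<gamma> x a b Q" by (simp_all add: at_corner_def)
  then show "corner x a b \<in> regions \<gamma>" "at_corner \<gamma> x a b (corner x a b)"
    using corner_eqI by auto
qed

lemma at_corner_iff:
  assumes "x \<in> X" "a \<in> {1, -1}" "b \<in> {1, -1}" "Q \<in> regions \<gamma>"
  shows "at_corner \<gamma> x a b Q \<longleftrightarrow> corner x a b = Q"
  using corner_eqI at_corner_corner assms by metis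

text \<open>Apply \<open>corner_nearby\<close> with the strand of the half edge as base. For the
  under-strand the two tangents change roles, which reverses the sign of their cross product; this
  is the origin of the minus sign in \<open>half_edge_side\<close>.\<close>

lemma half_edge_nearby:
  assumes "x \<in> X" "h \<in> {1, -1}" "\<theta> \<in> {1, -1}"
  obtains \<delta> where "\<delta> > 0" "\<And>r. 0 < r \<Longrightarrow> r < \<delta> \<Longrightarrow>
    time x ov + h * r \<notin> C \<and> side \<theta> (time x ov + h * r) = half_edge_side \<theta> x ov h"
proof (cases ov)
  case True
  have k: "\<theta> * orientation x \<in> {1, -1}" using assms(3) orientation_cases[OF assms(1)] by auto
  obtain Q \<delta> where Q: "Q \<in> regions \<gamma>" "\<delta> > 0"
    "lies_towards Q (\<gamma> (fst x)) (of_real h * d (fst x) + of_real (\<theta> * orientation x) * d (snd x))"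
    "\<And>r. 0 < r \<Longrightarrow> r < \<delta> \<Longrightarrow> fst x + h * r \<notin> C \<and>
      side (\<theta> * orientation x * sgn (cross (d (fst x)) (d (snd x)))) (fst x + h * r) = Q"
    using corner_nearby[OF paired_X[OF assms(1)] assms(2) k] by metis
  have eq: "\<theta> * orientation x * sgn (cross (d (fst x)) (d (snd x))) = \<theta>"
    using orientation_cases[OF assms(1)] unfolding orientation_def[symmetric] by auto
  have "corner x h (\<theta> * orientation x) = Q"
    using Q(1,3) by (intro corner_eqI) (simp_all add: at_corner_def)
  then show thesis using Q(4)[unfolded eq] True
    by (intro that[OF Q(2)]) (simp add: time_def half_edge_side_def)
next
  case False
  have k: "- \<theta> * orientation x \<in> {1, -1}" using assms(3) orientation_cases[OF assms(1)]
    by auto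
  have p: "paired (snd x) (fst x)" using paired_X[OF assms(1)] paired_sym by blast
  obtain Q \<delta> where Q: "Q \<in> regions \<gamma>" "\<delta> > 0"
    "lies_towards Q (\<gamma> (snd x)) (of_real h * d (snd x) + of_real (- \<theta> * orientation x) * d (fst x))"
    "\<And>r. 0 < r \<Longrightarrow> r < \<delta> \<Longrightarrow> snd x + h * r \<notin> C \<and>
      side (- \<theta> * orientation x * sgn (cross (d (snd x)) (d (fst x)))) (snd x + h * r) = Q"
    using corner_nearby[OF p assms(2) k] by metis
  have "sgn (cross (d (snd x)) (d (fst x))) = - orientation x"
    unfolding orientation_def cross_skew[of "d (snd x)"] by (simp add: sgn_minus)
  then have "- \<theta> * orientation x * sgn (cross (d (snd x)) (d (fst x))) = \<theta>"
    using orientation_cases[OF assms(1)] by auto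
  moreover have "corner x (- \<theta> * orientation x) h = Q"
    using Q(1,3) X_point[OF assms(1)] by (intro corner_eqI) (simp_all add: at_corner_def add.commute)
  ultimately show thesis using Q(4) False
    by (intro that[OF Q(2)]) (simp add: time_def half_edge_side_def)
qed

text \<open>Edges are lifted to the real line: integer translates describe the same arc of the
  diagram, and a diagram without crossings has no edge.\<close>

definition "edge \<alpha> \<beta> \<longleftrightarrow> \<alpha> < \<beta> \<and> \<alpha> \<in> C \<and> \<beta> \<in> C \<and> {\<alpha><..<\<beta>} \<inter> C = {}"

text \<open>By periodicity there is a crossing parameter within one period on either side of
  \<open>t\<close>, so the nearest ones are extrema of finite nonempty sets.\<close>

lemma edge_around:
  assumes "t \<notin> C" "C \<noteq> {}"
  obtains \<alpha> \<beta> where "edge \<alpha> \<beta>" "t \<in> {\<alpha><..<\<beta>}"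
proof -
  obtain c where c: "c \<in> C" using assms(2) by auto
  define c1 where "c1 = c + of_int \<lfloor>t - c\<rfloor>"
  have c1: "c1 \<in> C" "t - 1 \<le> c1" "c1 \<le> t" using c C_per by (auto simp: c1_def) linarith+
  define c2 where "c2 = c1 + 1"
  have c2: "c2 \<in> C" "t \<le> c2" "c2 \<le> t + 1" using c1 C_per[of c1 1] by (auto simp: c2_def)
  let ?A = "C \<inter> {t - 1..t}" and ?B = "C \<inter> {t..t + 1}"
  have A: "finite ?A" "?A \<noteq> {}" and B: "finite ?B" "?B \<noteq> {}" using finite_C c1 c2 by auto
  have Ai: "Max ?A \<in> ?A" and Bi: "Min ?B \<in> ?B" using A B Max_in Min_in by blast+
  then have lt: "Max ?A < t" "t < Min ?B" using assms(1) by (auto simp: less_le)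
  moreover have "s \<notin> C" if "s \<in> {Max ?A<..<Min ?B}" for s
  proof
    assume s: "s \<in> C"
    have "s \<notin> ?A" "s \<notin> ?B" using A B that Max_ge[of ?A s] Min_le[of ?B s] by auto
    then show False using s that Ai Bi by auto
  qed
  then have "{Max ?A<..<Min ?B} \<inter> C = {}" by blast
  ultimately show thesis using that[of "Max ?A" "Min ?B"] Ai Bi by (auto simp: edge_def)
qed

lemma edge_side_start:
  assumes "edge \<alpha> \<beta>" "t \<in> {\<alpha><..<\<beta>}" "x \<in> X" "time x ov = frac \<alpha>" "\<theta> \<in> {1, -1}"
  shows "side \<theta> t = half_edge_side \<theta> x ov 1"
proof -
  obtain \<delta> where \<delta>: "\<delta> > 0" "\<And>r. 0 < r \<Longrightarrow> r < \<delta> \<Longrightarrow>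
      time x ov + 1 * r \<notin> C \<and> side \<theta> (time x ov + 1 * r) = half_edge_side \<theta> x ov 1"
    using half_edge_nearby[OF assms(3) _ assms(5), of 1 ov] by auto
  define r where "r = min \<delta> (\<beta> - \<alpha>) / 2"
  have r: "0 < r" "r < \<delta>" "\<alpha> + r \<in> {\<alpha><..<\<beta>}" using \<delta>(1) assms(1)
    unfolding r_def edge_def by (auto simp: min_def field_simps)
  have "side \<theta> t = side \<theta> (\<alpha> + r)"
    using side_constant[OF _ assms(2) r(3) assms(5)] assms(1) by (simp add: edge_def)
  also have "\<dots> = side \<theta> (frac \<alpha> + r)"
    using side_per[of \<theta> "frac \<alpha> + r" "\<lfloor>\<alpha>\<rfloor>"] by (simp add: frac_def)
  finally show ?thesis using \<delta>(2)[OF r(1,2)] assms(4) by simp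
qed

lemma edge_side_end:
  assumes "edge \<alpha> \<beta>" "t \<in> {\<alpha><..<\<beta>}" "x \<in> X" "time x ov = frac \<beta>" "\<theta> \<in> {1, -1}"
  shows "side \<theta> t = half_edge_side \<theta> x ov (-1)"
proof -
  obtain \<delta> where \<delta>: "\<delta> > 0" "\<And>r. 0 < r \<Longrightarrow> r < \<delta> \<Longrightarrow>
      time x ov + (-1) * r \<notin> C \<and> side \<theta> (time x ov + (-1) * r) = half_edge_side \<theta> x ov (-1)"
    using half_edge_nearby[OF assms(3) _ assms(5), of "-1" ov] by auto
  define r where "r = min \<delta> (\<beta> - \<alpha>) / 2"
  have r: "0 < r" "r < \<delta>" "\<beta> - r \<in> {\<alpha><..<\<beta>}" using \<delta>(1) assms(1)
    unfolding r_def edge_def by (auto simp: min_def field_simps)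
  have "side \<theta> t = side \<theta> (\<beta> - r)"
    using side_constant[OF _ assms(2) r(3) assms(5)] assms(1) by (simp add: edge_def)
  also have "\<dots> = side \<theta> (frac \<beta> - r)"
    using side_per[of \<theta> "frac \<beta> - r" "\<lfloor>\<beta>\<rfloor>"] by (simp add: frac_def)
  finally show ?thesis using \<delta>(2)[OF r(1,2)] assms(4) by simp
qed

end

section \<open>Edges between regions of opposite shade\<close>

locale prime_checkered_diagram = diagram +
  fixes S :: "complex set set"
  assumes prime: "prime_diagram \<gamma> X" and checkerboard: "checkerboard \<gamma> X S"
begin

lemma side_shaded: "t \<notin> C \<Longrightarrow> side 1 t \<in> S \<longleftrightarrow> side (-1) t \<notin> S"
proof -
  assume t: "t \<notin> C"
  have "adjacent_along_arc \<gamma> X (side 1 t) (side (-1) t)"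
    unfolding adjacent_along_arc_def
    using lies_towards_side[OF t, of 1] lies_towards_side[OF t, of "-1"] t by (auto simp: C_def)
  then show ?thesis
    using checkerboard side_region[OF t, of 1] side_region[OF t, of "-1"]
    unfolding checkerboard_def by auto
qed

lemma side_distinct: "t \<notin> C \<Longrightarrow> side 1 t \<noteq> side (-1) t"
  using side_shaded by metis

text \<open>Primeness in the form used below: the two regions along an edge have no other edge in
  common. Once \<open>t'\<close> is moved to \<open>s\<close> in the period that starts at
  \<open>t\<close>, either no crossing separates \<open>t\<close> from \<open>s\<close>, so that
  \<open>s\<close> comes before \<open>\<beta>\<close>, or none separates \<open>s\<close> from
  \<open>t + 1\<close>, so that \<open>s\<close> comes after \<open>\<alpha> + 1\<close> and lies on
  the next translate of the edge.\<close>

lemma same_edge: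
  assumes "edge \<alpha> \<beta>" "t \<in> {\<alpha><..<\<beta>}" "t' \<notin> C" "{side 1 t', side (-1) t'} = {side 1 t, side (-1) t}"
  obtains n :: int where "t' + of_int n \<in> {\<alpha><..<\<beta>}"
proof -
  have t: "t \<notin> C" using assms(1,2) by (auto simp: edge_def)
  define s where "s = t' + of_int (- \<lfloor>t' - t\<rfloor>)"
  have s: "t \<le> s" "s < t + 1" unfolding s_def by linarith+
  have sC: "s \<notin> C" using C_per assms(3) unfolding s_def by blast
  have sides: "side 1 s = side 1 t'" "side (-1) s = side (-1) t'" unfolding s_def side_per by auto
  show thesis
  proof (cases "s = t")
    case True
    then show thesis using that assms(2) s_def by metis
  next
    case False
    then have "t < s" using s by simp
    then consider "{t..s} \<inter> C = {}" | "{s..t + 1} \<inter> C = {}"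
      using edge_on_one_side[OF prime t sC _ s(2) side_region[OF t] side_region[OF t] side_distinct[OF t] refl]
        sides assms(4) by auto
    then show thesis
    proof cases
      case 1
      moreover have "\<beta> \<in> C" "t < \<beta>" using assms(1,2) by (auto simp: edge_def)
      ultimately have "s < \<beta>" by (meson atLeastAtMost_iff disjoint_iff less_imp_le not_le)
      then show thesis using that[of "- \<lfloor>t' - t\<rfloor>"] \<open>t < s\<close> assms(2) s_def
        by simp
    next
      case 2
      moreover have "\<alpha> + 1 \<in> C" using C_per[of \<alpha> 1] assms(1) by (simp add: edge_def)
      ultimately have "\<alpha> + 1 < s" using assms(2)
        by (metis IntI atLeastAtMost_iff add_right_mono empty_iff greaterThanLessThan_iff less_imp_le linorder_not_le)
      then show thesis using that[of "- \<lfloor>t' - t\<rfloor> - 1"] s assms(2) s_def by simp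
    qed
  qed
qed

text \<open>By \<open>same_edge\<close>, points of the half edge near the crossing lie on a
  translate of the given edge. No crossing parameter lies between them and \<open>time x ov\<close>,
  so the latter is the end at which the half edge is attached.\<close>

lemma half_edge_on_edge:
  assumes "edge \<alpha> \<beta>" "t \<in> {\<alpha><..<\<beta>}" "x \<in> X" "h \<in> {1, -1}"
    and "{half_edge_side 1 x ov h, half_edge_side (-1) x ov h} = {side 1 t, side (-1) t}"
  shows "time x ov = frac (if h = 1 then \<alpha> else \<beta>)"
proof -
  obtain \<delta>1 where \<delta>1: "\<delta>1 > 0" "\<And>r. 0 < r \<Longrightarrow> r < \<delta>1 \<Longrightarrow>
      time x ov + h * r \<notin> C \<and> side 1 (time x ov + h * r) = half_edge_side 1 x ov h"
    using half_edge_nearby[OF assms(3,4), of 1 ov] by auto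
  obtain \<delta>2 where \<delta>2: "\<delta>2 > 0" "\<And>r. 0 < r \<Longrightarrow> r < \<delta>2 \<Longrightarrow>
      time x ov + h * r \<notin> C \<and> side (-1) (time x ov + h * r) = half_edge_side (-1) x ov h"
    using half_edge_nearby[OF assms(3,4), of "-1" ov] by auto
  define c where "c = time x ov"
  have cC: "c \<in> C" using time_in_C assms(3) by (simp add: c_def)
  define r where "r = min \<delta>1 \<delta>2 / 2"
  have r: "0 < r" "r < \<delta>1" "r < \<delta>2" using \<delta>1(1) \<delta>2(1) by (auto simp: r_def)
  have free: "c + h * u \<notin> C" if "0 < u" "u \<le> r" for u using \<delta>1(2)[of u] r that
    by (simp add: c_def)
  obtain n :: int where n: "c + h * r + of_int n \<in> {\<alpha><..<\<beta>}"
    using same_edge[OF assms(1,2) free[OF r(1) order_refl]] \<delta>1(2)[OF r(1,2)] \<delta>2(2)[OF r(1,3)] assms(5)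
    unfolding c_def by metis
  have cn: "c + of_int n \<in> C" using C_per cC by blast
  have frac_c: "frac c = c" using time_frac[OF assms(3)] by (simp add: c_def)
  have C_shift: "s - of_int n \<in> C \<longleftrightarrow> s \<in> C" for s
    using C_per[of "s - of_int n" n] by simp
  consider "h = 1" | "h = -1" using assms(4) by auto
  then show ?thesis
  proof cases
    case 1
    have "c + of_int n < \<beta>" using n 1 r by simp
    then have "c + of_int n \<le> \<alpha>" using assms(1) cn unfolding edge_def
      by (meson disjoint_iff greaterThanLessThan_iff not_le)
    moreover have "\<not> c + of_int n < \<alpha>"
    proof
      assume "c + of_int n < \<alpha>"
      then have "c + h * (\<alpha> - of_int n - c) \<notin> C" using n 1 by (intro free) auto
      then show False using C_shift[of \<alpha>] assms(1) 1 by (simp add: edge_def)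
    qed
    ultimately have "\<alpha> = c + of_int n" by simp
    then show ?thesis using frac_c 1 by (simp add: c_def frac_def)
  next
    case 2
    have "\<alpha> < c + of_int n" using n 2 r by simp
    then have "\<beta> \<le> c + of_int n" using assms(1) cn unfolding edge_def
      by (meson disjoint_iff greaterThanLessThan_iff not_le)
    moreover have "\<not> \<beta> < c + of_int n"
    proof
      assume "\<beta> < c + of_int n"
      then have "c + h * (c - (\<beta> - of_int n)) \<notin> C" using n 2 by (intro free) auto
      then show False using C_shift[of \<beta>] assms(1) 2 by (simp add: edge_def)
    qed
    ultimately have "\<beta> = c + of_int n" by simp
    then show ?thesis using frac_c 2 by (simp add: c_def frac_def)
  qed
qed

end

context diagram begin

section \<open>The frontier of a region\<close>

lemma corner_frontier:
  assumes "x \<in> X" "a \<in> {1, -1}" "b \<in> {1, -1}"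
  shows "\<gamma> (fst x) \<in> frontier (corner x a b)"
proof -
  let ?w = "of_real a * d (fst x) + of_real b * d (snd x)"
  obtain \<delta> where \<delta>: "\<delta> > 0"
    "\<And>\<eta>. 0 < \<eta> \<Longrightarrow> \<eta> < \<delta> \<Longrightarrow> \<gamma> (fst x) + of_real \<eta> * ?w \<in> corner x a b"
    using at_corner_corner[OF assms] lies_towardsE unfolding at_corner_def by blast
  have "\<exists>y\<in>corner x a b. dist y (\<gamma> (fst x)) < e" if e: "e > 0" for e
  proof -
    have N: "norm ?w + 1 > 0" using norm_ge_zero[of ?w] by linarith
    define \<eta> where "\<eta> = min \<delta> (e / (norm ?w + 1)) / 2"
    have "e / (norm ?w + 1) > 0" using e N by simp
    then have "0 < 2 * \<eta>" "2 * \<eta> \<le> \<delta>" "2 * \<eta> \<le> e / (norm ?w + 1)"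
      using \<delta>(1) by (simp_all add: \<eta>_def)
    then have \<eta>: "0 < \<eta>" "\<eta> < \<delta>" "\<eta> < e / (norm ?w + 1)" by linarith+
    then have "\<eta> * (norm ?w + 1) < e" using N by (simp add: pos_less_divide_eq)
    then have "\<eta> * norm ?w < e" using \<eta>(1) by (simp add: algebra_simps)
    then have "dist (\<gamma> (fst x) + of_real \<eta> * ?w) (\<gamma> (fst x)) < e"
      using \<eta>(1) by (simp add: dist_norm norm_mult)
    then show ?thesis using \<delta>(2)[OF \<eta>(1,2)] by blast
  qed
  then have "\<gamma> (fst x) \<in> closure (corner x a b)" by (auto simp: closure_approachable)
  moreover have "\<gamma> (fst x) \<notin> corner x a b"
    using region_disjoint[OF corner_region[OF assms]] by blast
  ultimately show ?thesis using interior_subset unfolding frontier_def by blast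
qed

(* The crossing at which the arc of the diagram through the parameter t starts. *)
definition "crossing_before t x \<longleftrightarrow> x \<in> X \<and>
  (\<exists>c ov. c \<in> C \<and> c \<le> t \<and> {c<..t} \<inter> C = {} \<and> time x ov = frac c)"

lemma crossing_beforeI:
  "x \<in> X \<Longrightarrow> c \<in> C \<Longrightarrow> c \<le> t \<Longrightarrow> {c<..t} \<inter> C = {} \<Longrightarrow> time x ov = frac c \<Longrightarrow> crossing_before t x"
  unfolding crossing_before_def by blast

lemma crossing_before_exists:
  assumes "C \<noteq> {}"
  obtains x where "crossing_before t x"
proof (cases "t \<in> C")
  case True
  then obtain x ov where "x \<in> X" "time x ov = frac t" using C_time by blast
  then show thesis using that crossing_beforeI[of x t t ov] True by simp
next
  case False
  then obtain \<alpha> \<beta> where e: "edge \<alpha> \<beta>" "t \<in> {\<alpha><..<\<beta>}"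
    using edge_around assms by blast
  then obtain x ov where "x \<in> X" "time x ov = frac \<alpha>" using C_time unfolding edge_def
    by blast
  moreover have "{\<alpha><..t} \<inter> C = {}" using e by (fastforce simp: edge_def)
  moreover have "\<alpha> \<in> C" "\<alpha> \<le> t" using e by (auto simp: edge_def)
  ultimately show thesis using that crossing_beforeI by blast
qed

lemma crossing_before_unique:
  assumes "crossing_before t x" "crossing_before t y"
  shows "x = y"
proof -
  obtain c ov where c: "c \<in> C" "c \<le> t" "{c<..t} \<inter> C = {}" "time x ov = frac c"
    using assms(1) unfolding crossing_before_def by auto
  obtain c' ov' where c': "c' \<in> C" "c' \<le> t" "{c'<..t} \<inter> C = {}" "time y ov' = frac c'"
    using assms(2) unfolding crossing_before_def by auto
  have "c = c'" using c(1-3) c'(1-3)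
    by (metis disjoint_iff greaterThanAtMost_iff linorder_neqE_linordered_idom)
  then show ?thesis using time_inj assms c(4) c'(4) unfolding crossing_before_def by metis
qed

lemma crossing_before_per: "crossing_before t x \<Longrightarrow> crossing_before (t + of_int n) x"
proof -
  assume "crossing_before t x"
  then obtain c ov where c: "x \<in> X" "c \<in> C" "c \<le> t" "{c<..t} \<inter> C = {}" "time x ov = frac c"
    unfolding crossing_before_def by auto
  have "s \<notin> C" if "s \<in> {c + of_int n<..t + of_int n}" for s
  proof -
    have "s - of_int n \<in> {c<..t}" using that by auto
    then show ?thesis using c(4) C_per[of "s - of_int n" n] by auto
  qed
  moreover have "frac (c + of_int n) = frac c" by (simp add: frac_def)
  ultimately show ?thesis
    using c C_per[of c n] by (intro crossing_beforeI[of x "c + of_int n" _ ov]) auto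
qed

lemma crossing_before_C:
  assumes "t \<in> C" "crossing_before t x"
  shows "\<gamma> (fst x) = \<gamma> t"
proof -
  obtain c ov where c: "x \<in> X" "c \<in> C" "c \<le> t" "{c<..t} \<inter> C = {}" "time x ov = frac c"
    using assms(2) unfolding crossing_before_def by auto
  have "c = t" using c(3,4) assms(1) by (metis disjoint_iff greaterThanAtMost_iff le_less order_refl)
  moreover have "\<gamma> (fst x) = \<gamma> (time x ov)" using X_point[OF c(1)] by (simp add: time_def)
  ultimately show ?thesis using c(5) per_frac by metis
qed

text \<open>At a double point both strands give the crossing itself, and elsewhere the parameter is
  determined up to a period. So the starting crossing depends on the point of the diagram alone, as
  is needed for a connectedness argument in the plane.\<close>

lemma crossing_before_point:
  assumes "crossing_before t x" "crossing_before t' x'" "\<gamma> t = \<gamma> t'"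
  shows "x = x'"
proof (cases "t' \<in> C")
  case True
  then have "t \<in> C" using assms(3) by (simp add: C_def)
  then have "\<gamma> (fst x) = \<gamma> (fst x')" using crossing_before_C True assms by metis
  then show ?thesis using crossing_eq assms(1,2) unfolding crossing_before_def by blast
next
  case False
  then obtain n :: int where "t = t' + of_int n" using inj_off_C assms(3) frac_eqE by metis
  then show ?thesis using crossing_before_per[OF assms(2)] crossing_before_unique assms(1) by metis
qed

text \<open>At most two parameters modulo 1 lie over \<open>p\<close>, so a single radius serves
  them all.\<close>

lemma C_isolated_at_point:
  obtains \<delta> where "\<delta> > 0" "\<And>t s. \<gamma> t = p \<Longrightarrow> s \<noteq> t \<Longrightarrow> \<bar>s - t\<bar> < \<delta> \<Longrightarrow> s \<notin> C"
proof (cases "\<exists>t. \<gamma> t = p")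
  case True
  then obtain t0 where t0: "\<gamma> t0 = p" ..
  obtain c where c: "\<And>t. \<gamma> t = p \<Longrightarrow> frac t = frac t0 \<or> frac t = c"
  proof (cases "t0 \<in> C")
    case True
    then obtain c where "paired (frac t0) c" using C_iff_paired by blast
    then show thesis using that paired_frac per_frac t0 by metis
  next
    case False
    then show thesis using that inj_off_C t0 by metis
  qed
  obtain \<delta>1 where \<delta>1: "\<delta>1 > 0" "\<And>s. s \<noteq> frac t0 \<Longrightarrow> \<bar>s - frac t0\<bar> < \<delta>1 \<Longrightarrow> s \<notin> C"
    using C_isolated by blast
  obtain \<delta>2 where \<delta>2: "\<delta>2 > 0" "\<And>s. s \<noteq> c \<Longrightarrow> \<bar>s - c\<bar> < \<delta>2 \<Longrightarrow> s \<notin> C"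
    using C_isolated by blast
  show thesis
  proof (rule that)
    show "min \<delta>1 \<delta>2 > 0" using \<delta>1(1) \<delta>2(1) by simp
    fix t s assume "\<gamma> t = p" and s: "s \<noteq> t" "\<bar>s - t\<bar> < min \<delta>1 \<delta>2"
    define u where "u = s - of_int \<lfloor>t\<rfloor>"
    have u: "u \<noteq> frac t" "\<bar>u - frac t\<bar> < min \<delta>1 \<delta>2" using s
      by (auto simp: u_def frac_def)
    then have "u \<notin> C"
      using c[OF \<open>\<gamma> t = p\<close>] \<delta>1(2)[of u] \<delta>2(2)[of u] by auto
    then show "s \<notin> C" using C_per[of u "\<lfloor>t\<rfloor>"] by (simp add: u_def)
  qed
next
  case False
  then show thesis using that[of 1] by auto
qed

(* The frontier of a region is connected because the diagram is, so a function that agrees at the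
   two ends of every edge of the region takes a single value on its crossings. *)
lemma constant_along_boundary:
  assumes P: "P \<in> regions \<gamma>"
    and edges: "\<And>\<alpha> \<beta> t x y ov ov'. \<lbrakk>edge \<alpha> \<beta>; t \<in> {\<alpha><..<\<beta>}; P \<in> {side 1 t, side (-1) t};
        x \<in> X; y \<in> X; time x ov = frac \<alpha>; time y ov' = frac \<beta>\<rbrakk> \<Longrightarrow> \<rho> x = \<rho> y"
    and xy: "x \<in> X" "y \<in> X" "\<gamma> (fst x) \<in> frontier P" "\<gamma> (fst y) \<in> frontier P"
  shows "\<rho> x = \<rho> y"
proof -
  define F where "F = frontier P"
  have conF: "connected F" unfolding F_def
    using connected_frontier_component_complement[OF connected_range] P unfolding regions_def by blast
  have C_ne: "C \<noteq> {}" using time_in_C[OF xy(1)] by blast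
  have F_range: "q \<in> range \<gamma>" if q: "q \<in> F" for q
  proof (rule ccontr)
    assume q': "q \<notin> range \<gamma>"
    then obtain Q where Q: "Q \<in> regions \<gamma>" "{q} \<subseteq> Q"
      using connected_subset_region[of "{q}"] by auto
    then have "Q \<inter> P \<noteq> {}"
      using q open_region[OF Q(1)] open_Int_closure_eq_empty[of Q P] unfolding F_def frontier_def
        by blast
    then have "Q = P" using Q(1) P region_eq by blast
    then show False using q Q open_region[OF P] unfolding F_def frontier_def
      by (simp add: interior_open)
  qed
  \<comment> \<open>For a point \<open>q\<close> of the diagram, \<open>v\<close> is the value of
    \<open>\<rho>\<close> at the crossing where the arc through \<open>q\<close> starts.\<close>
  define val where "val q v \<longleftrightarrow> (\<forall>t x. \<gamma> t = q \<longrightarrow> crossing_before t x \<longrightarrow> \<rho> x = v)" for q v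
  have valI: "val (\<gamma> t) (\<rho> x)" if "crossing_before t x" for t x
    unfolding val_def using crossing_before_point that by blast
  define same where "same q q' \<longleftrightarrow> (\<exists>v. val q v \<and> val q' v)" for q q'
  have "same (\<gamma> (fst x)) (\<gamma> (fst y))"
  proof (rule connected_equivalence_relation[OF conF])
    show "\<gamma> (fst x) \<in> F" "\<gamma> (fst y) \<in> F" using xy by (simp_all add: F_def)
    show "same q' q" if "same q q'" for q q' using that by (auto simp: same_def)
    \<comment> \<open>The value at \<open>q'\<close> is unique because \<open>q'\<close> lies on the
      diagram; off the diagram \<open>val\<close> would hold vacuously for every value.\<close>
    show "same q q''" if "same q q'" "same q' q''" "q' \<in> F" for q q' q''
    proof -
      obtain t where t: "q' = \<gamma> t" using F_range \<open>q' \<in> F\<close> by blast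
      obtain z where "crossing_before t z" using crossing_before_exists[OF C_ne] by blast
      then have "v = w" if "val q' v" "val q' w" for v w using that t unfolding val_def by metis
      then show ?thesis using that(1,2) unfolding same_def by metis
    qed
    fix a assume a: "a \<in> F"
    obtain \<delta> where \<delta>: "\<delta> > 0" "\<And>t s. \<gamma> t = a \<Longrightarrow> s \<noteq> t \<Longrightarrow> \<bar>s - t\<bar> < \<delta> \<Longrightarrow> s \<notin> C"
      using C_isolated_at_point by blast
    obtain r where r: "r > 0" "\<And>t. norm (\<gamma> t - a) < r \<Longrightarrow> \<exists>t'. \<gamma> t' = a \<and> \<bar>t - t'\<bar> < \<delta>"
      using near_preimage[OF \<delta>(1)] by blast
    have "same a q" if q: "q \<in> F \<inter> ball a r" for q
    proof -
      obtain s where s: "q = \<gamma> s" using F_range q by blast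
      then obtain t' where t': "\<gamma> t' = a" "\<bar>s - t'\<bar> < \<delta>"
        using r(2)[of s] q by (auto simp: dist_norm norm_minus_commute)
      obtain xs where xs: "crossing_before s xs" using crossing_before_exists[OF C_ne] by blast
      obtain x' where x': "crossing_before t' x'" using crossing_before_exists[OF C_ne] by blast
      have "\<rho> xs = \<rho> x'"
      proof (cases "t' \<le> s")
        case True
        have free: "u \<notin> C" if "u \<in> {t'<..s}" for u
          using \<delta>(2)[OF t'(1), of u] that t'(2) by auto
        obtain c ov where c: "x' \<in> X" "c \<in> C" "c \<le> t'" "{c<..t'} \<inter> C = {}" "time x' ov = frac c"
          using x' unfolding crossing_before_def by auto
        have "u \<notin> C" if "u \<in> {c<..s}" for u
          using that free[of u] c(4) by (cases "u \<le> t'") auto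
        then have "crossing_before s x'" unfolding crossing_before_def
          using c True by (intro conjI exI[of _ c] exI[of _ ov]) auto
        then show ?thesis using crossing_before_unique xs by blast
      next
        case False
        have free: "u \<notin> C" if "u \<in> {s..<t'}" for u
          using \<delta>(2)[OF t'(1), of u] that t'(2) by auto
        obtain c ov where c: "xs \<in> X" "c \<in> C" "c \<le> s" "{c<..s} \<inter> C = {}" "time xs ov = frac c"
          using xs unfolding crossing_before_def by auto
        have cs: "c < s" using c(2,3) free[of s] False by (cases "c = s") auto
        have free': "u \<notin> C" if "u \<in> {c<..<t'}" for u
          using that free[of u] c(4) by (cases "u \<le> s") auto
        show ?thesis
        \<comment> \<open>The starting crossing can change only if \<open>t'\<close> is a crossing
          and \<open>s\<close> comes before it. Then \<open>s\<close> is on the edge that ends at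
          \<open>t'\<close>, and this edge borders \<open>P\<close> because
          \<open>\<gamma> s\<close> is on the frontier.\<close>
        proof (cases "t' \<in> C")
          case True
          have e: "edge c t'" "s \<in> {c<..<t'}" using free' c(2) True cs False
            by (auto simp: edge_def)
          obtain y' ov' where y': "y' \<in> X" "time y' ov' = frac t'" using C_time True by blast
          have "s \<notin> C" using free[of s] False by auto
          then have "P \<in> {side 1 s, side (-1) s}" using frontier_side[OF _ P] q s
            by (auto simp: F_def)
          then have "\<rho> xs = \<rho> y'" using edges[OF e _ c(1) y'(1) c(5) y'(2)] by blast
          moreover have "crossing_before t' y'" unfolding crossing_before_def
            using y' True by (intro conjI exI[of _ t'] exI[of _ ov']) auto
          ultimately show ?thesis using crossing_before_unique x' by blast
        next
          case False
          have "u \<notin> C" if "u \<in> {c<..t'}" for u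
            using that free'[of u] False by (cases "u = t'") auto
          then have "crossing_before t' xs" unfolding crossing_before_def
            using c cs \<open>\<not> t' \<le> s\<close> by (intro conjI exI[of _ c] exI[of _ ov]) auto
          then show ?thesis using crossing_before_unique x' by blast
        qed
      qed
      then show ?thesis using valI[OF xs] valI[OF x'] s t'(1) unfolding same_def by metis
    qed
    moreover have "openin (top_of_set F) (F \<inter> ball a r)" by (simp add: openin_open_Int)
    ultimately show "\<exists>T. openin (top_of_set F) T \<and> a \<in> T \<and> (\<forall>q\<in>T. same a q)"
      using a r(1) by (intro exI[of _ "F \<inter> ball a r"]) auto
  qed
  then obtain v where v: "val (\<gamma> (fst x)) v" "val (\<gamma> (fst y)) v" unfolding same_def
    by blast
  have "crossing_before (fst z) z" if "z \<in> X" for z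
    unfolding crossing_before_def using that time_in_C[OF that, of True] time_frac[OF that, of True]
    by (intro conjI exI[of _ "fst z"] exI[of _ True]) (auto simp: time_def)
  then show ?thesis using v xy(1,2) unfolding val_def by metis
qed

section \<open>Signs\<close>

text \<open>The entry of the Dehn matrix as a function of the region instead of its index. A corner
  contributes its sign along the over-strand, so a region filling several corners gets the
  sum.\<close>

definition "dehn_coeff x Q = (of_bool (corner x 1 1 = Q) + of_bool (corner x 1 (-1) = Q)
  - of_bool (corner x (-1) (-1) = Q) - of_bool (corner x (-1) 1 = Q) :: int)"

lemma dehn_matrix_eq: "x \<in> X \<Longrightarrow> R k \<in> regions \<gamma> \<Longrightarrow> dehn_matrix \<gamma> R x k = dehn_coeff x (R k)"
  using at_corner_iff[of x _ _ "R k"] by (simp add: dehn_matrix_def dehn_coeff_def)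

lemma dehn_coeff_frontier: "x \<in> X \<Longrightarrow> dehn_coeff x Q \<noteq> 0 \<Longrightarrow> \<gamma> (fst x) \<in> frontier Q"
proof -
  assume x: "x \<in> X" "dehn_coeff x Q \<noteq> 0"
  then have "corner x 1 1 = Q \<or> corner x 1 (-1) = Q \<or> corner x (-1) (-1) = Q \<or> corner x (-1) 1 = Q"
    by - (rule ccontr, simp add: dehn_coeff_def)
  then show ?thesis
    using corner_frontier[OF x(1), of 1 1] corner_frontier[OF x(1), of 1 "-1"]
      corner_frontier[OF x(1), of "-1" "-1"] corner_frontier[OF x(1), of "-1" 1] by auto
qed

definition meets where "meets x Q \<longleftrightarrow> Q \<in> {corner x 1 1, corner x 1 (-1), corner x (-1) (-1), corner x (-1) 1}"

lemma meets_crossing_iff: "x \<in> X \<Longrightarrow> Q \<in> regions \<gamma> \<Longrightarrow> meets_crossing \<gamma> x Q \<longleftrightarrow> meets x Q"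
  using at_corner_iff[of x _ _ Q] by (auto simp: meets_crossing_def meets_def)

definition outward :: "bool \<Rightarrow> real" where "outward out = (if out then 1 else -1)"

text \<open>The factor that distinguishes outgoing from incoming half edges is left out, so that the
  two ends of an edge carry the same value, namely \<open>side_sign\<close> at its interior
  points.\<close>

definition "half_edge_sign P U x ov out =
  (of_bool (half_edge_side 1 x ov (outward out) = P \<and> half_edge_side (-1) x ov (outward out) = U)
   - of_bool (half_edge_side 1 x ov (outward out) = U \<and> half_edge_side (-1) x ov (outward out) = P) :: int)"

definition "side_sign P U t =
  (of_bool (side 1 t = P \<and> side (-1) t = U) - of_bool (side 1 t = U \<and> side (-1) t = P) :: int)"

lemma half_edge_sign_nonzero:
  assumes "half_edge_sign P U x ov out \<noteq> 0"
  shows "{half_edge_side 1 x ov (outward out), half_edge_side (-1) x ov (outward out)} = {P, U}"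
proof (rule ccontr)
  assume "\<not> ?thesis"
  then have "\<not> (half_edge_side 1 x ov (outward out) = P \<and> half_edge_side (-1) x ov (outward out) = U)"
    "\<not> (half_edge_side 1 x ov (outward out) = U \<and> half_edge_side (-1) x ov (outward out) = P)"
    unfolding doubleton_eq_iff by blast+
  then show False using assms unfolding half_edge_sign_def by (simp only: of_bool_eq diff_self)
qed

lemma half_edge_sign_start:
  assumes "edge \<alpha> \<beta>" "t \<in> {\<alpha><..<\<beta>}" "x \<in> X" "time x ov = frac \<alpha>"
  shows "half_edge_sign P U x ov True = side_sign P U t"
  using edge_side_start[OF assms, of 1] edge_side_start[OF assms, of "-1"]
  by (simp add: half_edge_sign_def side_sign_def outward_def)

lemma half_edge_sign_end:
  assumes "edge \<alpha> \<beta>" "t \<in> {\<alpha><..<\<beta>}" "x \<in> X" "time x ov = frac \<beta>"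
  shows "half_edge_sign P U x ov False = side_sign P U t"
  using edge_side_end[OF assms, of 1] edge_side_end[OF assms, of "-1"]
  by (simp add: half_edge_sign_def side_sign_def outward_def)

end

section \<open>Shading at a crossing, cancellation along edges and uniqueness of signs\<close>

context prime_checkered_diagram begin

lemma S_regions: "Q \<in> S \<Longrightarrow> Q \<in> regions \<gamma>"
  using checkerboard unfolding checkerboard_def by blast

lemma half_edge_shaded:
  assumes "x \<in> X" "h \<in> {1, -1}"
  shows "half_edge_side 1 x ov h \<in> S \<longleftrightarrow> half_edge_side (-1) x ov h \<notin> S"
proof -
  obtain \<delta>1 where \<delta>1: "\<delta>1 > 0" "\<And>r. 0 < r \<Longrightarrow> r < \<delta>1 \<Longrightarrow>
      time x ov + h * r \<notin> C \<and> side 1 (time x ov + h * r) = half_edge_side 1 x ov h"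
    using half_edge_nearby[OF assms, of 1 ov] by auto
  obtain \<delta>2 where \<delta>2: "\<delta>2 > 0" "\<And>r. 0 < r \<Longrightarrow> r < \<delta>2 \<Longrightarrow>
      time x ov + h * r \<notin> C \<and> side (-1) (time x ov + h * r) = half_edge_side (-1) x ov h"
    using half_edge_nearby[OF assms, of "-1" ov] by auto
  define r where "r = min \<delta>1 \<delta>2 / 2"
  have r: "0 < r" "r < \<delta>1" "r < \<delta>2" using \<delta>1(1) \<delta>2(1) by (auto simp: r_def)
  show ?thesis using side_shaded \<delta>1(2)[OF r(1,2)] \<delta>2(2)[OF r(1,3)] by metis
qed

text \<open>Cyclically adjacent corners are separated by a half edge and thus have opposite shades;
  three of the four half edges determine the pattern.\<close>

lemma corner_shading:
  assumes "x \<in> X"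
  shows "corner x 1 (-1) \<in> S \<longleftrightarrow> corner x 1 1 \<notin> S"
    and "corner x (-1) 1 \<in> S \<longleftrightarrow> corner x 1 1 \<notin> S"
    and "corner x (-1) (-1) \<in> S \<longleftrightarrow> corner x 1 1 \<in> S"
  using orientation_cases[OF assms] half_edge_shaded[OF assms, of 1 True]
    half_edge_shaded[OF assms, of "-1" True] half_edge_shaded[OF assms, of 1 False]
  by (auto simp: half_edge_side_def)

text \<open>Opposite corners have the same shade, so one of the two swept corners decides.\<close>

lemma goeritz_index_eq:
  assumes "x \<in> X"
  shows "goeritz_index \<gamma> S x = (if corner x 1 (orientation x) \<in> S then 1 else -1)"
proof -
  have "orientation x = (if cross (d (fst x)) (d (snd x)) > 0 then 1 else -1)"
    using X_transverse[OF assms] by (auto simp: orientation_def sgn_if)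
  moreover have "(\<exists>Q\<in>S. at_corner \<gamma> x a b Q) \<longleftrightarrow> corner x a b \<in> S"
    if "a \<in> {1, -1}" "b \<in> {1, -1}" for a b
    using at_corner_iff[OF assms that] S_regions by auto
  ultimately show ?thesis
    using orientation_cases[OF assms] corner_shading[OF assms]
    unfolding goeritz_index_def Let_def by auto
qed

lemma goeritz_index_cases: "goeritz_index \<gamma> S x \<in> {1, -1}"
  by (simp add: goeritz_index_def Let_def)

text \<open>Multiplying out pairs each shaded corner with each unshaded one, and every such pair is
  separated by exactly one half edge. Halves of the over-strand separate corners of equal Dehn sign,
  halves of the under-strand corners of opposite sign. The Goeritz index records whether the shade
  is on the left of the outgoing over-strand, which converts these signs into the direction of the
  half edge.\<close>

lemma product_expansion:
  assumes "x \<in> X" "P \<in> S" "U \<notin> S"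
  shows "goeritz_index \<gamma> S x * dehn_coeff x P * dehn_coeff x U
    = (\<Sum>ov\<in>UNIV. \<Sum>out\<in>UNIV. (if out then 1 else -1) * half_edge_sign P U x ov out)"
proof -
  note sh = corner_shading[OF assms(1)]
  have ne: "Q \<in> S \<Longrightarrow> Q \<noteq> U" "Q \<notin> S \<Longrightarrow> Q \<noteq> P" for Q
    using assms by auto
  note defs = goeritz_index_eq[OF assms(1)] dehn_coeff_def half_edge_sign_def half_edge_side_def
    outward_def UNIV_bool
  show ?thesis
  proof (cases "corner x 1 1 \<in> S")
    case True
    have "corner x 1 1 \<noteq> U" "corner x (-1) (-1) \<noteq> U" "corner x 1 (-1) \<noteq> P" "corner x (-1) 1 \<noteq> P"
      using True sh ne by auto
    note this [simp] and sh [simp] and True [simp]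
    consider "orientation x = 1" | "orientation x = -1" using orientation_cases[OF assms(1)] by auto
    then show ?thesis by cases (simp_all add: defs of_bool_conj algebra_simps)
  next
    case False
    have "corner x 1 1 \<noteq> P" "corner x (-1) (-1) \<noteq> P" "corner x 1 (-1) \<noteq> U" "corner x (-1) 1 \<noteq> U"
      using False sh ne by auto
    note this [simp] and sh [simp] and False [simp]
    consider "orientation x = 1" | "orientation x = -1" using orientation_cases[OF assms(1)] by auto
    then show ?thesis by cases (simp_all add: defs of_bool_conj algebra_simps)
  qed
qed

lemma half_edge_sign_location:
  assumes "edge \<alpha> \<beta>" "t \<in> {\<alpha><..<\<beta>}" "{side 1 t, side (-1) t} = {P, U}"
    and "x \<in> X" "half_edge_sign P U x ov out \<noteq> 0"
  shows "time x ov = frac (if out then \<alpha> else \<beta>)"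
proof -
  have "{half_edge_side 1 x ov (outward out), half_edge_side (-1) x ov (outward out)} = {P, U}"
    using half_edge_sign_nonzero[OF assms(5)] .
  then have "time x ov = frac (if outward out = 1 then \<alpha> else \<beta>)"
    using half_edge_on_edge[OF assms(1,2,4), of "outward out" ov] assms(3) by (auto simp: outward_def)
  then show ?thesis by (auto simp: outward_def)
qed

lemma products_cancel:
  assumes "P \<in> S" "U \<notin> S"
  shows "(\<Sum>x\<in>X. goeritz_index \<gamma> S x * dehn_coeff x P * dehn_coeff x U) = 0"
proof -
  define f where "f = (\<lambda>(x, ov, out). (if out then 1 else -1) * half_edge_sign P U x ov out)"
  have "(\<Sum>x\<in>X. goeritz_index \<gamma> S x * dehn_coeff x P * dehn_coeff x U)
      = (\<Sum>x\<in>X. \<Sum>ov\<in>UNIV. \<Sum>out\<in>UNIV. f (x, ov, out))"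
    by (intro sum.cong refl) (simp add: product_expansion[OF _ assms] f_def)
  also have "\<dots> = sum f (X \<times> UNIV \<times> UNIV)"
    by (simp add: sum.cartesian_product)
  also have "\<dots> = 0"
  proof (cases "\<exists>i\<in>X \<times> UNIV \<times> UNIV. f i \<noteq> 0")
    case False
    then show ?thesis by (simp add: sum.neutral)
  next
    case True
    then obtain x ov out where x: "x \<in> X" "half_edge_sign P U x ov out \<noteq> 0"
      by (auto simp: f_def)
    let ?h = "outward out"
    have h: "?h \<in> {1, -1}" by (simp add: outward_def)
    obtain \<delta>1 where \<delta>1: "\<delta>1 > 0" "\<And>r. 0 < r \<Longrightarrow> r < \<delta>1 \<Longrightarrow>
        time x ov + ?h * r \<notin> C \<and> side 1 (time x ov + ?h * r) = half_edge_side 1 x ov ?h"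
      using half_edge_nearby[OF x(1) h, of 1 ov] by auto
    obtain \<delta>2 where \<delta>2: "\<delta>2 > 0" "\<And>r. 0 < r \<Longrightarrow> r < \<delta>2 \<Longrightarrow>
        time x ov + ?h * r \<notin> C \<and> side (-1) (time x ov + ?h * r) = half_edge_side (-1) x ov ?h"
      using half_edge_nearby[OF x(1) h, of "-1" ov] by auto
    define t where "t = time x ov + ?h * (min \<delta>1 \<delta>2 / 2)"
    have t: "t \<notin> C" "side 1 t = half_edge_side 1 x ov ?h" "side (-1) t = half_edge_side (-1) x ov ?h"
      using \<delta>1(1) \<delta>2(1) \<delta>1(2)[of "min \<delta>1 \<delta>2 / 2"] \<delta>2(2)[of "min \<delta>1 \<delta>2 / 2"]
      by (auto simp: t_def)
    have sides: "{side 1 t, side (-1) t} = {P, U}"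
      using half_edge_sign_nonzero[OF x(2)] t by simp
    obtain \<alpha> \<beta> where e: "edge \<alpha> \<beta>" "t \<in> {\<alpha><..<\<beta>}"
      using edge_around[OF t(1)] time_in_C[OF x(1)] by blast
    obtain y ov1 where y: "y \<in> X" "time y ov1 = frac \<alpha>" using C_time e(1) unfolding edge_def
      by blast
    obtain z ov2 where z: "z \<in> X" "time z ov2 = frac \<beta>" using C_time e(1) unfolding edge_def
      by blast
    \<comment> \<open>The last entries make the two triples distinct even if the edge starts and
      ends at the same crossing.\<close>
    have "sum f (X \<times> UNIV \<times> UNIV) = sum f {(y, ov1, True), (z, ov2, False)}"
    proof (rule sum.mono_neutral_right)
      show "\<forall>i\<in>X \<times> UNIV \<times> UNIV - {(y, ov1, True), (z, ov2, False)}. f i = 0"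
      proof (rule ballI, rule ccontr)
        fix i assume i: "i \<in> X \<times> UNIV \<times> UNIV - {(y, ov1, True), (z, ov2, False)}" "f i \<noteq> 0"
        obtain u o' out' where u: "i = (u, o', out')" by (cases i) auto
        have "time u o' = frac (if out' then \<alpha> else \<beta>)"
          using half_edge_sign_location[OF e sides, of u o' out'] i u by (auto simp: f_def)
        then show False using time_inj[of u y o' ov1] time_inj[of u z o' ov2] y z i u
          by (auto split: if_splits)
      qed
    qed (use finite_X y z in auto)
    also have "\<dots> = f (y, ov1, True) + f (z, ov2, False)" by simp
    also have "\<dots> = 0"
      using half_edge_sign_start[OF e y] half_edge_sign_end[OF e z] by (simp add: f_def)
    finally show ?thesis .
  qed
  finally show ?thesis .
qed

text \<open>The refinement of the cancellation to single rows: if the common edge of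
  \<open>P\<close> and \<open>U\<close> has distinct end crossings, these are the only rows in which
  both regions have a nonzero entry.\<close>

lemma product_at_edge:
  assumes e: "edge \<alpha> \<beta>" "t \<in> {\<alpha><..<\<beta>}" and PU: "{side 1 t, side (-1) t} = {P, U}" "P \<in> S" "U \<notin> S"
    and y: "y \<in> X" "time y ov1 = frac \<alpha>" and z: "z \<in> X" "time z ov2 = frac \<beta>" and "y \<noteq> z" "x \<in> X"
  shows "goeritz_index \<gamma> S x * dehn_coeff x P * dehn_coeff x U
    = (if x = y then side_sign P U t else if x = z then - side_sign P U t else 0)"
proof -
  have "half_edge_sign P U x ov out = (if x = y \<and> ov = ov1 \<and> out \<or> x = z \<and> ov = ov2 \<and> \<not> out
      then side_sign P U t else 0)" for ov out
  proof (cases "x = y \<and> ov = ov1 \<and> out \<or> x = z \<and> ov = ov2 \<and> \<not> out")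
    case True
    then show ?thesis using half_edge_sign_start[OF e y] half_edge_sign_end[OF e z] by auto
  next
    case False
    then have "time x ov \<noteq> frac (if out then \<alpha> else \<beta>)"
      using time_inj[OF \<open>x \<in> X\<close> y(1), of ov ov1] time_inj[OF \<open>x \<in> X\<close> z(1), of ov ov2] y(2) z(2)
        by metis
    then have "half_edge_sign P U x ov out = 0"
      using half_edge_sign_location[OF e PU(1) \<open>x \<in> X\<close>] by blast
    then show ?thesis unfolding if_not_P[OF False] .
  qed
  then show ?thesis unfolding product_expansion[OF \<open>x \<in> X\<close> PU(2,3)]
    using \<open>y \<noteq> z\<close> by (cases ov1; cases ov2) (auto simp: UNIV_bool)
qed

lemma side_sign_nonzero: "{side 1 t, side (-1) t} = {P, U} \<Longrightarrow> P \<noteq> U \<Longrightarrow> \<bar>side_sign P U t\<bar> = 1"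
  by (auto simp: side_sign_def doubleton_eq_iff)

text \<open>The sums over the column of the region opposite \<open>P\<close> along an edge determine
  the sign at one end from the sign at the other, in the same way for \<open>\<sigma>\<close> and
  \<open>\<tau>\<close>. An edge with both ends at one crossing imposes nothing.\<close>

lemma signs_unique:
  assumes P: "P \<in> S"
    and \<sigma>: "\<And>U. U \<in> regions \<gamma> - S \<Longrightarrow> (\<Sum>x\<in>{x\<in>X. dehn_coeff x P \<noteq> 0}. \<sigma> x * dehn_coeff x U) = 0"
    and \<tau>: "\<And>U. U \<in> regions \<gamma> - S \<Longrightarrow> (\<Sum>x\<in>{x\<in>X. dehn_coeff x P \<noteq> 0}. \<tau> x * dehn_coeff x U) = 0"
    and "x \<in> X" "dehn_coeff x P \<noteq> 0" "y \<in> X" "dehn_coeff y P \<noteq> 0"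
  shows "\<sigma> x * \<tau> x = \<sigma> y * \<tau> y"
proof (rule constant_along_boundary[of P "\<lambda>x. \<sigma> x * \<tau> x", OF S_regions[OF P] _ \<open>x \<in> X\<close> \<open>y \<in> X\<close>])
  show "\<gamma> (fst x) \<in> frontier P" "\<gamma> (fst y) \<in> frontier P"
    using dehn_coeff_frontier assms by blast+
  fix \<alpha> \<beta> t y z ov1 ov2
  assume e: "edge \<alpha> \<beta>" "t \<in> {\<alpha><..<\<beta>}" and Pt: "P \<in> {side 1 t, side (-1) t}"
    and y: "y \<in> X" and z: "z \<in> X" and y': "time y ov1 = frac \<alpha>" and z': "time z ov2 = frac \<beta>"
  show "\<sigma> y * \<tau> y = \<sigma> z * \<tau> z"
  proof (cases "y = z")
    case False
    have t: "t \<notin> C" using e by (auto simp: edge_def)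
    define U where "U = (if side 1 t = P then side (-1) t else side 1 t)"
    have sides: "{side 1 t, side (-1) t} = {P, U}" using Pt by (auto simp: U_def)
    have U: "U \<in> regions \<gamma> - S"
      using side_shaded[OF t] Pt P side_region[OF t, of 1] side_region[OF t, of "-1"]
        by (auto simp: U_def)
    then have "P \<noteq> U" using P by auto
    note prod = product_at_edge[OF e sides P _ y y' z z' False]
    \<comment> \<open>Integers with product 1 or -1 are units. In particular both ends of the edge
      are rows with a nonzero entry at \<open>P\<close>, although the frontier of \<open>P\<close>
      may also contain crossings at which its two corners cancel.\<close>
    have abs_prod: "\<bar>dehn_coeff u P\<bar> * \<bar>dehn_coeff u U\<bar> = 1" if u: "u \<in> {y, z}" for u
    proof -
      have "goeritz_index \<gamma> S u * dehn_coeff u P * dehn_coeff u U \<in> {side_sign P U t, - side_sign P U t}"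
        using prod[of u] U u y z by auto
      then have "\<bar>goeritz_index \<gamma> S u * dehn_coeff u P * dehn_coeff u U\<bar> = 1"
        using side_sign_nonzero[OF sides \<open>P \<noteq> U\<close>] by auto
      moreover have "\<bar>goeritz_index \<gamma> S u\<bar> = 1" using goeritz_index_cases[of u] by auto
      ultimately show ?thesis by (simp add: abs_mult)
    qed
    have ny: "\<bar>dehn_coeff y P\<bar> * \<bar>dehn_coeff y U\<bar> = 1" and nz: "\<bar>dehn_coeff z P\<bar> * \<bar>dehn_coeff z U\<bar> = 1"
      using abs_prod by blast+
    have sq: "dehn_coeff y U * dehn_coeff y U = 1" "dehn_coeff z U * dehn_coeff z U = 1"
    proof -
      have "\<bar>dehn_coeff y U\<bar> = 1" "\<bar>dehn_coeff z U\<bar> = 1"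
        using abs_zmult_eq_1[of "dehn_coeff y U" "dehn_coeff y P"] ny
          abs_zmult_eq_1[of "dehn_coeff z U" "dehn_coeff z P"] nz
            by (simp_all add: abs_mult mult.commute)
      then show "dehn_coeff y U * dehn_coeff y U = 1" "dehn_coeff z U * dehn_coeff z U = 1"
        by (metis abs_mult_self_eq mult_1)+
    qed
    \<comment> \<open>Among the rows of \<open>P\<close> only the two ends contribute to the column
      of \<open>U\<close>, so the vanishing sum is a relation between their signs.\<close>
    have rel: "s y * dehn_coeff y U = - (s z * dehn_coeff z U)"
      if "(\<Sum>x\<in>{x\<in>X. dehn_coeff x P \<noteq> 0}. s x * dehn_coeff x U) = 0" for s :: "real \<times> real \<Rightarrow> int"
    proof -
      have "(\<Sum>x\<in>{x\<in>X. dehn_coeff x P \<noteq> 0}. s x * dehn_coeff x U) = (\<Sum>x\<in>{y, z}. s x * dehn_coeff x U)"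
      proof (rule sum.mono_neutral_right)
        show "{y, z} \<subseteq> {x\<in>X. dehn_coeff x P \<noteq> 0}" using y z ny nz by auto
        show "\<forall>x\<in>{x\<in>X. dehn_coeff x P \<noteq> 0} - {y, z}. s x * dehn_coeff x U = 0"
        proof
          fix x assume x: "x \<in> {x\<in>X. dehn_coeff x P \<noteq> 0} - {y, z}"
          then have "goeritz_index \<gamma> S x * dehn_coeff x P * dehn_coeff x U = 0"
            using prod[of x] U by simp
          moreover have "goeritz_index \<gamma> S x \<noteq> 0" using goeritz_index_cases[of x] by auto
          ultimately show "s x * dehn_coeff x U = 0" using x by simp
        qed
      qed (simp add: finite_X)
      then show ?thesis using that False by simp
    qed
    have "(\<sigma> y * \<tau> y) * (dehn_coeff y U * dehn_coeff y U) = (\<sigma> y * dehn_coeff y U) * (\<tau> y * dehn_coeff y U)"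
      by (simp add: algebra_simps)
    also have "\<dots> = (\<sigma> z * \<tau> z) * (dehn_coeff z U * dehn_coeff z U)"
      unfolding rel[OF \<sigma>[OF U]] rel[OF \<tau>[OF U]] by (simp add: algebra_simps)
    finally show ?thesis unfolding sq by simp
  qed simp
qed

text \<open>The two shaded corners are opposite and carry opposite signs; the value 0 occurs when
  \<open>P\<close> fills both or neither.\<close>

lemma dehn_coeff_shaded:
  assumes "x \<in> X" "P \<in> S"
  shows "dehn_coeff x P \<in> {-1, 0, 1}"
proof (cases "corner x 1 1 \<in> S")
  case True
  then have "corner x 1 (-1) \<noteq> P" "corner x (-1) 1 \<noteq> P"
    using corner_shading[OF assms(1)] assms by auto
  then show ?thesis by (auto simp: dehn_coeff_def)
next
  case False
  then have "corner x 1 1 \<noteq> P" "corner x (-1) (-1) \<noteq> P"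
    using corner_shading[OF assms(1)] assms by auto
  then show ?thesis by (auto simp: dehn_coeff_def)
qed

text \<open>Two distinct shaded regions at a crossing fill one shaded corner each, and these corners
  have opposite signs. This is the source of the minus sign between the signed row sums and the
  Goeritz matrix.\<close>

lemma dehn_coeff_product:
  assumes "x \<in> X" "P \<in> S" "Q \<in> S" "P \<noteq> Q"
  shows "dehn_coeff x P * dehn_coeff x Q = - of_bool (meets x P \<and> meets x Q)"
proof (cases "corner x 1 1 \<in> S")
  case True
  then have "corner x 1 (-1) \<noteq> P" "corner x (-1) 1 \<noteq> P" "corner x 1 (-1) \<noteq> Q" "corner x (-1) 1 \<noteq> Q"
    using corner_shading[OF assms(1)] assms by auto
  then show ?thesis using assms(4) by (auto simp: dehn_coeff_def meets_def)
next
  case False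
  then have "corner x 1 1 \<noteq> P" "corner x (-1) (-1) \<noteq> P" "corner x 1 1 \<noteq> Q" "corner x (-1) (-1) \<noteq> Q"
    using corner_shading[OF assms(1)] assms by auto
  then show ?thesis using assms(4) by (auto simp: dehn_coeff_def meets_def)
qed

text \<open>Summed over all shaded regions, the two shaded corners cancel. This matches the
  vanishing row sums of the Goeritz matrix and takes care of its diagonal.\<close>

lemma dehn_coeff_sum_shaded:
  assumes "x \<in> X" "finite S"
  shows "(\<Sum>Q\<in>S. dehn_coeff x Q) = 0"
proof -
  have "(\<Sum>Q\<in>S. of_bool (c = Q)) = (of_bool (c \<in> S) :: int)" for c
    using assms(2) by (simp add: of_bool_def sum.delta')
  then show ?thesis using corner_shading[OF assms(1)]
    by (simp add: dehn_coeff_def sum.distrib sum_subtractf)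
qed

end

section \<open>The Goeritz matrix from signed sums of rows of the Dehn matrix\<close>

theorem theorem2:
  fixes \<gamma> :: "real \<Rightarrow> complex" and X :: "(real \<times> real) set"
    and S :: "complex set set" and R :: "nat \<Rightarrow> complex set" and b m :: nat
  assumes "knot_diagram \<gamma> X"
    and "prime_diagram \<gamma> X"
    and "checkerboard \<gamma> X S"
    and "bij_betw R {1..m} (regions \<gamma>)"
    and "bij_betw R {1..b} S"
  shows "(\<forall>j\<in>{1..b}.
            (\<exists>\<sigma>. admissible_signs \<gamma> X R b m j \<sigma>) \<and>
            (\<forall>\<sigma> \<tau>. admissible_signs \<gamma> X R b m j \<sigma> \<and> admissible_signs \<gamma> X R b m j \<tau> \<longrightarrow>
               ((\<forall>x\<in>nonzero_rows \<gamma> X R j. \<tau> x = \<sigma> x) \<or>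
                (\<forall>x\<in>nonzero_rows \<gamma> X R j. \<tau> x = - \<sigma> x)) \<and>
               ((\<forall>k\<in>{1..m}. signed_row_sum \<gamma> X R j \<tau> k = signed_row_sum \<gamma> X R j \<sigma> k) \<or>
                (\<forall>k\<in>{1..m}. signed_row_sum \<gamma> X R j \<tau> k = - signed_row_sum \<gamma> X R j \<sigma> k)))) \<and>
         (\<forall>v :: nat \<Rightarrow> nat \<Rightarrow> int.
            (\<forall>j\<in>{1..b}. \<exists>\<sigma>. admissible_signs \<gamma> X R b m j \<sigma> \<and>
                              (\<forall>k\<in>{1..m}. v j k = signed_row_sum \<gamma> X R j \<sigma> k)) \<longrightarrow>
            (\<forall>j0\<in>{1..b}. \<exists>\<epsilon> :: nat \<Rightarrow> int.
               (\<forall>j\<in>{1..b}. \<epsilon> j \<in> {1, -1}) \<and> \<epsilon> j0 = 1 \<and>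
               ((\<forall>j\<in>{1..b}. \<forall>k\<in>{1..b}. \<epsilon> j * v j k = goeritz_matrix \<gamma> X S R b j k) \<or>
                (\<forall>j\<in>{1..b}. \<forall>k\<in>{1..b}. \<epsilon> j * v j k = - goeritz_matrix \<gamma> X S R b j k)) \<and>
               (\<forall>j\<in>{1..b}. \<forall>k\<in>{b+1..m}. \<epsilon> j * v j k = 0)))"
proof -
  interpret prime_checkered_diagram \<gamma> X S
    using assms(1-3) by unfold_locales
  define N where "N j = {x \<in> X. dehn_coeff x (R j) \<noteq> 0}" for j
  have finN: "finite (N j)" for j using finite_X by (simp add: N_def)
  have fin: "finite S" "finite (regions \<gamma>)" using assms(4,5) bij_betw_finite by blast+
  have sub: "S \<subseteq> regions \<gamma>" using S_regions by blast
  have bm: "b \<le> m"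
    using card_mono[OF fin(2) sub] bij_betw_same_card[OF assms(4)] bij_betw_same_card[OF assms(5)]
      by simp
  have R_reg: "R k \<in> regions \<gamma>" if "k \<in> {1..m}" for k using assms(4) that
    by (rule bij_betwE[rule_format])
  have R_S: "R k \<in> S" if "k \<in> {1..b}" for k using assms(5) that by (rule bij_betwE[rule_format])
  have inj: "inj_on R {1..m}" using assms(4) by (rule bij_betw_imp_inj_on)
  have unshaded: "R ` {b+1..m} = regions \<gamma> - S"
  proof -
    have "{b+1..m} = {1..m} - {1..b}" by auto
    then show ?thesis
      using inj_on_image_set_diff[OF inj, of "{1..m}" "{1..b}"] bm
        bij_betw_imp_surj_on[OF assms(4)] bij_betw_imp_surj_on[OF assms(5)] by auto
  qed
  have rows: "nonzero_rows \<gamma> X R j = N j" if "j \<in> {1..b}" for j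
    using dehn_matrix_eq[of _ R j, OF _ S_regions[OF R_S[OF that]]]
      by (auto simp: nonzero_rows_def N_def)
  have row_sum: "signed_row_sum \<gamma> X R j \<sigma> k = (\<Sum>x\<in>N j. \<sigma> x * dehn_coeff x (R k))"
    if "j \<in> {1..b}" "k \<in> {1..m}" for j k \<sigma>
    unfolding signed_row_sum_def rows[OF that(1)]
    by (intro sum.cong refl) (simp add: N_def dehn_matrix_eq[of _ R k, OF _ R_reg[OF that(2)]])
  have admissible: "admissible_signs \<gamma> X R b m j \<sigma> \<longleftrightarrow> (\<forall>x\<in>N j. \<sigma> x \<in> {1, -1}) \<and>
      (\<forall>U\<in>regions \<gamma> - S. (\<Sum>x\<in>N j. \<sigma> x * dehn_coeff x U) = 0)" if "j \<in> {1..b}" for j \<sigma>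
    unfolding admissible_signs_def rows[OF that] unshaded[symmetric] using row_sum[OF that] by auto
  define sign where "sign j x = goeritz_index \<gamma> S x * dehn_coeff x (R j)" for j x
  \<comment> \<open>The chosen sign contains the coefficient at \<open>R j\<close>, which vanishes
    outside \<open>N j\<close>; so the sum may run over all crossings.\<close>
  have sign_sum: "(\<Sum>x\<in>N j. sign j x * dehn_coeff x U)
      = (\<Sum>x\<in>X. goeritz_index \<gamma> S x * dehn_coeff x (R j) * dehn_coeff x U)" for j U
    unfolding sign_def by (rule sum.mono_neutral_left) (auto simp: N_def finite_X)
  have sign_admissible: "admissible_signs \<gamma> X R b m j (sign j)" if "j \<in> {1..b}" for j
    unfolding admissible[OF that]
  proof (intro conjI ballI)
    fix x assume "x \<in> N j"
    then show "sign j x \<in> {1, -1}"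
      using dehn_coeff_shaded[OF _ R_S[OF that], of x] goeritz_index_cases[of x]
        by (auto simp: N_def sign_def)
  next
    fix U assume "U \<in> regions \<gamma> - S"
    then show "(\<Sum>x\<in>N j. sign j x * dehn_coeff x U) = 0"
      unfolding sign_sum using products_cancel[OF R_S[OF that]] by simp
  qed
  have off_diagonal: "goeritz_sum \<gamma> X S R j k
      = - (\<Sum>x\<in>X. goeritz_index \<gamma> S x * dehn_coeff x (R j) * dehn_coeff x (R k))"
    if "j \<in> {1..b}" "k \<in> {1..b}" "j \<noteq> k" for j k
  proof -
    have "R j \<noteq> R k" using inj_onD[OF inj, of j k] that bm by auto
    note prod = dehn_coeff_product[OF _ R_S[OF that(1)] R_S[OF that(2)] this]
    have "{x \<in> X. meets_crossing \<gamma> x (R j) \<and> meets_crossing \<gamma> x (R k)}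
        = {x \<in> X. meets x (R j) \<and> meets x (R k)}"
      using meets_crossing_iff[OF _ S_regions[OF R_S[OF that(1)]]]
        meets_crossing_iff[OF _ S_regions[OF R_S[OF that(2)]]] by blast
    then have "goeritz_sum \<gamma> X S R j k
        = (\<Sum>x\<in>X. if meets x (R j) \<and> meets x (R k) then goeritz_index \<gamma> S x else 0)"
      unfolding goeritz_sum_def
      using sum.inter_filter[OF finite_X] by simp
    also have "\<dots> = (\<Sum>x\<in>X. - (goeritz_index \<gamma> S x * dehn_coeff x (R j) * dehn_coeff x (R k)))"
      by (intro sum.cong refl) (simp add: mult.assoc prod)
    finally show ?thesis by (simp add: sum_negf)
  qed
  have matrix: "signed_row_sum \<gamma> X R j (sign j) k = - goeritz_matrix \<gamma> X S R b j k"
    if jk: "j \<in> {1..b}" "k \<in> {1..b}" for j k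
  proof -
    have lhs: "signed_row_sum \<gamma> X R j (sign j) k
        = (\<Sum>x\<in>X. goeritz_index \<gamma> S x * dehn_coeff x (R j) * dehn_coeff x (R k))"
      using row_sum[OF jk(1), of k] jk(2) bm sign_sum by simp
    show ?thesis
    proof (cases "j = k")
      case False
      then show ?thesis using lhs off_diagonal[OF jk] by (simp add: goeritz_matrix_def)
    next
      case True
      \<comment> \<open>In each row the shaded coefficients add up to zero, so the entry at
        \<open>R j\<close> is minus the sum of the others; the diagonal thereby reduces to the
        off-diagonal entries.\<close>
      have column: "(\<Sum>l\<in>{1..b} - {j}. dehn_coeff x (R l)) = - dehn_coeff x (R j)" if "x \<in> X" for x
        using dehn_coeff_sum_shaded[OF that fin(1)] sum.reindex_bij_betw[OF assms(5), of "dehn_coeff x"]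
          sum.remove[of "{1..b}" j "\<lambda>l. dehn_coeff x (R l)"] jk(1) by simp
      have "(\<Sum>l\<in>{1..b} - {j}. goeritz_sum \<gamma> X S R j l)
          = - (\<Sum>l\<in>{1..b} - {j}. \<Sum>x\<in>X. goeritz_index \<gamma> S x * dehn_coeff x (R j) * dehn_coeff x (R l))"
        using off_diagonal[OF jk(1)] by (simp add: sum_negf)
      also have "\<dots> = - (\<Sum>x\<in>X. \<Sum>l\<in>{1..b} - {j}. goeritz_index \<gamma> S x * dehn_coeff x (R j) * dehn_coeff x (R l))"
        by (subst sum.swap) simp
      also have "\<dots> = (\<Sum>x\<in>X. goeritz_index \<gamma> S x * dehn_coeff x (R j) * dehn_coeff x (R j))"
        unfolding sum_distrib_left[symmetric] sum_negf[symmetric]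
        by (intro sum.cong refl) (simp only: column mult_minus_right minus_minus)
      finally show ?thesis using lhs True by (simp add: goeritz_matrix_def)
    qed
  qed
  have unique: "(\<forall>x\<in>N j. \<tau> x = \<sigma> x) \<or> (\<forall>x\<in>N j. \<tau> x = - \<sigma> x)"
    if j: "j \<in> {1..b}" and adm: "admissible_signs \<gamma> X R b m j \<sigma>" "admissible_signs \<gamma> X R b m j \<tau>" for j \<sigma> \<tau>
  proof -
    have signs: "\<sigma> x \<in> {1, -1} \<and> \<tau> x \<in> {1, -1}" if "x \<in> N j" for x
      using adm that unfolding admissible[OF j] by blast
    have "\<sigma> x * \<tau> x = \<sigma> y * \<tau> y" if "x \<in> N j" "y \<in> N j" for x y
      using signs_unique[OF R_S[OF j], of \<sigma> \<tau> x y] adm that unfolding admissible[OF j] N_def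
        by blast
    \<comment> \<open>Both choices take only the values 1 and -1: product 1 everywhere means that
      they agree, product 1 nowhere that they are opposite.\<close>
    then have "(\<forall>x\<in>N j. \<sigma> x * \<tau> x = 1) \<or> (\<forall>x\<in>N j. \<sigma> x * \<tau> x \<noteq> 1)"
      by metis
    then show ?thesis
    proof (elim disjE)
      assume "\<forall>x\<in>N j. \<sigma> x * \<tau> x = 1"
      then have "\<forall>x\<in>N j. \<tau> x = \<sigma> x" using signs by fastforce
      then show ?thesis ..
    next
      assume "\<forall>x\<in>N j. \<sigma> x * \<tau> x \<noteq> 1"
      then have "\<forall>x\<in>N j. \<tau> x = - \<sigma> x" using signs by fastforce
      then show ?thesis ..
    qed
  qed
  have unique_sum: "(\<forall>k\<in>{1..m}. signed_row_sum \<gamma> X R j \<tau> k = signed_row_sum \<gamma> X R j \<sigma> k) \<or>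
      (\<forall>k\<in>{1..m}. signed_row_sum \<gamma> X R j \<tau> k = - signed_row_sum \<gamma> X R j \<sigma> k)"
    if j: "j \<in> {1..b}" and adm: "admissible_signs \<gamma> X R b m j \<sigma>" "admissible_signs \<gamma> X R b m j \<tau>" for j \<sigma> \<tau>
    using unique[OF that]
  proof (elim disjE)
    assume "\<forall>x\<in>N j. \<tau> x = \<sigma> x"
    then show ?thesis using row_sum[OF j] by simp
  next
    assume "\<forall>x\<in>N j. \<tau> x = - \<sigma> x"
    then show ?thesis using row_sum[OF j] by (simp add: sum_negf)
  qed
  have part2: "\<exists>\<epsilon> :: nat \<Rightarrow> int. (\<forall>j\<in>{1..b}. \<epsilon> j \<in> {1, -1}) \<and> \<epsilon> j0 = 1 \<and>
      ((\<forall>j\<in>{1..b}. \<forall>k\<in>{1..b}. \<epsilon> j * v j k = goeritz_matrix \<gamma> X S R b j k) \<or>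
       (\<forall>j\<in>{1..b}. \<forall>k\<in>{1..b}. \<epsilon> j * v j k = - goeritz_matrix \<gamma> X S R b j k)) \<and>
      (\<forall>j\<in>{1..b}. \<forall>k\<in>{b+1..m}. \<epsilon> j * v j k = 0)"
    if v: "\<forall>j\<in>{1..b}. \<exists>\<sigma>. admissible_signs \<gamma> X R b m j \<sigma> \<and> (\<forall>k\<in>{1..m}. v j k = signed_row_sum \<gamma> X R j \<sigma> k)"
      and j0: "j0 \<in> {1..b}" for v :: "nat \<Rightarrow> nat \<Rightarrow> int" and j0
  proof -
    have "\<exists>s\<in>{1, -1 :: int}. \<forall>k\<in>{1..m}. v j k = s * signed_row_sum \<gamma> X R j (sign j) k" if j: "j \<in> {1..b}" for j
    proof -
      obtain \<sigma> where \<sigma>: "admissible_signs \<gamma> X R b m j \<sigma>" "\<forall>k\<in>{1..m}. v j k = signed_row_sum \<gamma> X R j \<sigma> k"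
        using v j by blast
      show ?thesis using unique_sum[OF j sign_admissible[OF j] \<sigma>(1)] \<sigma>(2) by auto
    qed
    then obtain s where s: "\<And>j. j \<in> {1..b} \<Longrightarrow> s j \<in> {1, -1 :: int}"
      "\<And>j k. j \<in> {1..b} \<Longrightarrow> k \<in> {1..m} \<Longrightarrow> v j k = s j * signed_row_sum \<gamma> X R j (sign j) k"
        by metis
    have sq: "s j * s j = 1" if "j \<in> {1..b}" for j using s(1)[OF that] by auto
    \<comment> \<open>The factor \<open>s j\<close> relates \<open>v j\<close> to the sum with the
      signs \<open>sign j\<close>, and the additional factor \<open>s j0\<close> leaves the row
      \<open>v j0\<close> unchanged. It multiplies the whole matrix, which is why \<open>G\<close>
      and its negative both occur.\<close>
    have "s j0 * s j * v j k = - s j0 * goeritz_matrix \<gamma> X S R b j k"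
      if jk: "j \<in> {1..b}" "k \<in> {1..b}" for j k
    proof -
      have "s j0 * s j * v j k = s j0 * (s j * s j) * signed_row_sum \<gamma> X R j (sign j) k"
        using s(2)[OF jk(1), of k] jk(2) bm by (simp add: mult.assoc)
      then show ?thesis using sq[OF jk(1)] matrix[OF jk] by simp
    qed
    moreover have "v j k = 0" if jk: "j \<in> {1..b}" "k \<in> {b+1..m}" for j k
      using s(2)[OF jk(1), of k] jk(2) sign_admissible[OF jk(1)] unfolding admissible_signs_def by auto
    moreover have "s j0 * s j \<in> {1, -1}" if "j \<in> {1..b}" for j using s(1)[OF that] s(1)[OF j0]
      by auto
    ultimately show ?thesis using s(1)[OF j0] sq[OF j0]
      by (intro exI[of _ "\<lambda>j. s j0 * s j"]) auto
  qed
  show ?thesis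
  proof (intro conjI ballI allI impI; (elim conjE)?)
    show "\<exists>\<sigma>. admissible_signs \<gamma> X R b m j \<sigma>" if "j \<in> {1..b}" for j
      using sign_admissible[OF that] by blast
  next
    fix j \<sigma> \<tau> assume j: "j \<in> {1..b}" "admissible_signs \<gamma> X R b m j \<sigma>" "admissible_signs \<gamma> X R b m j \<tau>"
    show "(\<forall>x\<in>nonzero_rows \<gamma> X R j. \<tau> x = \<sigma> x) \<or> (\<forall>x\<in>nonzero_rows \<gamma> X R j. \<tau> x = - \<sigma> x)"
      unfolding rows[OF j(1)] using unique[OF j] .
    show "(\<forall>k\<in>{1..m}. signed_row_sum \<gamma> X R j \<tau> k = signed_row_sum \<gamma> X R j \<sigma> k) \<or>
      (\<forall>k\<in>{1..m}. signed_row_sum \<gamma> X R j \<tau> k = - signed_row_sum \<gamma> X R j \<sigma> k)"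
      using unique_sum[OF j] .
  qed (use part2 in blast)
qed


end
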